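(* Let $\{X_n\}_{n\ge 0}$ be a two-type branching process with immigration (with the notation fixed in the context) such that $f(\mathbf 0)=\mathbf 0$, the mean matrix $M$ is positively regular, and its maximal eigenvalue satisfies $\rho>1$. Assume that $h_0>0$ and that there is $0<\gamma<1$ such that $A^n\gamma^{-n}$ converges, as $n\to\infty$, to a matrix $P_0$ which is nonzero and has finite entries. Assume that $E_i\big((\mathbf 1\cdot Z_1)^{2s}\big)<\infty$ for $i=1,2$ and $E\big((\mathbf 1\cdot I_1)^{\kappa}\big)<\infty$ for some $s\ge1$, $\kappa\ge1$, and that $h_0\gamma\rho^{d}>1$, where $d=\min\{s,\kappa\}$. Let $\boldsymbol l=(l_1,l_2)\in\mathbb R^2$ be a nonzero vector with $l_1\neq l_2$. Then, for any $\varepsilon>0$ and $i=1,2$, $$\lim_{n\to\infty}(h_0\gamma)^{-n}P_i\Big(\Big|\frac{\boldsymbol l\cdot X_{n+1}}{\mathbf 1\cdot X_n}-\frac{\boldsymbol l\cdot(X_nM)}{\mathbf 1\cdot X_n}\Big|>\varepsilon\Big)=\sum_{\boldsymbol j\in\mathbb N^2\setminus\{\mathbf 0\}}\phi(\boldsymbol j,\varepsilon)\,r_{i,\boldsymbol j}<\infty,$$ and there is a positive integer $k_0$ such that $$\lim_{n\to\infty}(h_0\gamma)^{-n}P_i\Big(\Big|\frac{\boldsymbol l\cdot X_n}{\mathbf 1\cdot X_n}-\frac{\boldsymbol l\cdot\boldsymbol v}{\mathbf 1\cdot\boldsymbol v}\Big|>\varepsilon\Big)=(h_0\gamma)^{-k_0}\sum_{\boldsymbol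 j\in\mathbb N^2\setminus\{\mathbf 0\}}\hat\phi(\boldsymbol j,k_0,\varepsilon)\,r_{i,\boldsymbol j}<\infty,$$ where $$\phi(\boldsymbol j,\varepsilon)=P\big(|\boldsymbol l\cdot X_1-\boldsymbol l\cdot(\boldsymbol jM)|>\varepsilon(\mathbf 1\cdot\boldsymbol j)\,\big|\,X_0=\boldsymbol j\big),$$ $$\hat\phi(\boldsymbol j,k_0,\varepsilon)=P\Big(\Big|\frac{\boldsymbol l\cdot X_{k_0}}{\mathbf 1\cdot X_{k_0}}-\frac{\boldsymbol l\cdot\boldsymbol v}{\mathbf 1\cdot\boldsymbol v}\Big|>\varepsilon\,\Big|\,X_0=\boldsymbol j\Big),$$ and $$r_{i,\boldsymbol j}=\lim_{n\to\infty}\frac{P_i(X_n=\boldsymbol j)}{(h_0\gamma)^n}.$$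
   Context: $\mathbb N=\{0,1,2,\dots\}$, $\mathbf 1=(1,1)$, $\mathbf 0=(0,0)$, $e_1=(1,0)$, $e_2=(0,1)$; vectors are row vectors and $\cdot$ is the Euclidean inner product; $\boldsymbol s^{\boldsymbol j}=s_1^{j_1}s_2^{j_2}$. $\{Z_n\}_{n\ge0}$, $Z_n=(Z_n^{(1)},Z_n^{(2)})$, is a two-type Galton–Watson branching process: each particle of type $i$ independently produces, in the next generation, a random vector of offspring with law $P_i(j_1,j_2)=P(Z_1=(j_1,j_2)\mid Z_0=e_i)$. Its offspring generating functions are $f^{(i)}(\boldsymbol s)=f_1^{(i)}(\boldsymbol s)=\sum_{\boldsymbol j\in\mathbb N^2}P_i(j_1,j_2)s_1^{j_1}s_2^{j_2}$, $i=1,2$, $\boldsymbol s\in[0,1]^2$, and $f=(f^{(1)},f^{(2)})$. $I_1,I_2,\dots$ are i.i.d. $\mathbb N^2$-valued immigration vectors, independent of the reproduction, and $h_0=P(I_1=\mathbf 0)$. The process with immigration is $X_0=Z_0$, $X_n=Z_n+U_n^{(1)}+\cdots+U_n^{(n)}$ for $n\ge1$, where $U_n^{(k)}$ is the vector of numbers of descendants, in generation $n$, of the $k$-th immigration $I_k$ (so $U_n^{(n)}=I_n$); all particles reproduce independently with the same offspring laws. Equivalently, given $X_n=\boldsymbol j$, $X_{n+1}$ is the sum of the offspring vectors of the $j_1$ particles of type 1 and the $j_2$ particles of type 2 plus the independent vector $I_{n+1}$. $P_i$ and $E_i$ denote probability and expectation given $X_0=Z_0=e_i$; $P(\cdot\mid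 X_0=\boldsymbol j)$ refers to the process started from $\boldsymbol j$. With $D_{ij}(\boldsymbol s)=\partial f^{(i)}(\boldsymbol s)/\partial s_j$, set $A=(D_{ij}(\mathbf 0))_{i,j}$ and $M=(m_{ij})$, $m_{ij}=D_{ij}(\mathbf 1^-)$ (the mean matrix, with finite entries). Positively regular means that some power of $M$ has all entries strictly positive; $\rho$ is then the maximal (Perron–Frobenius) eigenvalue of $M$, with strictly positive left eigenvector $\boldsymbol v$ and right eigenvector $\boldsymbol u$ normalized by $\boldsymbol v\cdot\boldsymbol u=1$, $\boldsymbol u\cdot\mathbf 1=1$. The limit defining $r_{i,\boldsymbol j}$ exists under the stated assumptions on $h_0$ and $A$. *)

theory Defs
  imports "HOL-Probability.Probability"
begin

text \<open>The two types are the elements 1 and 2 of the numeral type \<^typ>\<open>2\<close>. Population vectors have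
  type \<^typ>\<open>nat ^ 2\<close>; real vectors
  have type \<^typ>\<open>real ^ 2\<close>. On both \<^term>\<open>1\<close> is the all-ones vector and \<^term>\<open>axis i 1\<close> the unit vector.
  Vectors are row vectors: \<^term>\<open>x v* M\<close> is the row vector x times the matrix M.\<close>

definition real_vec :: "nat ^ 2 \<Rightarrow> real ^ 2" where
  "real_vec j = (\<chi> i. real (j $ i))"

text \<open>The class operation \<open>^\<close> is componentwise on \<^typ>\<open>real ^ 2 ^ 2\<close>, hence an explicit matrix power.\<close>

primrec mat_power :: "real ^ 2 ^ 2 \<Rightarrow> nat \<Rightarrow> real ^ 2 ^ 2" where
  "mat_power A 0 = mat 1"
| "mat_power A (Suc n) = A ** mat_power A n"

definition positively_regular :: "real ^ 2 ^ 2 \<Rightarrow> bool" where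
  "positively_regular M \<longleftrightarrow> (\<exists>n. \<forall>i j. mat_power M n $ i $ j > 0)"

definition complex_eigenvalue :: "real ^ 2 ^ 2 \<Rightarrow> complex \<Rightarrow> bool" where
  "complex_eigenvalue M z \<longleftrightarrow>
     (\<exists>x :: complex ^ 2. x \<noteq> 0 \<and> (\<chi> i j. complex_of_real (M $ i $ j)) *v x = z *s x)"

definition maximal_eigenvalue :: "real ^ 2 ^ 2 \<Rightarrow> real \<Rightarrow> bool" where
  "maximal_eigenvalue M \<rho> \<longleftrightarrow>
     complex_eigenvalue M (complex_of_real \<rho>) \<and> (\<forall>z. complex_eigenvalue M z \<longrightarrow> cmod z \<le> \<rho>)"

definition offspring_gf :: "(2 \<Rightarrow> (nat ^ 2) pmf) \<Rightarrow> 2 \<Rightarrow> real ^ 2 \<Rightarrow> real" where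
  "offspring_gf P i s = (\<Sum>\<^sub>\<infinity>j\<in>UNIV. pmf (P i) j * (\<Prod>k\<in>UNIV. (s $ k) ^ (j $ k)))"

text \<open>The generating functions live on the unit square, so the partial derivatives are taken
  within \<open>[0, 1]\<close>, that is, one-sided at the boundary.\<close>

definition partial_deriv :: "(real ^ 2 \<Rightarrow> real) \<Rightarrow> 2 \<Rightarrow> real ^ 2 \<Rightarrow> real" where
  "partial_deriv F j s =
     vector_derivative (\<lambda>t. F (\<chi> k. if k = j then t else s $ k)) (at (s $ j) within {0..1})"

definition derivative_matrix :: "(2 \<Rightarrow> (nat ^ 2) pmf) \<Rightarrow> real ^ 2 \<Rightarrow> real ^ 2 ^ 2" where
  "derivative_matrix P s = (\<chi> i j. partial_deriv (offspring_gf P i) j s)"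

text \<open>\<open>M\<close> is the matrix of the limits of the partial derivatives as both coordinates
  increase to 1; since \<open>M\<close> is real, these limits are finite.\<close>

definition is_mean_matrix :: "(2 \<Rightarrow> (nat ^ 2) pmf) \<Rightarrow> real ^ 2 ^ 2 \<Rightarrow> bool" where
  "is_mean_matrix P M \<longleftrightarrow>
     (derivative_matrix P \<longlongrightarrow> M) (at 1 within {s. \<forall>k. 0 \<le> s $ k \<and> s $ k < 1})"

text \<open>\<open>gw x z t\<close> is generation \<open>t\<close> of the population founded by \<open>z\<close>, where \<open>x t i k\<close> is the
  offspring vector of the \<open>k\<close>-th particle of type \<open>i\<close> in generation \<open>t\<close>.\<close>

primrec gw :: "(nat \<Rightarrow> 2 \<Rightarrow> nat \<Rightarrow> nat ^ 2) \<Rightarrow> nat ^ 2 \<Rightarrow> nat \<Rightarrow> nat ^ 2" where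
  "gw x z 0 = z"
| "gw x z (Suc t) = (\<Sum>i\<in>UNIV. \<Sum>k<gw x z t $ i. x t i k)"

text \<open>\<open>\<xi> c t i k\<close> is the offspring vector of the \<open>k\<close>-th particle of type \<open>i\<close> in the clan \<open>c\<close> at
  age \<open>t\<close> of that clan. Clan 0 descends from the initial population, clan \<open>c \<ge> 1\<close> from the
  immigrants \<open>I c\<close>, who arrive at time \<open>c\<close>. The initial state is a parameter of the processes,
  so that \<open>P(\<cdot> | X\<^sub>0 = j)\<close> is the law, on one and the same probability space, of
  the process started in \<open>j\<close>.\<close>

definition Z_proc ::
  "(nat \<Rightarrow> nat \<Rightarrow> 2 \<Rightarrow> nat \<Rightarrow> 'w \<Rightarrow> nat ^ 2) \<Rightarrow> nat ^ 2 \<Rightarrow> nat \<Rightarrow> 'w \<Rightarrow> nat ^ 2" where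
  "Z_proc \<xi> j n \<omega> = gw (\<lambda>t i k. \<xi> 0 t i k \<omega>) j n"

definition U_proc ::
  "(nat \<Rightarrow> nat \<Rightarrow> 2 \<Rightarrow> nat \<Rightarrow> 'w \<Rightarrow> nat ^ 2) \<Rightarrow> (nat \<Rightarrow> 'w \<Rightarrow> nat ^ 2) \<Rightarrow>
     nat \<Rightarrow> nat \<Rightarrow> 'w \<Rightarrow> nat ^ 2" where
  "U_proc \<xi> I c n \<omega> = gw (\<lambda>t i k. \<xi> c t i k \<omega>) (I c \<omega>) (n - c)"

definition X_proc ::
  "(nat \<Rightarrow> nat \<Rightarrow> 2 \<Rightarrow> nat \<Rightarrow> 'w \<Rightarrow> nat ^ 2) \<Rightarrow> (nat \<Rightarrow> 'w \<Rightarrow> nat ^ 2) \<Rightarrow>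
     nat ^ 2 \<Rightarrow> nat \<Rightarrow> 'w \<Rightarrow> nat ^ 2" where
  "X_proc \<xi> I j n \<omega> = Z_proc \<xi> j n \<omega> + (\<Sum>c = 1..n. U_proc \<xi> I c n \<omega>)"

text \<open>Only \<open>I 1, I 2, \<dots>\<close> are used; \<open>I 0\<close> is unconstrained.\<close>

locale branching_with_immigration = prob_space \<Omega>
  for \<Omega> :: "'w measure"
  and P :: "2 \<Rightarrow> (nat ^ 2) pmf"
  and \<xi> :: "nat \<Rightarrow> nat \<Rightarrow> 2 \<Rightarrow> nat \<Rightarrow> 'w \<Rightarrow> nat ^ 2"
  and I :: "nat \<Rightarrow> 'w \<Rightarrow> nat ^ 2" +
  assumes independent:
    "indep_vars (\<lambda>_. count_space UNIV)
       (\<lambda>a. case a of Inl c \<Rightarrow> I c | Inr (c, t, i, k) \<Rightarrow> \<xi> c t i k) (Inl ` {1..} \<union> range Inr)"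
  and offspring_law: "distr \<Omega> (count_space UNIV) (\<xi> c t i k) = measure_pmf (P i)"
  and immigration_law:
    "c \<ge> 1 \<Longrightarrow> distr \<Omega> (count_space UNIV) (I c) = distr \<Omega> (count_space UNIV) (I 1)"

end

(* Let |x| be the population size; it never decreases because no particle dies childless. On the
   level {|x| = m} the transition matrix scaled by h0 \<gamma> is a contraction for m \<ge> 2 and equals
   A / \<gamma> for m = 1, so P_i(X_n = j) / (h0 \<gamma>)^n converges by induction on the level. The function
   (u . x)^(-e), with e slightly below d = min s \<kappa> so that still h0 \<gamma> \<rho>^e > 1, is a Lyapunov
   function: one step multiplies its mean by about \<rho>^(-e) < h0 \<gamma> when |x| is large. Hence
   E_i |X_n|^(-e) = O((h0 \<gamma>)^n), and limit and sum may be exchanged for every weight that is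
   O(|x|^(-d)). The moment inequality E|S_n|^(2s) = O(n^s) for centered sums shows that \<phi> is such a
   weight. For the second limit, the part of x orthogonal to v relative to u . x contracts by a
   factor below 1 in each step outside an event of probability O(|x|^(-d)); after k0 steps it is
   below the threshold, so \<phi>h with k0 steps is also such a weight. *)

theory Submission
  imports Defs
begin

section \<open>Moments of sums of independent variables\<close>

text \<open>To stay on level {|x| = m}, every particle must have exactly one child and no immigrant
  may arrive, so the scaled level matrix has size about \<open>\<gamma>^(m-1)\<close>. For m = 1
  nothing contracts, and convergence is just the hypothesis on \<open>A^n / \<gamma>^n\<close>.
  Since \<open>A\<close> may be reducible, no positive eigenvector is at hand; a positive weight
  that is subinvariant with a rate g > \<gamma> replaces it, and g^2 < \<gamma> is enough for m
  \<ge> 2. The exponent d comes from concentration of one step: offspring moments of order 2s give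
  |x|^(-s), immigration moments of order \<kappa> give |x|^(-\<kappa>). Taking e < d strictly leaves
  a factor |x|^(-(d-e)) tending to 0, the uniform smallness of tails that the exchange of limit and
  sum needs. The drift estimate holds only for large |x|; the finitely many small states are
  controlled by the convergence on the levels. One step is not enough for the second limit: a large
  population x of atypical composition moves close to xM, not to the direction of v. So k0 depends
  on \<epsilon> and l.\<close>

lemma exp_le_quadratic:
  fixes w b :: real
  assumes "\<bar>w\<bar> \<le> b"
  shows "exp w \<le> 1 + w + w\<^sup>2 * exp b"
proof -
  obtain t where t: "\<bar>t\<bar> \<le> \<bar>w\<bar>" "exp w = (\<Sum>m<2. w ^ m / fact m) + exp t / fact 2 * w ^ 2"
    using Maclaurin_exp_le[of w 2] by auto
  have "exp t \<le> exp b" using t(1) assms by simp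
  then have "exp t / 2 \<le> exp b" using exp_gt_zero[of t] by linarith
  then have "exp t / 2 * w\<^sup>2 \<le> exp b * w\<^sup>2"
    by (intro mult_right_mono) auto
  then show ?thesis
    using t(2) by (simp add: numeral_2_eq_2 mult.commute)
qed

text \<open>The linear coefficient must be exactly p, because only the linear term will vanish in
  expectation. For |z| \<le> 1/2 this is a second-order expansion of exp (p ln (1 + z)); for larger
  |z|, |1 + z| \<le> 3 |z| and |z| \<le> (2 |z|)^p let the power term absorb everything.\<close>

lemma abs_one_add_powr_le:
  fixes z p C :: real
  assumes p: "p \<ge> 2" and C: "C = p\<^sup>2 * exp p + 3 powr p + p * 2 powr p"
  shows "\<bar>1 + z\<bar> powr p \<le> 1 + p * z + C * (z\<^sup>2 + \<bar>z\<bar> powr p)"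
proof (cases "\<bar>z\<bar> \<le> 1 / 2")
  case True
  then have pos: "1 + z > 0" by auto
  have "\<bar>1 + z\<bar> powr p = exp (p * ln (1 + z))"
    using pos by (simp add: powr_def)
  also have "\<dots> \<le> exp (p * z)"
    using p pos ln_le_minus_one[OF pos] by simp
  also have "\<dots> \<le> 1 + p * z + (p * z)\<^sup>2 * exp p"
  proof (rule exp_le_quadratic)
    have "p * \<bar>z\<bar> \<le> p * 1"
      using p True by (intro mult_left_mono) auto
    then show "\<bar>p * z\<bar> \<le> p"
      using p by (simp add: abs_mult)
  qed
  also have "(p * z)\<^sup>2 * exp p = (p\<^sup>2 * exp p) * z\<^sup>2"
    by (simp add: power_mult_distrib)
  also have "\<dots> \<le> C * z\<^sup>2"
    using p unfolding C by (intro mult_right_mono) auto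
  also have "\<dots> \<le> C * (z\<^sup>2 + \<bar>z\<bar> powr p)"
    using p unfolding C by (intro mult_left_mono) auto
  finally show ?thesis by simp
next
  case False
  then have z: "\<bar>z\<bar> > 1 / 2" by simp
  have C': "C \<ge> 3 powr p + p * 2 powr p" and C0: "C \<ge> 0"
    using p unfolding C by auto
  have "\<bar>1 + z\<bar> powr p \<le> (3 * \<bar>z\<bar>) powr p"
    using z p by (intro powr_mono2) auto
  also have "\<dots> = 3 powr p * \<bar>z\<bar> powr p"
    by (simp add: powr_mult)
  finally have 1: "\<bar>1 + z\<bar> powr p \<le> 3 powr p * \<bar>z\<bar> powr p" .
  have "(2 * \<bar>z\<bar>) powr 1 \<le> (2 * \<bar>z\<bar>) powr p"
    using z p by (intro powr_mono) auto
  then have "\<bar>z\<bar> \<le> 2 powr p * \<bar>z\<bar> powr p"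
    using z by (simp add: powr_mult)
  then have "p * \<bar>z\<bar> \<le> p * (2 powr p * \<bar>z\<bar> powr p)"
    using p by (intro mult_left_mono) auto
  moreover have "- (p * z) \<le> p * \<bar>z\<bar>"
    using p mult_left_mono[of "- z" "\<bar>z\<bar>" p] by simp
  ultimately have 2: "0 \<le> p * z + p * 2 powr p * \<bar>z\<bar> powr p" by simp
  have "\<bar>1 + z\<bar> powr p \<le> 1 + p * z + (3 powr p + p * 2 powr p) * \<bar>z\<bar> powr p"
    using 1 2 by (simp add: algebra_simps)
  also have "(3 powr p + p * 2 powr p) * \<bar>z\<bar> powr p \<le> C * \<bar>z\<bar> powr p"
    using C' by (intro mult_right_mono) auto
  also have "C * \<bar>z\<bar> powr p \<le> C * (z\<^sup>2 + \<bar>z\<bar> powr p)"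
    using C0 by (intro mult_left_mono) auto
  finally show ?thesis by simp
qed

text \<open>The previous bound scaled by |x|. The factor of y in the linear term depends on x alone,
  so for independent x and centred y this term has expectation 0.\<close>

lemma abs_add_powr_le:
  fixes p :: real
  assumes p: "p \<ge> 2"
  obtains C where "C \<ge> 0" and "\<And>x y :: real. \<bar>x + y\<bar> powr p \<le>
    \<bar>x\<bar> powr p + p * (\<bar>x\<bar> powr (p - 2) * x) * y + C * (\<bar>x\<bar> powr (p - 2) * y\<^sup>2 + \<bar>y\<bar> powr p)"
proof -
  define C where "C = p\<^sup>2 * exp p + 3 powr p + p * 2 powr p"
  have "1 \<le> p * 2 powr p"
    using p ge_one_powr_ge_zero[of 2 p] mult_mono[of 1 p 1 "2 powr p"] by simp
  then have C1: "C \<ge> 1" unfolding C_def by (simp add: add_increasing)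
  have "\<bar>x + y\<bar> powr p \<le>
      \<bar>x\<bar> powr p + p * (\<bar>x\<bar> powr (p - 2) * x) * y + C * (\<bar>x\<bar> powr (p - 2) * y\<^sup>2 + \<bar>y\<bar> powr p)" for x y
  proof (cases "x = 0")
    case True
    \<comment> \<open>Since \<open>0 powr q = 0\<close> for every q, also for q = 0, the right side
      is just C |y|^p; hence the need for C \<ge> 1.\<close>
    have "1 * \<bar>y\<bar> powr p \<le> C * \<bar>y\<bar> powr p"
      using C1 by (intro mult_right_mono) auto
    then show ?thesis using True p by simp
  next
    case False
    define z where "z = y / x"
    have y: "y = x * z" using False by (simp add: z_def)
    have sq: "\<bar>x\<bar> powr (p - 2) * x\<^sup>2 = \<bar>x\<bar> powr p"
      using False powr_add[of "\<bar>x\<bar>" "p - 2" 2] by simp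
    have "\<bar>x + y\<bar> powr p = \<bar>x\<bar> powr p * \<bar>1 + z\<bar> powr p"
    proof -
      have "\<bar>x + y\<bar> = \<bar>x\<bar> * \<bar>1 + z\<bar>" unfolding y by (simp add: distrib_left flip: abs_mult)
      then show ?thesis by (simp add: powr_mult)
    qed
    also have "\<dots> \<le> \<bar>x\<bar> powr p * (1 + p * z + C * (z\<^sup>2 + \<bar>z\<bar> powr p))"
      by (intro mult_left_mono abs_one_add_powr_le p C_def) auto
    also have "\<dots> = \<bar>x\<bar> powr p + p * (\<bar>x\<bar> powr p * z) + C * (\<bar>x\<bar> powr p * z\<^sup>2 + \<bar>x\<bar> powr p * \<bar>z\<bar> powr p)"
      by (simp add: algebra_simps)
    also have "\<bar>x\<bar> powr p * \<bar>z\<bar> powr p = \<bar>y\<bar> powr p"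
      unfolding y by (simp add: abs_mult powr_mult)
    also have "\<bar>x\<bar> powr p * z = \<bar>x\<bar> powr (p - 2) * x * y"
      unfolding y sq[symmetric] by (simp add: power2_eq_square)
    also have "\<bar>x\<bar> powr p * z\<^sup>2 = \<bar>x\<bar> powr (p - 2) * y\<^sup>2"
      unfolding y sq[symmetric] by (simp add: power2_eq_square)
    finally show ?thesis by (simp add: mult.assoc)
  qed
  then show ?thesis using that[of C] C1 by auto
qed

text \<open>Truncation at level a. The level stays free so that it can later grow with the number of
  summands.\<close>

lemma powr_le_split:
  fixes x a p q :: real
  assumes "x \<ge> 0" "a > 0" "0 \<le> q" "q \<le> p"
  shows "x powr q \<le> x powr p / a powr (p - q) + a powr q"
proof (cases "x \<ge> a")
  case True
  then have "x > 0" using assms by simp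
  have "x powr q * a powr (p - q) \<le> x powr q * x powr (p - q)"
    using True assms by (intro mult_left_mono powr_mono2) auto
  also have "\<dots> = x powr p"
    by (simp flip: powr_add)
  finally have "x powr q \<le> x powr p / a powr (p - q)"
    using assms by (simp add: field_simps)
  then show ?thesis by (simp add: add_increasing2)
next
  case False
  then have "x powr q \<le> a powr q"
    using assms by (intro powr_mono2) auto
  then show ?thesis by (simp add: add_increasing)
qed

lemma powr_le_one_add_powr:
  fixes x p q :: real
  assumes "x \<ge> 0" "0 \<le> q" "q \<le> p"
  shows "x powr q \<le> 1 + x powr p"
proof -
  have "x powr q \<le> x powr p / 1 powr (p - q) + 1 powr q"
    by (rule powr_le_split) (use assms in simp_all)
  then show ?thesis by simp
qed

context prob_space
begin

lemma indep_var_commute: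
  assumes "indep_var S X T Y"
  shows "indep_var T Y S X"
  using assms unfolding indep_var_eq indep_sets2_eq
proof (elim conjE, intro conjI ballI)
  fix a b
  assume "a \<in> sigma_sets (space M) {Y -` A \<inter> space M |A. A \<in> sets T}"
    and "b \<in> sigma_sets (space M) {X -` A \<inter> space M |A. A \<in> sets S}"
    and "\<forall>a\<in>sigma_sets (space M) {X -` A \<inter> space M |A. A \<in> sets S}.
       \<forall>b\<in>sigma_sets (space M) {Y -` A \<inter> space M |A. A \<in> sets T}. prob (a \<inter> b) = prob a * prob b"
  then have "prob (b \<inter> a) = prob b * prob a" by blast
  then show "prob (a \<inter> b) = prob a * prob b" by (simp only: Int_commute mult.commute)
qed

lemma integrable_powr_le:
  fixes f :: "'a \<Rightarrow> real"
  assumes "integrable M (\<lambda>\<omega>. \<bar>f \<omega>\<bar> powr p)" "random_variable borel f" "0 \<le> q" "q \<le> p"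
  shows "integrable M (\<lambda>\<omega>. \<bar>f \<omega>\<bar> powr q)"
proof (rule Bochner_Integration.integrable_bound)
  show "integrable M (\<lambda>\<omega>. 1 + \<bar>f \<omega>\<bar> powr p)"
    using assms(1) by simp
  have "norm (\<bar>f \<omega>\<bar> powr q) \<le> norm (1 + \<bar>f \<omega>\<bar> powr p)" for \<omega>
    using powr_le_one_add_powr[of "\<bar>f \<omega>\<bar>" q p] assms(3,4) by simp
  then show "AE \<omega> in M. norm (\<bar>f \<omega>\<bar> powr q) \<le> norm (1 + \<bar>f \<omega>\<bar> powr p)"
    by blast
qed (use assms(2) in measurable)

lemma integrable_of_abs_powr:
  fixes f :: "'a \<Rightarrow> real"
  assumes "integrable M (\<lambda>\<omega>. \<bar>f \<omega>\<bar> powr p)" "random_variable borel f" "1 \<le> p"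
  shows "integrable M f"
proof (rule integrable_abs_cancel)
  show "integrable M (\<lambda>\<omega>. \<bar>f \<omega>\<bar>)"
    using integrable_powr_le[OF assms(1,2), of 1] assms(3) by simp
qed (rule assms(2))

text \<open>One induction step of the moment inequality. Independence removes the linear term and
  factors the quadratic one into E|S|^(p-2) and E Y^2; truncation at a trades E|S|^(p-2) for E|S|^p
  / a^2, whose weight can be made small.\<close>

lemma moment_add_indep:
  fixes S Y :: "'a \<Rightarrow> real" and p C a :: real
  assumes p: "p \<ge> 2" and a: "a > 0" and C0: "C \<ge> 0"
    and C: "\<And>x y :: real. \<bar>x + y\<bar> powr p \<le>
      \<bar>x\<bar> powr p + p * (\<bar>x\<bar> powr (p - 2) * x) * y + C * (\<bar>x\<bar> powr (p - 2) * y\<^sup>2 + \<bar>y\<bar> powr p)"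
    and ind: "indep_var borel S borel Y"
    and S: "integrable M (\<lambda>\<omega>. \<bar>S \<omega>\<bar> powr p)" and Y: "integrable M (\<lambda>\<omega>. \<bar>Y \<omega>\<bar> powr p)"
    and Y0: "expectation Y = 0" and Y1: "expectation (\<lambda>\<omega>. \<bar>Y \<omega>\<bar> powr p) \<le> b"
  shows "integrable M (\<lambda>\<omega>. \<bar>S \<omega> + Y \<omega>\<bar> powr p)" (is ?int)
    and "expectation (\<lambda>\<omega>. \<bar>S \<omega> + Y \<omega>\<bar> powr p) \<le> expectation (\<lambda>\<omega>. \<bar>S \<omega>\<bar> powr p) +
      C * (1 + b) * (expectation (\<lambda>\<omega>. \<bar>S \<omega>\<bar> powr p) / a\<^sup>2 + a powr (p - 2)) + C * b" (is ?le)
proof -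
  have [measurable]: "random_variable borel S" "random_variable borel Y"
    using indep_var_rv1[OF ind] indep_var_rv2[OF ind] .
  define g where "g = (\<lambda>x :: real. \<bar>x\<bar> powr (p - 2) * x)"
  define q where "q = (\<lambda>x :: real. \<bar>x\<bar> powr (p - 2))"
  have [measurable]: "g \<in> borel_measurable borel" "q \<in> borel_measurable borel"
    unfolding g_def q_def by measurable
  have absg: "\<bar>g x\<bar> = \<bar>x\<bar> powr (p - 1)" for x
    using powr_add[of "\<bar>x\<bar>" "p - 2" 1] by (simp add: g_def abs_mult)
  have intg: "integrable M (\<lambda>\<omega>. g (S \<omega>))"
  proof (rule integrable_abs_cancel)
    show "integrable M (\<lambda>\<omega>. \<bar>g (S \<omega>)\<bar>)"
      unfolding absg using integrable_powr_le[OF S, of "p - 1"] p by simp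
  qed simp
  have intq: "integrable M (\<lambda>\<omega>. q (S \<omega>))"
    unfolding q_def using integrable_powr_le[OF S, of "p - 2"] p by simp
  have intY: "integrable M Y"
    by (rule integrable_of_abs_powr[OF Y]) (use p in simp_all)
  have intY2: "integrable M (\<lambda>\<omega>. (Y \<omega>)\<^sup>2)"
    using integrable_powr_le[OF Y, of 2] p by simp
  have i1: "indep_var borel (\<lambda>\<omega>. g (S \<omega>)) borel Y"
    by (rule indep_var_compose[OF ind, of g borel "\<lambda>x. x" borel, unfolded o_def]) measurable
  have i2: "indep_var borel (\<lambda>\<omega>. q (S \<omega>)) borel (\<lambda>\<omega>. (Y \<omega>)\<^sup>2)"
    by (rule indep_var_compose[OF ind, of q borel "\<lambda>x. x\<^sup>2" borel, unfolded o_def]) measurable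
  have intgY: "integrable M (\<lambda>\<omega>. g (S \<omega>) * Y \<omega>)" and EgY: "expectation (\<lambda>\<omega>. g (S \<omega>) * Y \<omega>) = 0"
    by (rule indep_var_integrable[OF i1 intg intY], subst indep_var_lebesgue_integral[OF i1 intg intY], simp add: Y0)
  have intqY: "integrable M (\<lambda>\<omega>. q (S \<omega>) * (Y \<omega>)\<^sup>2)"
    and EqY: "expectation (\<lambda>\<omega>. q (S \<omega>) * (Y \<omega>)\<^sup>2) = expectation (\<lambda>\<omega>. q (S \<omega>)) * expectation (\<lambda>\<omega>. (Y \<omega>)\<^sup>2)"
    by (rule indep_var_integrable[OF i2 intq intY2], rule indep_var_lebesgue_integral[OF i2 intq intY2])
  let ?R = "\<lambda>\<omega>. \<bar>S \<omega>\<bar> powr p + p * (g (S \<omega>) * Y \<omega>) + C * (q (S \<omega>) * (Y \<omega>)\<^sup>2 + \<bar>Y \<omega>\<bar> powr p)"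
  have R: "\<bar>S \<omega> + Y \<omega>\<bar> powr p \<le> ?R \<omega>" for \<omega>
    using C[of "S \<omega>" "Y \<omega>"] by (simp add: g_def q_def mult.assoc)
  have intR: "integrable M ?R"
    using S intgY intqY Y by simp
  show int: ?int
  proof (rule Bochner_Integration.integrable_bound[OF intR])
    have "norm (\<bar>S \<omega> + Y \<omega>\<bar> powr p) \<le> norm (?R \<omega>)" for \<omega>
      using R[of \<omega>] by simp
    then show "AE \<omega> in M. norm (\<bar>S \<omega> + Y \<omega>\<bar> powr p) \<le> norm (?R \<omega>)" by blast
  qed measurable
  have Y2: "expectation (\<lambda>\<omega>. (Y \<omega>)\<^sup>2) \<le> 1 + b"
  proof -
    have "expectation (\<lambda>\<omega>. (Y \<omega>)\<^sup>2) \<le> expectation (\<lambda>\<omega>. 1 + \<bar>Y \<omega>\<bar> powr p)"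
    proof (rule integral_mono[OF intY2])
      show "(Y \<omega>)\<^sup>2 \<le> 1 + \<bar>Y \<omega>\<bar> powr p" for \<omega>
        using powr_le_one_add_powr[of "\<bar>Y \<omega>\<bar>" 2 p] p by simp
    qed (use Y in simp)
    also have "\<dots> \<le> 1 + b" using Y Y1 by (simp add: prob_space)
    finally show ?thesis .
  qed
  have Eq: "expectation (\<lambda>\<omega>. q (S \<omega>)) \<le> expectation (\<lambda>\<omega>. \<bar>S \<omega>\<bar> powr p) / a\<^sup>2 + a powr (p - 2)"
  proof -
    have "expectation (\<lambda>\<omega>. q (S \<omega>)) \<le> expectation (\<lambda>\<omega>. \<bar>S \<omega>\<bar> powr p / a\<^sup>2 + a powr (p - 2))"
    proof (rule integral_mono[OF intq])
      show "q (S \<omega>) \<le> \<bar>S \<omega>\<bar> powr p / a\<^sup>2 + a powr (p - 2)" for \<omega>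
        using powr_le_split[of "\<bar>S \<omega>\<bar>" a "p - 2" p] p a by (simp add: q_def)
    qed (use S in simp)
    also have "\<dots> = expectation (\<lambda>\<omega>. \<bar>S \<omega>\<bar> powr p) / a\<^sup>2 + a powr (p - 2)"
      using S by (simp add: prob_space)
    finally show ?thesis .
  qed
  have "expectation (\<lambda>\<omega>. q (S \<omega>)) * expectation (\<lambda>\<omega>. (Y \<omega>)\<^sup>2) \<le>
      (expectation (\<lambda>\<omega>. \<bar>S \<omega>\<bar> powr p) / a\<^sup>2 + a powr (p - 2)) * (1 + b)"
    by (intro mult_mono Eq Y2) (auto intro!: add_nonneg_nonneg divide_nonneg_nonneg Bochner_Integration.integral_nonneg)
  then have "C * (expectation (\<lambda>\<omega>. q (S \<omega>)) * expectation (\<lambda>\<omega>. (Y \<omega>)\<^sup>2) + expectation (\<lambda>\<omega>. \<bar>Y \<omega>\<bar> powr p))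
     \<le> C * ((expectation (\<lambda>\<omega>. \<bar>S \<omega>\<bar> powr p) / a\<^sup>2 + a powr (p - 2)) * (1 + b) + b)"
    using Y1 C0 by (intro mult_left_mono add_mono) auto
  moreover have "expectation (\<lambda>\<omega>. \<bar>S \<omega> + Y \<omega>\<bar> powr p) \<le> expectation ?R"
    by (intro integral_mono int intR R)
  moreover have "expectation ?R = expectation (\<lambda>\<omega>. \<bar>S \<omega>\<bar> powr p) +
     C * (expectation (\<lambda>\<omega>. q (S \<omega>)) * expectation (\<lambda>\<omega>. (Y \<omega>)\<^sup>2) + expectation (\<lambda>\<omega>. \<bar>Y \<omega>\<bar> powr p))"
    using S intgY intqY Y EgY EqY by simp
  ultimately show ?le by (simp add: algebra_simps)
qed

text \<open>A Marcinkiewicz-Zygmund type bound. K is quantified before the index set because one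
  constant must serve populations of every size.\<close>

lemma moment_sum_indep:
  fixes p b :: real
  assumes p: "p \<ge> 2" and b: "b \<ge> 0"
  shows "\<exists>K\<ge>0. \<forall>B (Y :: 'b \<Rightarrow> 'a \<Rightarrow> real). finite B \<longrightarrow> indep_vars (\<lambda>_. borel) Y B \<longrightarrow>
      (\<forall>x\<in>B. integrable M (\<lambda>\<omega>. \<bar>Y x \<omega>\<bar> powr p)) \<longrightarrow>
      (\<forall>x\<in>B. expectation (\<lambda>\<omega>. \<bar>Y x \<omega>\<bar> powr p) \<le> b) \<longrightarrow>
      (\<forall>x\<in>B. expectation (Y x) = 0) \<longrightarrow>
      integrable M (\<lambda>\<omega>. \<bar>\<Sum>x\<in>B. Y x \<omega>\<bar> powr p) \<and>
      expectation (\<lambda>\<omega>. \<bar>\<Sum>x\<in>B. Y x \<omega>\<bar> powr p) \<le> K * real (card B) powr (p / 2)"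
proof -
  obtain C where C0: "C \<ge> 0" and C: "\<And>x y :: real. \<bar>x + y\<bar> powr p \<le>
    \<bar>x\<bar> powr p + p * (\<bar>x\<bar> powr (p - 2) * x) * y + C * (\<bar>x\<bar> powr (p - 2) * y\<^sup>2 + \<bar>y\<bar> powr p)"
    using abs_add_powr_le[OF p] by blast
  \<comment> \<open>D dominates both constants of the induction step. With A = 2D the term D * (K N
    / A) is half of K N; K is large enough for the remaining terms to fit into the other half, and
    its summand b covers a single variable.\<close>
  define D where "D = C * (1 + b) + 1"
  define A where "A = 2 * D"
  define K where "K = 2 * (D * A powr (p / 2 - 1) + D) + b"
  have D: "D \<ge> 1" "C * (1 + b) \<le> D" "C * b \<le> D"
    using C0 b by (auto simp: D_def algebra_simps)
  have K: "K \<ge> 0" "b \<le> K" "D * A powr (p / 2 - 1) + D \<le> K / 2"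
    using b D by (auto simp: K_def)
  have main: "integrable M (\<lambda>\<omega>. \<bar>\<Sum>x\<in>B. Y x \<omega>\<bar> powr p) \<and>
      expectation (\<lambda>\<omega>. \<bar>\<Sum>x\<in>B. Y x \<omega>\<bar> powr p) \<le> K * real (card B) powr (p / 2)"
    if "finite B" "indep_vars (\<lambda>_. borel) Y B"
      "\<And>x. x \<in> B \<Longrightarrow> integrable M (\<lambda>\<omega>. \<bar>Y x \<omega>\<bar> powr p)"
      "\<And>x. x \<in> B \<Longrightarrow> expectation (\<lambda>\<omega>. \<bar>Y x \<omega>\<bar> powr p) \<le> b"
      "\<And>x. x \<in> B \<Longrightarrow> expectation (Y x) = 0" for B and Y :: "'b \<Rightarrow> 'a \<Rightarrow> real"
    using that
  proof (induction B rule: finite_induct)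
    case empty
    then show ?case using p by simp
  next
    case (insert y B)
    let ?S = "\<lambda>\<omega>. \<Sum>x\<in>B. Y x \<omega>"
    have IH: "integrable M (\<lambda>\<omega>. \<bar>?S \<omega>\<bar> powr p)"
      "expectation (\<lambda>\<omega>. \<bar>?S \<omega>\<bar> powr p) \<le> K * real (card B) powr (p / 2)"
      using insert.IH insert.prems indep_vars_subset[OF insert.prems(1), of B] by auto
    show ?case
    \<comment> \<open>The empty sum is separate since the truncation level below must be
      positive.\<close>
    proof (cases "B = {}")
      case True
      then show ?thesis using insert.prems(2-4)[of y] K by auto
    next
      case False
      define n where "n = real (card B)"
      have n1: "n \<ge> 1"
        using False insert.hyps by (simp add: n_def Suc_le_eq card_gt_0_iff)
      have "indep_var borel (Y y) borel ?S"
        using indep_vars_sum[OF insert.hyps insert.prems(1)] by simp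
      then have ind: "indep_var borel ?S borel (Y y)"
        by (rule indep_var_commute)
      \<comment> \<open>With \<open>a\<^sup>2\<close> proportional to \<open>n\<close>, the term \<open>E / a\<^sup>2\<close> uses up only half of the increment
        of \<open>K * n powr (p / 2)\<close>.\<close>
      define a where "a = sqrt (A * n)"
      have An: "A * n > 0" using D n1 by (simp add: A_def)
      then have a: "a > 0" "a\<^sup>2 = A * n" by (auto simp: a_def)
      have apow: "a powr (p - 2) = A powr (p / 2 - 1) * n powr (p / 2 - 1)"
      proof -
        have "a powr (p - 2) = (A * n) powr ((1/2) * (p - 2))"
          using An by (simp add: a_def powr_half_sqrt[symmetric] powr_powr)
        also have "(1/2) * (p - 2) = p / 2 - 1" by (simp add: field_simps)
        finally show ?thesis by (simp add: powr_mult)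
      qed
      have b': "\<And>x. x \<in> insert y B \<Longrightarrow> expectation (\<lambda>\<omega>. \<bar>Y x \<omega>\<bar> powr p) \<le> b"
        using insert.prems(3) .
      note step = moment_add_indep[OF p a(1) C0 C ind IH(1) insert.prems(2)[OF insertI1] insert.prems(4)[OF insertI1] b'[OF insertI1]]
      define E where "E = expectation (\<lambda>\<omega>. \<bar>?S \<omega>\<bar> powr p)"
      define N where "N = n powr (p / 2 - 1)"
      have N1: "N \<ge> 1" using n1 p by (simp add: N_def ge_one_powr_ge_zero)
      have nN: "n powr (p / 2) = n * N"
        using n1 powr_add[of n 1 "p / 2 - 1"] by (simp add: N_def)
      have E0: "E \<ge> 0" by (simp add: E_def)
      have EK: "E \<le> K * (n * N)" using IH(2) by (simp add: E_def n_def[symmetric] nN)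
      have x1: "E / a\<^sup>2 \<le> K * N / A"
        using EK An n1 D by (simp add: a(2) A_def divide_simps) (simp add: algebra_simps)
      have x2: "C * (1 + b) * (E / a\<^sup>2 + a powr (p - 2)) \<le> D * (K * N / A + A powr (p / 2 - 1) * N)"
        using x1 D E0 C0 b An by (intro mult_mono add_mono) (auto simp: apow N_def)
      have x3: "D * (K * N / A) = K * N / 2" using D by (simp add: A_def)
      have x4: "D * A powr (p / 2 - 1) * N + C * b \<le> K / 2 * N"
      proof -
        have "D \<le> D * N" using D(1) N1 by simp
        then have "C * b \<le> D * N" using D(3) by linarith
        then have "D * A powr (p / 2 - 1) * N + C * b \<le> (D * A powr (p / 2 - 1) + D) * N"
          by (simp add: algebra_simps)
        also have "\<dots> \<le> K / 2 * N" using K(3) N1 by (intro mult_right_mono) auto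
        finally show ?thesis .
      qed
      have "expectation (\<lambda>\<omega>. \<bar>?S \<omega> + Y y \<omega>\<bar> powr p) \<le> E + D * (K * N / A + A powr (p / 2 - 1) * N) + C * b"
        using step(2) x2 unfolding E_def by linarith
      also have "\<dots> = E + D * (K * N / A) + (D * A powr (p / 2 - 1) * N + C * b)"
        by (simp add: algebra_simps)
      also have "\<dots> \<le> K * (n * N) + K * N / 2 + K / 2 * N"
        unfolding x3 using x4 EK by linarith
      \<comment> \<open>The two halves make up one K N, and N is at most the increment of n^(p/2)
        from n to n + 1 because p/2 - 1 \<ge> 0.\<close>
      also have "\<dots> = K * ((n + 1) * N)" by (simp add: algebra_simps)
      also have "\<dots> \<le> K * ((n + 1) * (n + 1) powr (p / 2 - 1))"
        unfolding N_def using n1 p K by (intro mult_left_mono powr_mono2) auto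
      also have "(n + 1) * (n + 1) powr (p / 2 - 1) = real (card (insert y B)) powr (p / 2)"
        using insert.hyps n1 powr_add[of "n + 1" 1 "p / 2 - 1"] by (simp add: n_def add.commute)
      finally show ?thesis
        using step(1) insert.hyps by (simp add: add.commute)
    qed
  qed
  show ?thesis
    by (intro exI[of _ K] conjI K(1) allI impI) (use main in blast)+
qed

end

section \<open>Offspring generating functions\<close>

lemma expectation_eq_infsum:
  fixes f :: "'b \<Rightarrow> real"
  assumes "integrable (measure_pmf p) f"
  shows "measure_pmf.expectation p f = (\<Sum>\<^sub>\<infinity>x. pmf p x * f x)"
proof -
  have int: "integrable (count_space UNIV) (\<lambda>x. pmf p x * f x)"
    using assms by (simp add: measure_pmf_eq_density integrable_density)
  have "measure_pmf.expectation p f = (\<integral>x. pmf p x * f x \<partial>count_space UNIV)"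
    by (simp add: measure_pmf_eq_density integral_density)
  also have "\<dots> = infsetsum (\<lambda>x. pmf p x * f x) UNIV"
    by (simp add: infsetsum_def)
  also have "\<dots> = (\<Sum>\<^sub>\<infinity>x. pmf p x * f x)"
    by (rule infsetsum_infsum) (use int in \<open>simp add: Infinite_Set_Sum.abs_summable_on_def\<close>)
  finally show ?thesis .
qed

lemma offspring_gf_eq_expectation:
  assumes s: "\<And>k. 0 \<le> s $ k \<and> s $ k \<le> 1"
  shows "offspring_gf P i s = measure_pmf.expectation (P i) (\<lambda>j. \<Prod>k\<in>UNIV. (s $ k) ^ (j $ k))"
  unfolding offspring_gf_def
proof (rule expectation_eq_infsum[symmetric])
  have "norm (\<Prod>k\<in>UNIV. (s $ k) ^ (j $ k)) \<le> 1" for j :: "nat ^ 2"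
    using s by (auto simp: abs_prod intro!: prod_le_1 power_le_one)
  then show "integrable (measure_pmf (P i)) (\<lambda>j. \<Prod>k\<in>UNIV. (s $ k) ^ (j $ k))"
    by (intro measure_pmf.integrable_const_bound[where B = 1]) auto
qed

lemma offspring_gf_0: "offspring_gf P i 0 = pmf (P i) 0"
proof -
  have "offspring_gf P i 0 = measure_pmf.expectation (P i) (\<lambda>j. \<Prod>k\<in>UNIV. (0 :: real) ^ (j $ k))"
    using offspring_gf_eq_expectation[of 0 P i] by simp
  \<comment> \<open>Because \<open>0 ^ 0 = 1\<close>, the monomial at the origin singles out j =
    0.\<close>
  also have "(\<lambda>j :: nat ^ 2. \<Prod>k\<in>UNIV. (0 :: real) ^ (j $ k)) = indicator {0}"
    by (auto simp: fun_eq_iff indicator_def vec_eq_iff power_0_left)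
  also have "measure_pmf.expectation (P i) \<dots> = pmf (P i) 0"
    by (simp add: pmf.rep_eq)
  finally show ?thesis .
qed

text \<open>The remainder for n + 1 is t times the remainder for n plus n x^(n-1) (t - x)^2. A bound
  by n^2 that is uniform on [0, 1] can be averaged over an offspring law with second moments, so
  differentiation under the expectation becomes a direct estimate.\<close>

lemma power_taylor_bound:
  fixes t x :: real
  assumes "0 \<le> t" "t \<le> 1" "0 \<le> x" "x \<le> 1"
  shows "\<bar>t ^ n - x ^ n - real n * x ^ (n - 1) * (t - x)\<bar> \<le> (real n)\<^sup>2 * (t - x)\<^sup>2"
proof (induction n)
  case (Suc n)
  have "t ^ Suc n - x ^ Suc n - real (Suc n) * x ^ n * (t - x)
      = t * (t ^ n - x ^ n - real n * x ^ (n - 1) * (t - x)) + real n * x ^ (n - 1) * (t - x)\<^sup>2"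
    by (cases n) (auto simp: algebra_simps power2_eq_square)
  then have "\<bar>t ^ Suc n - x ^ Suc n - real (Suc n) * x ^ n * (t - x)\<bar>
      \<le> \<bar>t\<bar> * \<bar>t ^ n - x ^ n - real n * x ^ (n - 1) * (t - x)\<bar> + \<bar>real n * x ^ (n - 1) * (t - x)\<^sup>2\<bar>"
    by (metis abs_mult abs_triangle_ineq)
  also have "\<dots> \<le> 1 * ((real n)\<^sup>2 * (t - x)\<^sup>2) + real n * 1 * (t - x)\<^sup>2"
  proof (intro add_mono mult_mono Suc.IH)
    show "\<bar>real n * x ^ (n - 1) * (t - x)\<^sup>2\<bar> \<le> real n * 1 * (t - x)\<^sup>2"
      using assms by (simp add: abs_mult mult_left_le power_le_one mult_right_mono)
  qed (use assms in auto)
  also have "\<dots> \<le> (real (Suc n))\<^sup>2 * (t - x)\<^sup>2"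
  proof -
    have "(real n)\<^sup>2 + real n \<le> (real (Suc n))\<^sup>2" by (simp add: power2_eq_square algebra_simps)
    then have "((real n)\<^sup>2 + real n) * (t - x)\<^sup>2 \<le> (real (Suc n))\<^sup>2 * (t - x)\<^sup>2"
      by (intro mult_right_mono) auto
    then show ?thesis by (simp add: distrib_right)
  qed
  finally show ?case by simp
qed simp

text \<open>Valid within any set, hence also for the one-sided derivatives at 0 and 1.\<close>

lemma has_vector_derivative_of_quadratic_bound:
  fixes g :: "real \<Rightarrow> real"
  assumes "\<And>t. t \<in> S \<Longrightarrow> \<bar>g t - g x - (t - x) * D\<bar> \<le> B * (t - x)\<^sup>2"
  shows "(g has_vector_derivative D) (at x within S)"
  unfolding has_real_derivative_iff_has_vector_derivative[symmetric] has_field_derivative_iff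
proof (rule LIM_zero_cancel, rule Lim_null_comparison)
  show "\<forall>\<^sub>F t in at x within S. norm ((g t - g x) / (t - x) - D) \<le> B * \<bar>t - x\<bar>"
    unfolding eventually_at_filter
  proof (intro always_eventually allI impI)
    fix t assume t: "t \<noteq> x" "t \<in> S"
    have "(g t - g x) / (t - x) - D = (g t - g x - (t - x) * D) / (t - x)"
      using t by (simp add: field_simps)
    then have "norm ((g t - g x) / (t - x) - D) = \<bar>g t - g x - (t - x) * D\<bar> / \<bar>t - x\<bar>"
      by simp
    also have "\<dots> \<le> B * (t - x)\<^sup>2 / \<bar>t - x\<bar>"
      using assms[OF t(2)] by (intro divide_right_mono) auto
    also have "\<dots> = B * \<bar>t - x\<bar>"
      using t power2_abs[of "t - x"] by (metis (no_types, lifting) abs_0_eq eq_iff_diff_eq_0 nonzero_mult_div_cancel_right power2_eq_square times_divide_eq_right)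
    finally show "norm ((g t - g x) / (t - x) - D) \<le> B * \<bar>t - x\<bar>" .
  qed
  show "((\<lambda>t. B * \<bar>t - x\<bar>) \<longlongrightarrow> 0) (at x within S)"
    by (rule tendsto_eq_intros refl)+ auto
qed

text \<open>The partial derivative of s^j in the k-th coordinate. The truncated exponent at j_k = 0
  is harmless because of the factor j_k.\<close>

definition deriv_term :: "2 \<Rightarrow> real ^ 2 \<Rightarrow> nat ^ 2 \<Rightarrow> real" where
  "deriv_term k s j = real (j $ k) * (s $ k) ^ (j $ k - 1) * (\<Prod>m\<in>UNIV - {k}. (s $ m) ^ (j $ m))"

lemma deriv_term_bound:
  assumes "\<And>k. 0 \<le> s $ k \<and> s $ k \<le> 1"
  shows "\<bar>deriv_term k s j\<bar> \<le> real (j $ k)"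
proof -
  have "\<bar>deriv_term k s j\<bar> \<le> real (j $ k) * 1 * 1"
    unfolding deriv_term_def abs_mult abs_prod using assms
    by (intro mult_mono) (auto intro!: prod_le_1 power_le_one prod_nonneg)
  then show ?thesis by simp
qed

lemma integrable_pmf_of_square:
  fixes f :: "'b \<Rightarrow> real"
  assumes "integrable (measure_pmf p) (\<lambda>j. (f j)\<^sup>2)"
  shows "integrable (measure_pmf p) f"
  by (rule measure_pmf.square_integrable_imp_integrable[OF _ assms]) simp

text \<open>Differentiation under the expectation: the remainder is at most E (j_k)^2 times (t -
  s_k)^2.\<close>

lemma derivative_matrix_eq:
  assumes sq: "integrable (measure_pmf (P i)) (\<lambda>j. (real (j $ k))\<^sup>2)"
    and s: "\<And>k. 0 \<le> s $ k \<and> s $ k \<le> 1"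
  shows "derivative_matrix P s $ i $ k = measure_pmf.expectation (P i) (deriv_term k s)"
proof -
  let ?E = "measure_pmf.expectation (P i)"
  define h where "h = (\<lambda>j :: nat ^ 2. \<Prod>m\<in>UNIV - {k}. (s $ m) ^ (j $ m))"
  define g where "g = (\<lambda>t. offspring_gf P i (\<chi> m. if m = k then t else s $ m))"
  have h: "0 \<le> h j" "h j \<le> 1" for j
    unfolding h_def using s by (auto intro!: prod_nonneg prod_le_1 power_le_one)
  have g: "g t = ?E (\<lambda>j. t ^ (j $ k) * h j)" if "0 \<le> t" "t \<le> 1" for t
  proof -
    have "g t = ?E (\<lambda>j. \<Prod>m\<in>UNIV. ((\<chi> m. if m = k then t else s $ m) $ m) ^ (j $ m))"
      unfolding g_def by (rule offspring_gf_eq_expectation) (use s that in auto)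
    also have "(\<lambda>j :: nat ^ 2. \<Prod>m\<in>UNIV. ((\<chi> m. if m = k then t else s $ m) $ m) ^ (j $ m)) = (\<lambda>j. t ^ (j $ k) * h j)"
      unfolding h_def by (rule ext, subst prod.remove[of _ k]) (auto intro!: prod.cong)
    finally show ?thesis .
  qed
  have intg: "integrable (measure_pmf (P i)) (\<lambda>j. t ^ (j $ k) * h j)" if "0 \<le> t" "t \<le> 1" for t
    using that h by (intro measure_pmf.integrable_const_bound[where B = 1])
      (auto simp: abs_mult intro!: mult_le_one power_le_one)
  have intd: "integrable (measure_pmf (P i)) (deriv_term k s)"
    by (rule Bochner_Integration.integrable_bound[OF integrable_pmf_of_square[OF sq]])
       (use deriv_term_bound[OF s] in auto)
  have sk: "0 \<le> s $ k" "s $ k \<le> 1" using s by auto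
  have "(g has_vector_derivative ?E (deriv_term k s)) (at (s $ k) within {0..1})"
  proof (rule has_vector_derivative_of_quadratic_bound)
    fix t :: real assume "t \<in> {0..1}"
    then have t: "0 \<le> t" "t \<le> 1" by auto
    let ?r = "\<lambda>j. t ^ (j $ k) * h j - (s $ k) ^ (j $ k) * h j - (t - s $ k) * deriv_term k s j"
    have r: "\<bar>?r j\<bar> \<le> (real (j $ k))\<^sup>2 * (t - s $ k)\<^sup>2" for j
    proof -
      have "?r j = h j * (t ^ (j $ k) - (s $ k) ^ (j $ k) - real (j $ k) * (s $ k) ^ (j $ k - 1) * (t - s $ k))"
        by (simp add: deriv_term_def h_def algebra_simps)
      then have "\<bar>?r j\<bar> = h j * \<bar>t ^ (j $ k) - (s $ k) ^ (j $ k) - real (j $ k) * (s $ k) ^ (j $ k - 1) * (t - s $ k)\<bar>"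
        using h(1)[of j] by (simp only: abs_mult abs_of_nonneg)
      also have "\<dots> \<le> 1 * \<bar>t ^ (j $ k) - (s $ k) ^ (j $ k) - real (j $ k) * (s $ k) ^ (j $ k - 1) * (t - s $ k)\<bar>"
        by (intro mult_right_mono h(2)) auto
      finally have "\<bar>?r j\<bar> \<le> 1 * \<bar>t ^ (j $ k) - (s $ k) ^ (j $ k) - real (j $ k) * (s $ k) ^ (j $ k - 1) * (t - s $ k)\<bar>" .
      then show ?thesis
        using power_taylor_bound[OF t sk, of "j $ k"] by simp
    qed
    have "g t - g (s $ k) - (t - s $ k) * ?E (deriv_term k s) = ?E ?r"
      using intg[OF t] intg[OF sk] intd by (simp add: g[OF t] g[OF sk])
    also have "\<bar>?E ?r\<bar> \<le> ?E (\<lambda>j. \<bar>?r j\<bar>)"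
      by (rule integral_abs_bound)
    also have "\<dots> \<le> ?E (\<lambda>j. (real (j $ k))\<^sup>2 * (t - s $ k)\<^sup>2)"
      using intg[OF t] intg[OF sk] intd sq r by (intro integral_mono) auto
    also have "\<dots> = ?E (\<lambda>j. (real (j $ k))\<^sup>2) * (t - s $ k)\<^sup>2" by simp
    finally show "\<bar>g t - g (s $ k) - (t - s $ k) * ?E (deriv_term k s)\<bar> \<le> ?E (\<lambda>j. (real (j $ k))\<^sup>2) * (t - s $ k)\<^sup>2" .
  qed
  then have "vector_derivative g (at (s $ k) within {0..1}) = ?E (deriv_term k s)"
    by (intro vector_derivative_within_closed_interval) (use sk in auto)
  then show ?thesis
    by (simp add: derivative_matrix_def partial_deriv_def g_def)
qed

text \<open>At the origin the termwise derivative vanishes except for j = e_k, so the matrix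
  collects the probabilities of having a single child of a given type.\<close>

lemma derivative_matrix_0:
  assumes "integrable (measure_pmf (P i)) (\<lambda>j. (real (j $ k))\<^sup>2)"
  shows "derivative_matrix P 0 $ i $ k = pmf (P i) (axis k 1)"
proof -
  have "deriv_term k 0 = indicator {axis k 1}"
  proof
    fix j :: "nat ^ 2"
    show "deriv_term k 0 j = indicator {axis k 1} j"
    proof (cases "j = axis k 1")
      case True
      then show ?thesis by (auto simp: deriv_term_def axis_def)
    next
      case False
      then consider "j $ k \<noteq> 1" | m where "m \<noteq> k" "j $ m \<noteq> 0"
        by (auto simp: vec_eq_iff axis_def split: if_splits)
      then have "deriv_term k 0 j = 0"
      proof cases
        case 1
        then show ?thesis by (auto simp: deriv_term_def power_0_left)
      next
        case 2
        then have "(\<Prod>m\<in>UNIV - {k}. ((0 :: real ^ 2) $ m) ^ (j $ m)) = 0"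
          by (intro prod_zero) (auto intro!: bexI[of _ m])
        then show ?thesis by (simp add: deriv_term_def)
      qed
      then show ?thesis using False by simp
    qed
  qed
  then show ?thesis
    using derivative_matrix_eq[where s = 0 and P = P and i = i and k = k, OF assms] by (simp add: pmf.rep_eq)
qed

lemma mean_matrix_eq:
  assumes M: "is_mean_matrix P M"
    and sq: "\<And>i k. integrable (measure_pmf (P i)) (\<lambda>j. (real (j $ k))\<^sup>2)"
  shows "M $ i $ k = measure_pmf.expectation (P i) (\<lambda>j. real (j $ k))"
proof -
  define S where "S = {s :: real ^ 2. \<forall>k. 0 \<le> s $ k \<and> s $ k < 1}"
  \<comment> \<open>A diagonal sequence inside [0, 1)^2. The limit that defines M may be evaluated
    along it, and dominated convergence with the bound j_k gives the mean.\<close>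
  define \<sigma> :: "nat \<Rightarrow> real ^ 2" where "\<sigma> = (\<lambda>n. \<chi> k. 1 - 1 / real (Suc n))"
  have \<sigma>S: "\<sigma> n \<in> S" for n by (auto simp: S_def \<sigma>_def)
  have inv: "(\<lambda>n. 1 - 1 / real (Suc n)) \<longlonglongrightarrow> 1"
    using tendsto_diff[OF tendsto_const[of "1::real"] LIMSEQ_Suc[OF lim_1_over_n]] by simp
  have "\<sigma> \<longlonglongrightarrow> 1"
    by (rule vec_tendstoI) (use inv in \<open>simp add: \<sigma>_def\<close>)
  moreover have "\<sigma> n \<noteq> 1" for n
    by (auto simp: \<sigma>_def vec_eq_iff)
  ultimately have "filterlim \<sigma> (at 1 within S) sequentially"
    using \<sigma>S by (auto simp: filterlim_at)
  with M have "(\<lambda>n. derivative_matrix P (\<sigma> n)) \<longlonglongrightarrow> M"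
    unfolding is_mean_matrix_def S_def[symmetric] by (rule filterlim_compose)
  then have "(\<lambda>n. derivative_matrix P (\<sigma> n) $ i $ k) \<longlonglongrightarrow> M $ i $ k"
    by (intro tendsto_vec_nth)
  moreover have s01: "0 \<le> \<sigma> n $ m \<and> \<sigma> n $ m \<le> 1" for n m
    using \<sigma>S[of n] by (auto simp: S_def less_imp_le)
  ultimately have lim: "(\<lambda>n. measure_pmf.expectation (P i) (deriv_term k (\<sigma> n))) \<longlonglongrightarrow> M $ i $ k"
    by (simp add: derivative_matrix_eq[OF sq s01])
  have "(\<lambda>n. measure_pmf.expectation (P i) (deriv_term k (\<sigma> n))) \<longlonglongrightarrow> measure_pmf.expectation (P i) (\<lambda>j. real (j $ k))"
  proof (rule integral_dominated_convergence)
    show "integrable (measure_pmf (P i)) (\<lambda>j. real (j $ k))"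
      by (rule integrable_pmf_of_square[OF sq])
    have "(\<lambda>n. deriv_term k (\<sigma> n) j) \<longlonglongrightarrow> real (j $ k) * 1 ^ (j $ k - 1) * (\<Prod>m\<in>UNIV - {k}. 1 ^ (j $ m))" for j
      unfolding deriv_term_def
      by (intro tendsto_mult tendsto_const tendsto_power tendsto_prod) (use inv in \<open>simp_all add: \<sigma>_def\<close>)
    then show "AE j in measure_pmf (P i). (\<lambda>n. deriv_term k (\<sigma> n) j) \<longlonglongrightarrow> real (j $ k)"
      by simp
    show "AE j in measure_pmf (P i). norm (deriv_term k (\<sigma> n) j) \<le> real (j $ k)" for n
      using deriv_term_bound[OF s01] by auto
  qed auto
  then show ?thesis
    using lim LIMSEQ_unique by blast
qed

section \<open>The process as a Markov chain\<close>

lemma measurable_countable_binop: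
  fixes f :: "'a \<Rightarrow> 'b::countable" and g :: "'a \<Rightarrow> 'c::countable"
  assumes f: "f \<in> measurable M (count_space UNIV)" and g: "g \<in> measurable M (count_space UNIV)"
  shows "(\<lambda>x. h (f x) (g x)) \<in> measurable M (count_space UNIV)"
proof (rule measurable_compose_countable[OF _ f])
  fix a show "(\<lambda>x. h a (g x)) \<in> measurable M (count_space UNIV)"
    by (rule measurable_compose[OF g]) simp
qed

lemma measurable_countable_sum:
  fixes f :: "'i \<Rightarrow> 'a \<Rightarrow> 'b::{countable, comm_monoid_add}"
  assumes "\<And>i. i \<in> B \<Longrightarrow> f i \<in> measurable M (count_space UNIV)"
  shows "(\<lambda>x. \<Sum>i\<in>B. f i x) \<in> measurable M (count_space UNIV)"
proof (cases "finite B")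
  case True
  then show ?thesis using assms
  proof (induction B rule: finite_induct)
    case (insert b B)
    then show ?case
      by (simp add: measurable_countable_binop[where h = "(+)"])
  qed simp
qed simp

lemma measurable_countable_map:
  fixes f :: "'i \<Rightarrow> 'a \<Rightarrow> 'b::countable"
  assumes "\<And>i. i \<in> set xs \<Longrightarrow> f i \<in> measurable M (count_space UNIV)"
  shows "(\<lambda>x. map (\<lambda>i. f i x) xs) \<in> measurable M (count_space UNIV)"
  using assms
proof (induction xs)
  case (Cons b xs)
  then show ?case
    by (simp add: measurable_countable_binop[where h = "(#)"])
qed simp

lemma gw_cong:
  assumes "\<And>t i k. t < n \<Longrightarrow> x t i k = y t i k"
  shows "gw x z n = gw y z n"
  using assms by (induction n) simp_all

lemma measurable_gw:
  assumes x: "\<And>t i k. t < n \<Longrightarrow> x t i k \<in> measurable M (count_space UNIV)"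
    and z: "z \<in> measurable M (count_space UNIV)"
  shows "(\<lambda>\<omega>. gw (\<lambda>t i k. x t i k \<omega>) (z \<omega>) n) \<in> measurable M (count_space UNIV)"
  using x
proof (induction n)
  case 0
  then show ?case using z by simp
next
  case (Suc n)
  then have IH: "(\<lambda>\<omega>. gw (\<lambda>t i k. x t i k \<omega>) (z \<omega>) n) \<in> measurable M (count_space UNIV)" by simp
  \<comment> \<open>The number of summands is random; it is first fixed to a, then the countably
    many values a are recombined.\<close>
  have "(\<lambda>\<omega>. \<Sum>i\<in>UNIV. \<Sum>k<a $ i. x n i k \<omega>) \<in> measurable M (count_space UNIV)" for a
    by (intro measurable_countable_sum Suc.prems) simp
  from measurable_compose_countable[OF this IH] show ?case by simp
qed

context prob_space
begin

lemma distr_add_cong: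
  fixes S T S' T' :: "'a \<Rightarrow> 'b::{countable, plus}"
  assumes i: "indep_var (count_space UNIV) S (count_space UNIV) T"
    and i': "indep_var (count_space UNIV) S' (count_space UNIV) T'"
    and S: "distr M (count_space UNIV) S = distr M (count_space UNIV) S'"
    and T: "distr M (count_space UNIV) T = distr M (count_space UNIV) T'"
  shows "distr M (count_space UNIV) (\<lambda>\<omega>. S \<omega> + T \<omega>) = distr M (count_space UNIV) (\<lambda>\<omega>. S' \<omega> + T' \<omega>)"
proof -
  let ?C = "count_space UNIV :: 'b measure"
  have add: "(\<lambda>p. fst p + snd p) \<in> measurable (?C \<Otimes>\<^sub>M ?C) ?C"
    by (rule measurable_countable_binop[where h = "(+)"]) simp_all
  have *: "distr M ?C (\<lambda>\<omega>. U \<omega> + V \<omega>) = distr (distr M ?C U \<Otimes>\<^sub>M distr M ?C V) ?C (\<lambda>p. fst p + snd p)"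
    if "indep_var ?C U ?C V" for U V
  proof -
    have m: "random_variable ?C U" "random_variable ?C V"
      and eq: "distr M ?C U \<Otimes>\<^sub>M distr M ?C V = distr M (?C \<Otimes>\<^sub>M ?C) (\<lambda>\<omega>. (U \<omega>, V \<omega>))"
      using that unfolding indep_var_distribution_eq by simp_all
    have mp: "(\<lambda>\<omega>. (U \<omega>, V \<omega>)) \<in> measurable M (?C \<Otimes>\<^sub>M ?C)"
      by (rule measurable_Pair[OF m])
    show ?thesis
      unfolding eq distr_distr[OF add mp] by (simp add: o_def)
  qed
  show ?thesis
    unfolding *[OF i] *[OF i'] S T ..
qed

text \<open>Countably many null atoms form a null set, so the law is carried by its atoms of
  positive mass.\<close>

lemma Abs_pmf_distr:
  fixes Y :: "'a \<Rightarrow> 'b::countable"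
  assumes Y: "random_variable (count_space UNIV) Y"
  shows "measure_pmf (Abs_pmf (distr M (count_space UNIV) Y)) = distr M (count_space UNIV) Y"
proof (rule Abs_pmf_inverse, safe)
  let ?D = "distr M (count_space UNIV) Y"
  interpret D: prob_space ?D by (rule prob_space_distr[OF Y])
  show "prob_space ?D" by (rule D.prob_space_axioms)
  have "AE x in ?D. x = a \<longrightarrow> measure ?D {a} \<noteq> 0" for a
  proof (cases "measure ?D {a} = 0")
    case True
    then have "{a} \<in> null_sets ?D" by (auto simp: null_sets_def D.emeasure_eq_measure)
    then have "AE x in ?D. x \<notin> {a}" by (rule AE_not_in)
    then show ?thesis by eventually_elim simp
  qed simp
  then have "AE x in ?D. \<forall>a. x = a \<longrightarrow> measure ?D {a} \<noteq> 0"
    by (subst AE_all_countable) blast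
  then show "AE x in ?D. measure ?D {x} \<noteq> 0" by eventually_elim simp
qed simp_all

end

section \<open>Independent inputs and sums of offspring vectors\<close>

context branching_with_immigration
begin

definition input :: "nat + nat \<times> nat \<times> 2 \<times> nat \<Rightarrow> 'w \<Rightarrow> nat ^ 2" where
  "input a = (case a of Inl c \<Rightarrow> I c | Inr (c, t, i, k) \<Rightarrow> \<xi> c t i k)"

definition inputs :: "(nat + nat \<times> nat \<times> 2 \<times> nat) set" where
  "inputs = Inl ` {1..} \<union> range Inr"

definition offspring_sum :: "(nat \<times> nat \<times> 2 \<times> nat) set \<Rightarrow> 'w \<Rightarrow> nat ^ 2" where
  "offspring_sum B \<omega> = (\<Sum>b\<in>B. input (Inr b) \<omega>)"

definition particle_type :: "nat \<times> nat \<times> 2 \<times> nat \<Rightarrow> 2" where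
  "particle_type b = fst (snd (snd b))"

definition type_count :: "(nat \<times> nat \<times> 2 \<times> nat) set \<Rightarrow> nat ^ 2" where
  "type_count B = (\<Sum>b\<in>B. axis (particle_type b) 1)"

text \<open>A reference set with m_i particles of each type i, placed in clan 0 at age 0: exactly
  the particles that reproduce in the first step of the process started from m.\<close>

definition founders :: "nat ^ 2 \<Rightarrow> (nat \<times> nat \<times> 2 \<times> nat) set" where
  "founders m = (\<lambda>(i, k). (0, 0, i, k)) ` (SIGMA i:UNIV. {..<m $ i})"

lemma indep_inputs: "indep_vars (\<lambda>_. count_space UNIV) input inputs"
proof -
  have "input = (\<lambda>a. case a of Inl c \<Rightarrow> I c | Inr (c, t, i, k) \<Rightarrow> \<xi> c t i k)"
    by (simp add: input_def fun_eq_iff)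
  then show ?thesis using independent by (simp add: inputs_def)
qed

lemma measurable_input: "a \<in> inputs \<Longrightarrow> random_variable (count_space UNIV) (input a)"
  using indep_inputs unfolding indep_vars_def by simp

lemma Inr_inputs [simp]: "Inr b \<in> inputs" and Inl_inputs [simp]: "Inl c \<in> inputs \<longleftrightarrow> c \<ge> 1"
  by (auto simp: inputs_def)

lemma measurable_immigration: "c \<ge> 1 \<Longrightarrow> random_variable (count_space UNIV) (I c)"
  using measurable_input[of "Inl c"] by (simp add: input_def)

lemma measurable_offspring: "random_variable (count_space UNIV) (\<xi> c t i k)"
  using measurable_input[of "Inr (c, t, i, k)"] by (simp add: input_def)

lemma measurable_offspring_sum: "random_variable (count_space UNIV) (offspring_sum B)"
  unfolding offspring_sum_def by (intro measurable_countable_sum measurable_input) simp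

lemma distr_input: "distr \<Omega> (count_space UNIV) (input (Inr b)) = measure_pmf (P (particle_type b))"
  by (cases b) (simp add: input_def particle_type_def offspring_law)

lemma indep_disjoint:
  assumes "A \<inter> B = {}" "A \<subseteq> inputs" "B \<subseteq> inputs"
    and "F \<in> measurable (PiM A (\<lambda>_. count_space UNIV)) (count_space UNIV)"
    and "G \<in> measurable (PiM B (\<lambda>_. count_space UNIV)) (count_space UNIV)"
  shows "indep_var (count_space UNIV) (\<lambda>\<omega>. F (\<lambda>a\<in>A. input a \<omega>)) (count_space UNIV) (\<lambda>\<omega>. G (\<lambda>b\<in>B. input b \<omega>))"
  by (rule indep_var_compose[OF indep_var_restrict[OF indep_inputs assms(1-3)] assms(4,5), unfolded o_def])

lemma offspring_sum_restrict:
  assumes "Inr ` B \<subseteq> A"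
  shows "offspring_sum B \<omega> = (\<Sum>b\<in>B. (\<lambda>a\<in>A. input a \<omega>) (Inr b))"
  unfolding offspring_sum_def by (rule sum.cong) (use assms in auto)

lemma indep_offspring_sum:
  assumes "a \<in> inputs" "a \<notin> Inr ` B"
  shows "indep_var (count_space UNIV) (input a) (count_space UNIV) (offspring_sum B)"
proof -
  have "indep_var (count_space UNIV) (\<lambda>\<omega>. (\<lambda>f. f a) (\<lambda>a\<in>{a}. input a \<omega>))
     (count_space UNIV) (\<lambda>\<omega>. (\<lambda>f. \<Sum>b\<in>B. f (Inr b)) (\<lambda>b\<in>Inr ` B. input b \<omega>))"
    by (rule indep_disjoint)
       (use assms in \<open>auto intro!: measurable_component_singleton measurable_countable_sum\<close>)
  then show ?thesis
    by (simp add: offspring_sum_def[abs_def])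
qed

lemma founders_add_axis: "founders (m + axis i 1) = insert (0, 0, i, m $ i) (founders m)"
  by (auto simp: founders_def axis_def image_iff less_Suc_eq split: if_splits)

lemma finite_founders [simp]: "finite (founders m)"
  by (simp add: founders_def)

lemma founders_0 [simp]: "founders 0 = {}"
  by (auto simp: founders_def)

lemma sum_founders: "(\<Sum>b\<in>founders j. g b) = (\<Sum>i\<in>UNIV. \<Sum>k<j $ i. g (0, 0, i, k))"
proof -
  have "(\<Sum>b\<in>founders j. g b) = (\<Sum>(i, k)\<in>(SIGMA i:UNIV. {..<j $ i}). g (0, 0, i, k))"
    unfolding founders_def by (subst sum.reindex) (auto simp: inj_on_def intro!: sum.cong)
  then show ?thesis by (subst sum.Sigma) auto
qed

lemma prod_founders: "(\<Prod>b\<in>founders j. g b) = (\<Prod>i\<in>UNIV. \<Prod>k<j $ i. g (0, 0, i, k))"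
proof -
  have "(\<Prod>b\<in>founders j. g b) = (\<Prod>(i, k)\<in>(SIGMA i:UNIV. {..<j $ i}). g (0, 0, i, k))"
    unfolding founders_def by (subst prod.reindex) (auto simp: inj_on_def intro!: prod.cong)
  then show ?thesis by (subst prod.Sigma) auto
qed

lemma not_founder: "(0, 0, i, m $ i) \<notin> founders m"
  by (auto simp: founders_def)

lemma distr_offspring_sum:
  assumes "finite B"
  shows "distr \<Omega> (count_space UNIV) (offspring_sum B)
    = distr \<Omega> (count_space UNIV) (offspring_sum (founders (type_count B)))"
  using assms
proof (induction B rule: finite_induct)
  case empty
  then show ?case by (simp add: type_count_def)
next
  case (insert b B)
  let ?i = "particle_type b"
  let ?b = "(0, 0, ?i, type_count B $ ?i) :: nat \<times> nat \<times> 2 \<times> nat"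
  have tc: "type_count (insert b B) = type_count B + axis ?i 1"
    using insert.hyps by (simp add: type_count_def add.commute)
  have 1: "offspring_sum (insert b B) = (\<lambda>\<omega>. input (Inr b) \<omega> + offspring_sum B \<omega>)"
    using insert.hyps by (simp add: offspring_sum_def fun_eq_iff)
  have 2: "offspring_sum (founders (type_count (insert b B))) =
      (\<lambda>\<omega>. input (Inr ?b) \<omega> + offspring_sum (founders (type_count B)) \<omega>)"
    unfolding tc founders_add_axis using not_founder by (simp add: offspring_sum_def fun_eq_iff)
  show ?case
    unfolding 1 2
  proof (rule distr_add_cong)
    show "indep_var (count_space UNIV) (input (Inr b)) (count_space UNIV) (offspring_sum B)"
      by (rule indep_offspring_sum) (use insert.hyps in auto)
    show "indep_var (count_space UNIV) (input (Inr ?b)) (count_space UNIV) (offspring_sum (founders (type_count B)))"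
      by (rule indep_offspring_sum) (use not_founder in auto)
    show "distr \<Omega> (count_space UNIV) (input (Inr b)) = distr \<Omega> (count_space UNIV) (input (Inr ?b))"
      by (simp add: distr_input) (simp add: particle_type_def)
  qed (rule insert.IH)
qed

section \<open>Clans and the Markov property\<close>

definition clan :: "nat ^ 2 \<Rightarrow> nat \<Rightarrow> nat \<Rightarrow> 'w \<Rightarrow> nat ^ 2" where
  "clan j c n \<omega> = gw (\<lambda>t i k. \<xi> c t i k \<omega>) (if c = 0 then j else I c \<omega>) (n - c)"

lemma X_proc_eq_clans: "X_proc \<xi> I j n \<omega> = (\<Sum>c\<le>n. clan j c n \<omega>)"
proof -
  have "{..n} = insert 0 {1..n}" by auto
  then have "(\<Sum>c\<le>n. clan j c n \<omega>) = clan j 0 n \<omega> + (\<Sum>c = 1..n. clan j c n \<omega>)"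
    by simp
  then show ?thesis by (simp add: X_proc_def Z_proc_def U_proc_def clan_def)
qed

lemma X_proc_1: "X_proc \<xi> I j 1 \<omega> = I 1 \<omega> + offspring_sum (founders j) \<omega>"
proof -
  have "offspring_sum (founders j) \<omega> = (\<Sum>(i, k)\<in>(SIGMA i:UNIV. {..<j $ i}). \<xi> 0 0 i k \<omega>)"
    unfolding offspring_sum_def founders_def
    by (subst sum.reindex) (auto simp: inj_on_def input_def intro!: sum.cong)
  also have "\<dots> = (\<Sum>i\<in>UNIV. \<Sum>k<j $ i. \<xi> 0 0 i k \<omega>)"
    by (subst sum.Sigma) auto
  finally show ?thesis
    by (simp add: X_proc_def Z_proc_def U_proc_def add.commute)
qed

text \<open>The inputs that determine all clans up to time n. Clan c then has age n - c, so only its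
  offspring vectors of ages t < n - c have been used.\<close>

definition past :: "nat \<Rightarrow> (nat + nat \<times> nat \<times> 2 \<times> nat) set" where
  "past n = Inl ` {1..n} \<union> Inr ` {(c, t, i, k). c \<le> n \<and> t < n - c}"

text \<open>The clan sizes as a function of an arbitrary family f of inputs, the form in which
  independence of disjoint blocks of inputs can be applied.\<close>

definition history_fun ::
  "nat ^ 2 \<Rightarrow> nat \<Rightarrow> (nat + nat \<times> nat \<times> 2 \<times> nat \<Rightarrow> nat ^ 2) \<Rightarrow> (nat ^ 2) list" where
  "history_fun j n f = map (\<lambda>c. gw (\<lambda>t i k. f (Inr (c, t, i, k)))
     (if c = 0 then j else f (Inl c)) (n - c)) [0..<Suc n]"

text \<open>The total X_n does not determine which offspring vectors come next, since these are
  indexed clan by clan. The list of clan sizes does, so the Markov property is obtained by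
  conditioning on it.\<close>

definition clan_sizes :: "nat ^ 2 \<Rightarrow> nat \<Rightarrow> 'w \<Rightarrow> (nat ^ 2) list" where
  "clan_sizes j n \<omega> = map (\<lambda>c. clan j c n \<omega>) [0..<Suc n]"

lemma measurable_history_fun:
  "history_fun j n \<in> measurable (PiM (past n) (\<lambda>_. count_space UNIV)) (count_space UNIV)"
  unfolding history_fun_def
proof (rule measurable_countable_map)
  fix c assume "c \<in> set [0..<Suc n]"
  then have c: "c \<le> n" by auto
  show "(\<lambda>f. gw (\<lambda>t i k. f (Inr (c, t, i, k))) (if c = 0 then j else f (Inl c)) (n - c))
      \<in> measurable (PiM (past n) (\<lambda>_. count_space UNIV)) (count_space UNIV)"
    using c by (cases "c = 0"; intro measurable_gw) (auto intro!: measurable_component_singleton simp: past_def)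
qed

lemma clan_sizes_eq: "clan_sizes j n \<omega> = history_fun j n (\<lambda>a\<in>past n. input a \<omega>)"
  unfolding clan_sizes_def history_fun_def
proof (rule map_cong[OF refl])
  fix c assume "c \<in> set [0..<Suc n]"
  then have c: "c \<le> n" by auto
  have z: "(if c = 0 then j else (\<lambda>a\<in>past n. input a \<omega>) (Inl c)) = (if c = 0 then j else I c \<omega>)"
    using c by (auto simp: past_def input_def)
  show "clan j c n \<omega> = gw (\<lambda>t i k. (\<lambda>a\<in>past n. input a \<omega>) (Inr (c, t, i, k)))
      (if c = 0 then j else (\<lambda>a\<in>past n. input a \<omega>) (Inl c)) (n - c)"
    unfolding clan_def z
    by (rule gw_cong) (use c in \<open>auto simp: past_def input_def\<close>)
qed

text \<open>The particles alive at time n when the clan sizes are v; those of clan c have age n -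
  c.\<close>

definition current :: "(nat ^ 2) list \<Rightarrow> nat \<Rightarrow> (nat \<times> nat \<times> 2 \<times> nat) set" where
  "current v n = (\<lambda>(c, i, k). (c, n - c, i, k)) ` (SIGMA c:{..n}. SIGMA i:UNIV. {..<v ! c $ i})"

lemma finite_current [simp]: "finite (current v n)"
  by (simp add: current_def)

lemma sum_current:
  "(\<Sum>b\<in>current v n. g b) = (\<Sum>c\<le>n. \<Sum>i\<in>UNIV. \<Sum>k<v ! c $ i. g (c, n - c, i, k))"
proof -
  have "(\<Sum>b\<in>current v n. g b) = (\<Sum>(c, i, k)\<in>(SIGMA c:{..n}. SIGMA i:UNIV. {..<v ! c $ i}). g (c, n - c, i, k))"
    unfolding current_def by (subst sum.reindex) (auto simp: inj_on_def intro!: sum.cong)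
  also have "\<dots> = (\<Sum>c\<le>n. \<Sum>(i, k)\<in>(SIGMA i:UNIV. {..<v ! c $ i}). g (c, n - c, i, k))"
    by (subst sum.Sigma) (auto intro!: sum.cong)
  also have "\<dots> = (\<Sum>c\<le>n. \<Sum>i\<in>UNIV. \<Sum>k<v ! c $ i. g (c, n - c, i, k))"
    by (subst sum.Sigma) (auto intro!: sum.cong)
  finally show ?thesis .
qed

lemma type_count_current: "type_count (current v n) = (\<Sum>c\<le>n. v ! c)"
proof -
  have "(\<Sum>i\<in>UNIV. \<Sum>k<m $ i. axis i 1) = m" for m :: "nat ^ 2"
    unfolding vec_eq_iff
  proof
    fix l
    have "(\<Sum>i\<in>UNIV. \<Sum>k<m $ i. axis i 1 :: nat ^ 2) $ l = (\<Sum>i\<in>UNIV. \<Sum>k<m $ i. (axis i 1 :: nat ^ 2) $ l)"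
      by (simp only: sum_component)
    also have "\<dots> = (\<Sum>i\<in>UNIV. if i = l then m $ i else 0)"
      by (intro sum.cong) (auto simp: axis_def)
    finally show "(\<Sum>i\<in>UNIV. \<Sum>k<m $ i. axis i 1 :: nat ^ 2) $ l = m $ l" by simp
  qed
  then show ?thesis
    unfolding type_count_def sum_current by (simp add: particle_type_def)
qed

text \<open>Once v is fixed, \<open>current v n\<close> is a nonrandom index set, so on this event
  the next state is an ordinary sum of inputs. The newest clan has age 0 and consists of the
  immigrants alone.\<close>

lemma X_proc_Suc:
  assumes "clan_sizes j n \<omega> = v"
  shows "X_proc \<xi> I j (Suc n) \<omega> = I (Suc n) \<omega> + offspring_sum (current v n) \<omega>"
proof -
  have v: "v ! c = clan j c n \<omega>" if "c \<le> n" for c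
    using that assms by (auto simp: clan_sizes_def simp del: upt_Suc)
  have "clan j c (Suc n) \<omega> = (\<Sum>i\<in>UNIV. \<Sum>k<v ! c $ i. input (Inr (c, n - c, i, k)) \<omega>)" if "c \<le> n" for c
    using that by (simp add: v clan_def[of j c "Suc n"] Suc_diff_le input_def) (simp add: clan_def)
  moreover have "clan j (Suc n) (Suc n) \<omega> = I (Suc n) \<omega>"
    by (simp add: clan_def)
  ultimately show ?thesis
    unfolding X_proc_eq_clans offspring_sum_def sum_current by (simp add: add.commute)
qed

lemma X_proc_eq_sum_clan_sizes:
  assumes "clan_sizes j n \<omega> = v"
  shows "X_proc \<xi> I j n \<omega> = (\<Sum>c\<le>n. v ! c)"
  unfolding X_proc_eq_clans using assms
  by (auto simp: clan_sizes_def simp del: upt_Suc intro!: sum.cong)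

lemma measurable_clan_sizes: "random_variable (count_space UNIV) (clan_sizes j n)"
  unfolding clan_sizes_def clan_def
proof (rule measurable_countable_map)
  fix c
  show "(\<lambda>\<omega>. gw (\<lambda>t i k. \<xi> c t i k \<omega>) (if c = 0 then j else I c \<omega>) (n - c)) \<in> measurable \<Omega> (count_space UNIV)"
    by (cases "c = 0"; intro measurable_gw measurable_offspring) (auto intro: measurable_immigration)
qed

lemma measurable_X_proc: "random_variable (count_space UNIV) (X_proc \<xi> I j n)"
proof -
  have "X_proc \<xi> I j n = (\<lambda>\<omega>. \<Sum>c\<le>n. clan_sizes j n \<omega> ! c)"
    using X_proc_eq_sum_clan_sizes by (auto simp: fun_eq_iff)
  moreover have "(\<lambda>\<omega>. (\<lambda>v. \<Sum>c\<le>n. v ! c) (clan_sizes j n \<omega>)) \<in> measurable \<Omega> (count_space UNIV)"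
    by (rule measurable_compose[OF measurable_clan_sizes]) simp
  ultimately show ?thesis by simp
qed

text \<open>The law of the next state depends on v only through the total: the current particles are
  matched with founders, and \<open>I (Suc n)\<close> with \<open>I 1\<close>.\<close>

lemma distr_next_generation:
  "distr \<Omega> (count_space UNIV) (\<lambda>\<omega>. I (Suc n) \<omega> + offspring_sum (current v n) \<omega>)
    = distr \<Omega> (count_space UNIV) (X_proc \<xi> I (\<Sum>c\<le>n. v ! c) 1)"
proof -
  have X1: "X_proc \<xi> I (\<Sum>c\<le>n. v ! c) 1 = (\<lambda>\<omega>. I 1 \<omega> + offspring_sum (founders (\<Sum>c\<le>n. v ! c)) \<omega>)"
    by (rule ext) (rule X_proc_1)
  have ind: "indep_var (count_space UNIV) (I c) (count_space UNIV) (offspring_sum B)" if "c \<ge> 1" for c B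
  proof -
    have "input (Inl c) = I c" by (simp add: input_def fun_eq_iff)
    moreover have "indep_var (count_space UNIV) (input (Inl c)) (count_space UNIV) (offspring_sum B)"
      by (rule indep_offspring_sum) (use that in auto)
    ultimately show ?thesis by (simp only:)
  qed
  show ?thesis
    unfolding X1
  proof (rule distr_add_cong)
    show "indep_var (count_space UNIV) (I (Suc n)) (count_space UNIV) (offspring_sum (current v n))"
      by (rule ind) simp
    show "indep_var (count_space UNIV) (I 1) (count_space UNIV) (offspring_sum (founders (\<Sum>c\<le>n. v ! c)))"
      by (rule ind) simp
    show "distr \<Omega> (count_space UNIV) (I (Suc n)) = distr \<Omega> (count_space UNIV) (I 1)"
      by (rule immigration_law) simp
    show "distr \<Omega> (count_space UNIV) (offspring_sum (current v n)) =
        distr \<Omega> (count_space UNIV) (offspring_sum (founders (\<Sum>c\<le>n. v ! c)))"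
      using distr_offspring_sum[of "current v n"] by (simp add: type_count_current)
  qed
qed

text \<open>The past stops at ages t < n - c and at the n-th immigration; the next step uses age n -
  c and immigration n + 1, so the two blocks of inputs are disjoint.\<close>

lemma indep_next_generation:
  "indep_var (count_space UNIV) (\<lambda>\<omega>. clan_sizes j n \<omega> = v)
     (count_space UNIV) (\<lambda>\<omega>. I (Suc n) \<omega> + offspring_sum (current v n) \<omega> \<in> E)"
proof -
  define B :: "(nat + nat \<times> nat \<times> 2 \<times> nat) set" where "B = insert (Inl (Suc n)) (Inr ` current v n)"
  have "indep_var (count_space UNIV) (\<lambda>\<omega>. (\<lambda>f. history_fun j n f = v) (\<lambda>a\<in>past n. input a \<omega>))
     (count_space UNIV) (\<lambda>\<omega>. (\<lambda>f. f (Inl (Suc n)) + (\<Sum>b\<in>current v n. f (Inr b)) \<in> E) (\<lambda>b\<in>B. input b \<omega>))"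
  proof (rule indep_disjoint)
    show "past n \<inter> B = {}"
      by (auto simp: past_def B_def current_def)
    show "past n \<subseteq> inputs" "B \<subseteq> inputs"
      by (auto simp: past_def B_def)
    show "(\<lambda>f. history_fun j n f = v) \<in> measurable (Pi\<^sub>M (past n) (\<lambda>_. count_space UNIV)) (count_space UNIV)"
      by (rule measurable_compose[OF measurable_history_fun]) simp
    have "(\<lambda>f. f (Inl (Suc n)) + (\<Sum>b\<in>current v n. f (Inr b)) :: nat ^ 2)
        \<in> measurable (Pi\<^sub>M B (\<lambda>_. count_space UNIV)) (count_space UNIV)"
      by (intro measurable_countable_binop[where h = "(+)"] measurable_countable_sum measurable_component_singleton)
         (auto simp: B_def)
    from measurable_compose[OF this, of "\<lambda>x. x \<in> E"]
    show "(\<lambda>f. f (Inl (Suc n)) + (\<Sum>b\<in>current v n. f (Inr b)) \<in> E)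
        \<in> measurable (Pi\<^sub>M B (\<lambda>_. count_space UNIV)) (count_space UNIV)" by simp
  qed
  moreover have "(\<lambda>f. f (Inl (Suc n)) + (\<Sum>b\<in>current v n. f (Inr b))) (\<lambda>b\<in>B. input b \<omega>)
      = I (Suc n) \<omega> + offspring_sum (current v n) \<omega>" for \<omega>
  proof -
    have "(\<Sum>b\<in>current v n. (\<lambda>b\<in>B. input b \<omega>) (Inr b)) = offspring_sum (current v n) \<omega>"
      by (rule offspring_sum_restrict[symmetric]) (auto simp: B_def)
    moreover have "(\<lambda>b\<in>B. input b \<omega>) (Inl (Suc n)) = I (Suc n) \<omega>"
      by (simp add: B_def input_def)
    ultimately show ?thesis by (simp only:)
  qed
  ultimately show ?thesis
    by (simp only: clan_sizes_eq)
qed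

lemma emeasure_X_proc_eq:
  "emeasure \<Omega> {\<omega> \<in> space \<Omega>. X_proc \<xi> I j n \<omega> \<in> E} = emeasure (distr \<Omega> (count_space UNIV) (X_proc \<xi> I j n)) E"
  by (subst emeasure_distr[OF measurable_X_proc]) (auto intro!: arg_cong[where f = "emeasure \<Omega>"])

text \<open>Decomposition over the clan-size lists with total a: on each piece the next state equals
  a variable that is independent of the piece and whose law is the same for all pieces. With
  \<open>emeasure\<close> the countable sum raises no question of summability.\<close>

lemma markov:
  "emeasure \<Omega> {\<omega> \<in> space \<Omega>. X_proc \<xi> I j n \<omega> = a \<and> X_proc \<xi> I j (Suc n) \<omega> \<in> E}
    = emeasure \<Omega> {\<omega> \<in> space \<Omega>. X_proc \<xi> I j n \<omega> = a} * emeasure \<Omega> {\<omega> \<in> space \<Omega>. X_proc \<xi> I a 1 \<omega> \<in> E}"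
proof -
  let ?V = "clan_sizes j n"
  let ?Y = "\<lambda>v \<omega>. I (Suc n) \<omega> + offspring_sum (current v n) \<omega>"
  define L where "L = {v :: (nat ^ 2) list. (\<Sum>c\<le>n. v ! c) = a}"
  have mY: "random_variable (count_space UNIV) (?Y v)" for v
    by (intro measurable_countable_binop[where h = "(+)"] measurable_immigration measurable_offspring_sum) simp
  note mV = measurable_clan_sizes[of j n]
  have [measurable]: "{\<omega> \<in> space \<Omega>. ?V \<omega> = v} \<in> events" for v
    using measurable_sets[OF mV, of "{v}"] by (simp add: vimage_def Int_def conj_commute)
  have [measurable]: "{\<omega> \<in> space \<Omega>. ?V \<omega> = v \<and> ?Y w \<omega> \<in> E} \<in> events" for v w
  proof -
    have "{\<omega> \<in> space \<Omega>. ?V \<omega> = v \<and> ?Y w \<omega> \<in> E} = (?V -` {v} \<inter> space \<Omega>) \<inter> (?Y w -` E \<inter> space \<Omega>)"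
      by auto
    then show ?thesis
      using measurable_sets[OF mV, of "{v}"] measurable_sets[OF mY, of E w] by simp
  qed
  have prod: "emeasure \<Omega> {\<omega> \<in> space \<Omega>. ?V \<omega> = v \<and> ?Y v \<omega> \<in> E}
      = emeasure \<Omega> {\<omega> \<in> space \<Omega>. ?V \<omega> = v} * emeasure \<Omega> {\<omega> \<in> space \<Omega>. X_proc \<xi> I a 1 \<omega> \<in> E}" if "v \<in> L" for v
  proof -
    have "{\<omega> \<in> space \<Omega>. ?V \<omega> = v \<and> ?Y v \<omega> \<in> E} = (\<lambda>\<omega>. (?V \<omega> = v, ?Y v \<omega> \<in> E)) -` ({True} \<times> {True}) \<inter> space \<Omega>"
      by auto
    then have "prob {\<omega> \<in> space \<Omega>. ?V \<omega> = v \<and> ?Y v \<omega> \<in> E}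
       = prob ((\<lambda>\<omega>. ?V \<omega> = v) -` {True} \<inter> space \<Omega>) * prob ((\<lambda>\<omega>. ?Y v \<omega> \<in> E) -` {True} \<inter> space \<Omega>)"
      using indep_varD[OF indep_next_generation[of j n v E], of "{True}" "{True}"] by simp
    also have "(\<lambda>\<omega>. ?V \<omega> = v) -` {True} = ?V -` {v}" by auto
    also have "(\<lambda>\<omega>. ?Y v \<omega> \<in> E) -` {True} = ?Y v -` E" by auto
    finally have "prob {\<omega> \<in> space \<Omega>. ?V \<omega> = v \<and> ?Y v \<omega> \<in> E}
       = prob (?V -` {v} \<inter> space \<Omega>) * prob (?Y v -` E \<inter> space \<Omega>)" .
    then have "emeasure \<Omega> {\<omega> \<in> space \<Omega>. ?V \<omega> = v \<and> ?Y v \<omega> \<in> E}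
       = emeasure \<Omega> (?V -` {v} \<inter> space \<Omega>) * emeasure \<Omega> (?Y v -` E \<inter> space \<Omega>)"
      by (simp add: emeasure_eq_measure ennreal_mult)
    also have "emeasure \<Omega> (?Y v -` E \<inter> space \<Omega>) = emeasure (distr \<Omega> (count_space UNIV) (?Y v)) E"
      by (rule emeasure_distr[OF mY, symmetric]) simp
    also have "\<dots> = emeasure \<Omega> {\<omega> \<in> space \<Omega>. X_proc \<xi> I a 1 \<omega> \<in> E}"
      using that by (simp add: distr_next_generation L_def emeasure_X_proc_eq)
    also have "?V -` {v} \<inter> space \<Omega> = {\<omega> \<in> space \<Omega>. ?V \<omega> = v}" by auto
    finally show ?thesis .
  qed
  have "emeasure \<Omega> {\<omega> \<in> space \<Omega>. X_proc \<xi> I j n \<omega> = a \<and> X_proc \<xi> I j (Suc n) \<omega> \<in> E}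
      = emeasure \<Omega> (\<Union>v\<in>L. {\<omega> \<in> space \<Omega>. ?V \<omega> = v \<and> ?Y v \<omega> \<in> E})"
    using X_proc_Suc[of j n] X_proc_eq_sum_clan_sizes[of j n]
    by (intro arg_cong[where f = "emeasure \<Omega>"]) (auto simp: L_def)
  also have "\<dots>
      = (\<integral>\<^sup>+v. emeasure \<Omega> {\<omega> \<in> space \<Omega>. ?V \<omega> = v \<and> ?Y v \<omega> \<in> E} \<partial>count_space L)"
    by (rule emeasure_UN_countable) (auto simp: disjoint_family_on_def)
  also have "\<dots> = (\<integral>\<^sup>+v. emeasure \<Omega> {\<omega> \<in> space \<Omega>. ?V \<omega> = v} * emeasure \<Omega> {\<omega> \<in> space \<Omega>. X_proc \<xi> I a 1 \<omega> \<in> E} \<partial>count_space L)"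
    by (rule nn_integral_cong) (simp add: prod)
  also have "\<dots> = (\<integral>\<^sup>+v. emeasure \<Omega> {\<omega> \<in> space \<Omega>. ?V \<omega> = v} \<partial>count_space L) * emeasure \<Omega> {\<omega> \<in> space \<Omega>. X_proc \<xi> I a 1 \<omega> \<in> E}"
    by (rule nn_integral_multc) simp
  also have "(\<integral>\<^sup>+v. emeasure \<Omega> {\<omega> \<in> space \<Omega>. ?V \<omega> = v} \<partial>count_space L) = emeasure \<Omega> {\<omega> \<in> space \<Omega>. X_proc \<xi> I j n \<omega> = a}"
  proof -
    have "{\<omega> \<in> space \<Omega>. X_proc \<xi> I j n \<omega> = a} = (\<Union>v\<in>L. {\<omega> \<in> space \<Omega>. ?V \<omega> = v})"
      using X_proc_eq_sum_clan_sizes[of j n] by (auto simp: L_def)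
    moreover have "emeasure \<Omega> (\<Union>v\<in>L. {\<omega> \<in> space \<Omega>. ?V \<omega> = v})
        = (\<integral>\<^sup>+v. emeasure \<Omega> {\<omega> \<in> space \<Omega>. ?V \<omega> = v} \<partial>count_space L)"
      by (rule emeasure_UN_countable) (auto simp: disjoint_family_on_def)
    ultimately show ?thesis by (simp only:)
  qed
  finally show ?thesis .
qed

section \<open>Transition laws as mass functions\<close>

definition law :: "nat ^ 2 \<Rightarrow> nat \<Rightarrow> (nat ^ 2) pmf" where
  "law j n = Abs_pmf (distr \<Omega> (count_space UNIV) (X_proc \<xi> I j n))"

lemma measure_law: "measure_pmf (law j n) = distr \<Omega> (count_space UNIV) (X_proc \<xi> I j n)"
  unfolding law_def by (rule Abs_pmf_distr[OF measurable_X_proc])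

lemma prob_law: "measure_pmf.prob (law j n) E = prob {\<omega> \<in> space \<Omega>. X_proc \<xi> I j n \<omega> \<in> E}"
  unfolding measure_def emeasure_X_proc_eq measure_law ..

lemma emeasure_law: "emeasure (law j n) E = emeasure \<Omega> {\<omega> \<in> space \<Omega>. X_proc \<xi> I j n \<omega> \<in> E}"
  unfolding emeasure_X_proc_eq measure_law ..

lemma pmf_law: "pmf (law j n) k = prob {\<omega> \<in> space \<Omega>. X_proc \<xi> I j n \<omega> = k}"
  using prob_law[of j n "{k}"] by (simp add: measure_pmf_single)

text \<open>The event may depend on the present state; the first limit compares X_(n+1) with X_n and
  needs this joint form.\<close>

lemma emeasure_joint:
  "emeasure \<Omega> {\<omega> \<in> space \<Omega>. X_proc \<xi> I j (Suc n) \<omega> \<in> E (X_proc \<xi> I j n \<omega>)}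
    = (\<integral>\<^sup>+a. emeasure (law a 1) (E a) \<partial>law j n)"
proof -
  have ev: "{\<omega> \<in> space \<Omega>. X_proc \<xi> I j n \<omega> = a \<and> X_proc \<xi> I j (Suc n) \<omega> \<in> F} \<in> events" for a F
  proof -
    have "{\<omega> \<in> space \<Omega>. X_proc \<xi> I j n \<omega> = a \<and> X_proc \<xi> I j (Suc n) \<omega> \<in> F}
      = (X_proc \<xi> I j n -` {a} \<inter> space \<Omega>) \<inter> (X_proc \<xi> I j (Suc n) -` F \<inter> space \<Omega>)" by auto
    then show ?thesis
      using sets.Int[OF measurable_sets[OF measurable_X_proc, of "{a}" j n] measurable_sets[OF measurable_X_proc, of F j "Suc n"]]
      by (simp only: sets_count_space Pow_UNIV UNIV_I)
  qed
  have "emeasure \<Omega> {\<omega> \<in> space \<Omega>. X_proc \<xi> I j (Suc n) \<omega> \<in> E (X_proc \<xi> I j n \<omega>)}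
     = emeasure \<Omega> (\<Union>a\<in>UNIV. {\<omega> \<in> space \<Omega>. X_proc \<xi> I j n \<omega> = a \<and> X_proc \<xi> I j (Suc n) \<omega> \<in> E a})"
    by (rule arg_cong[where f = "emeasure \<Omega>"]) auto
  also have "\<dots>
     = (\<integral>\<^sup>+a. emeasure \<Omega> {\<omega> \<in> space \<Omega>. X_proc \<xi> I j n \<omega> = a \<and> X_proc \<xi> I j (Suc n) \<omega> \<in> E a} \<partial>count_space UNIV)"
    by (rule emeasure_UN_countable) (use ev in \<open>auto simp: disjoint_family_on_def\<close>)
  also have "\<dots> = (\<integral>\<^sup>+a. ennreal (pmf (law j n) a) * emeasure (law a 1) (E a) \<partial>count_space UNIV)"
    by (rule nn_integral_cong) (simp only: markov pmf_law emeasure_law emeasure_eq_measure[symmetric])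
  also have "\<dots> = (\<integral>\<^sup>+a. emeasure (law a 1) (E a) \<partial>law j n)"
    by (rule nn_integral_measure_pmf[symmetric])
  finally show ?thesis .
qed

lemma law_0: "law j 0 = return_pmf j"
proof (rule pmf_eqI)
  fix k
  show "pmf (law j 0) k = pmf (return_pmf j) k"
    by (simp add: pmf_law X_proc_def Z_proc_def prob_space indicator_def)
qed

lemma law_Suc: "law j (Suc n) = bind_pmf (law j n) (\<lambda>a. law a 1)"
proof (rule pmf_eqI)
  fix k
  have "ennreal (pmf (law j (Suc n)) k) = ennreal (pmf (bind_pmf (law j n) (\<lambda>a. law a 1)) k)"
    using emeasure_joint[of j n "\<lambda>_. {k}"]
    by (simp add: pmf_law emeasure_eq_measure ennreal_pmf_bind emeasure_pmf_single)
  then show "pmf (law j (Suc n)) k = pmf (bind_pmf (law j n) (\<lambda>a. law a 1)) k" by simp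
qed

end

section \<open>One-step estimates\<close>

definition pop_size :: "nat ^ 2 \<Rightarrow> nat" where
  "pop_size j = (\<Sum>k\<in>UNIV. j $ k)"

lemma pop_size_add [simp]: "pop_size (x + y) = pop_size x + pop_size y"
  by (simp add: pop_size_def sum.distrib)

lemma pop_size_0 [simp]: "pop_size 0 = 0"
  by (simp add: pop_size_def)

lemma pop_size_axis [simp]: "pop_size (axis k n) = n"
  by (simp add: pop_size_def axis_def)

lemma pop_size_sum: "pop_size (\<Sum>b\<in>B. f b) = (\<Sum>b\<in>B. pop_size (f b))"
  by (induction B rule: infinite_finite_induct) auto

lemma pop_size_eq_0_iff [simp]: "pop_size j = 0 \<longleftrightarrow> j = 0"
  by (simp add: pop_size_def vec_eq_iff)

lemma pop_size_pos_iff [simp]: "pop_size j > 0 \<longleftrightarrow> j \<noteq> 0"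
  using pop_size_eq_0_iff[of j] by linarith

lemma pop_size_eq_1_iff: "pop_size j = Suc 0 \<longleftrightarrow> j = axis 1 (Suc 0) \<or> j = axis 2 (Suc 0)"
  by (auto simp: pop_size_def sum_2 vec_eq_iff forall_2 axis_def)

lemma component_le_pop_size: "j $ k \<le> pop_size j"
  unfolding pop_size_def by (rule member_le_sum) auto

lemma finite_pop_size_le: "finite {j. pop_size j \<le> m}"
proof (rule finite_subset)
  define f :: "nat \<times> nat \<Rightarrow> nat ^ 2" where "f = (\<lambda>(a, b). \<chi> k. if k = 1 then a else b)"
  show "{j. pop_size j \<le> m} \<subseteq> f ` ({..m} \<times> {..m})"
  proof
    fix j assume "j \<in> {j. pop_size j \<le> m}"
    then have "j $ k \<le> m" for k
      using component_le_pop_size[of j k] by simp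
    then have "(j $ 1, j $ 2) \<in> {..m} \<times> {..m}" by simp
    moreover have "f (j $ 1, j $ 2) = j"
      by (simp add: f_def vec_eq_iff forall_2)
    ultimately show "j \<in> f ` ({..m} \<times> {..m})"
      using rev_image_eqI[of "(j $ 1, j $ 2)" _ j f] by simp
  qed
  show "finite (f ` ({..m} \<times> {..m}))" by simp
qed

lemma inner_one_real_vec: "1 \<bullet> real_vec j = real (pop_size j)"
  by (simp add: inner_vec_def real_vec_def pop_size_def)

lemma real_vec_add: "real_vec (x + y) = real_vec x + real_vec y"
  by (simp add: real_vec_def vec_eq_iff)

lemma real_vec_0 [simp]: "real_vec 0 = 0"
  by (simp add: real_vec_def vec_eq_iff)

lemma real_vec_sum: "real_vec (\<Sum>b\<in>B. f b) = (\<Sum>b\<in>B. real_vec (f b))"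
  by (induction B rule: infinite_finite_induct) (auto simp: real_vec_add)

lemma inner_real_vec: "l \<bullet> real_vec x = (\<Sum>k\<in>UNIV. l $ k * real (x $ k))"
  by (simp add: inner_vec_def real_vec_def)

lemma abs_inner_real_vec_le: "\<bar>l \<bullet> real_vec x\<bar> \<le> (\<Sum>k\<in>UNIV. \<bar>l $ k\<bar>) * real (pop_size x)"
proof -
  have "\<bar>l \<bullet> real_vec x\<bar> \<le> (\<Sum>k\<in>UNIV. \<bar>l $ k\<bar> * real (x $ k))"
    unfolding inner_real_vec by (rule order_trans[OF sum_abs]) (simp add: abs_mult)
  also have "\<dots> \<le> (\<Sum>k\<in>UNIV. \<bar>l $ k\<bar> * real (pop_size x))"
    by (intro sum_mono mult_left_mono) (auto simp: component_le_pop_size)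
  finally show ?thesis by (simp add: sum_distrib_right)
qed

lemma inner_real_vec_mult: "l \<bullet> (real_vec j v* M) = (\<Sum>i\<in>UNIV. real (j $ i) * (\<Sum>k\<in>UNIV. M $ i $ k * l $ k))"
proof -
  have "l \<bullet> (real_vec j v* M) = (M *v l) \<bullet> real_vec j"
    by (metis dot_lmul_matrix inner_commute)
  then show ?thesis
    by (simp add: inner_real_vec matrix_vector_mult_def mult.commute)
qed

lemma (in prob_space) prob_ge_le_moment:
  fixes S :: "'a \<Rightarrow> real"
  assumes S: "integrable M (\<lambda>\<omega>. \<bar>S \<omega>\<bar> powr p)" and a: "a > 0" and p: "p > 0"
  shows "prob {\<omega> \<in> space M. \<bar>S \<omega>\<bar> > a} \<le> expectation (\<lambda>\<omega>. \<bar>S \<omega>\<bar> powr p) / a powr p"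
proof -
  have "prob {\<omega> \<in> space M. \<bar>S \<omega>\<bar> > a} \<le> prob {\<omega> \<in> space M. \<bar>S \<omega>\<bar> powr p \<ge> a powr p}"
  proof (rule finite_measure_mono)
    show "{\<omega> \<in> space M. \<bar>S \<omega>\<bar> > a} \<subseteq> {\<omega> \<in> space M. \<bar>S \<omega>\<bar> powr p \<ge> a powr p}"
      using a p by (auto intro!: powr_mono2)
    show "{\<omega> \<in> space M. \<bar>S \<omega>\<bar> powr p \<ge> a powr p} \<in> events"
      using borel_measurable_integrable[OF S] by measurable
  qed
  also have "\<dots> \<le> expectation (\<lambda>\<omega>. \<bar>S \<omega>\<bar> powr p) / a powr p"
    by (rule integral_Markov_inequality_measure[OF S sets.empty_sets]) (use a in auto)
  finally show ?thesis .
qed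

text \<open>The monomial w^x. It turns sums of offspring vectors into products, and for positive w
  it serves as a weight on the states of one population size.\<close>

definition monomial :: "(2 \<Rightarrow> real) \<Rightarrow> nat ^ 2 \<Rightarrow> real" where
  "monomial w x = (\<Prod>i\<in>UNIV. w i ^ (x $ i))"

lemma monomial_add: "monomial w (x + y) = monomial w x * monomial w y"
  by (simp add: monomial_def power_add prod.distrib)

lemma monomial_0 [simp]: "monomial w 0 = 1"
  by (simp add: monomial_def)

lemma monomial_sum: "monomial w (\<Sum>b\<in>B. f b) = (\<Prod>b\<in>B. monomial w (f b))"
  by (induction B rule: infinite_finite_induct) (auto simp: monomial_add)

lemma monomial_axis: "monomial w (axis k n) = w k ^ n"
proof -
  have "monomial w (axis k n) = (\<Prod>i\<in>UNIV. if i = k then w k ^ n else 1)"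
    unfolding monomial_def by (intro prod.cong) (auto simp: axis_def)
  then show ?thesis by simp
qed

text \<open>Generating functions are eliminated here: \<open>M\<close> and \<open>A\<close> enter as
  means and single-child probabilities of the offspring laws.\<close>

locale growing_branching = branching_with_immigration \<Omega> P \<xi> I
  for \<Omega> :: "'w measure"
  and P :: "2 \<Rightarrow> (nat ^ 2) pmf"
  and \<xi> :: "nat \<Rightarrow> nat \<Rightarrow> 2 \<Rightarrow> nat \<Rightarrow> 'w \<Rightarrow> nat ^ 2"
  and I :: "nat \<Rightarrow> 'w \<Rightarrow> nat ^ 2" +
  fixes M A :: "real ^ 2 ^ 2" and s \<kappa> h0 :: real
  assumes no_death: "pmf (P k) 0 = 0"
    and mean: "M $ k $ m = measure_pmf.expectation (P k) (\<lambda>x. real (x $ m))"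
    and single: "A $ k $ m = pmf (P k) (axis m 1)"
    and s_ge_1: "s \<ge> 1" and kappa_ge_1: "\<kappa> \<ge> 1"
    and offspring_moment: "integrable (measure_pmf (P k)) (\<lambda>x. real (pop_size x) powr (2 * s))"
    and immigration_moment: "integrable \<Omega> (\<lambda>\<omega>. real (pop_size (I 1 \<omega>)) powr \<kappa>)"
    and h0: "h0 = prob {\<omega> \<in> space \<Omega>. I 1 \<omega> = 0}"
begin

lemma nonzero_offspring: "x \<in> set_pmf (P k) \<Longrightarrow> x \<noteq> 0"
  using no_death[of k] by (auto simp: set_pmf_iff)

lemma measurable_fun_input:
  fixes f :: "nat ^ 2 \<Rightarrow> real"
  shows "a \<in> inputs \<Longrightarrow> (\<lambda>\<omega>. f (input a \<omega>)) \<in> borel_measurable \<Omega>"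
  by (rule measurable_compose[OF measurable_input]) auto

lemma integrable_input:
  fixes f :: "nat ^ 2 \<Rightarrow> real"
  shows "integrable \<Omega> (\<lambda>\<omega>. f (input (Inr b) \<omega>)) \<longleftrightarrow> integrable (measure_pmf (P (particle_type b))) f"
  using integrable_distr_eq[OF measurable_input[of "Inr b"], of f] by (simp add: distr_input)

lemma expectation_input:
  fixes f :: "nat ^ 2 \<Rightarrow> real"
  shows "expectation (\<lambda>\<omega>. f (input (Inr b) \<omega>)) = measure_pmf.expectation (P (particle_type b)) f"
  using integral_distr[OF measurable_input[of "Inr b"], of f] by (simp add: distr_input)

lemma AE_input_nonzero: "AE \<omega> in \<Omega>. \<forall>b. input (Inr b) \<omega> \<noteq> 0"
proof -
  have "AE \<omega> in \<Omega>. input (Inr b) \<omega> \<noteq> 0" for b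
  proof -
    have "AE x in measure_pmf (P (particle_type b)). x \<noteq> 0"
      using nonzero_offspring by (auto simp: AE_measure_pmf_iff)
    then have "AE x in distr \<Omega> (count_space UNIV) (input (Inr b)). x \<noteq> 0"
      by (simp only: distr_input)
    then show ?thesis
      by (subst (asm) AE_distr_iff[OF measurable_input]) auto
  qed
  then show ?thesis by (subst AE_all_countable) blast
qed

lemma card_founders: "card (founders j) = pop_size j"
  using sum_founders[of "\<lambda>_. 1 :: nat" j] by (simp add: pop_size_def)

lemma pop_size_X_1:
  assumes "\<forall>b. input (Inr b) \<omega> \<noteq> 0"
  shows "pop_size j \<le> (\<Sum>b\<in>founders j. pop_size (input (Inr b) \<omega>))"
proof -
  have "(\<Sum>b\<in>founders j. 1) \<le> (\<Sum>b\<in>founders j. pop_size (input (Inr b) \<omega>))"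
    using assms by (intro sum_mono) (simp add: Suc_le_eq del: split_paired_All)
  then show ?thesis by (simp add: card_founders)
qed

lemma pop_size_le_of_law_1:
  assumes "x \<in> set_pmf (law j 1)"
  shows "pop_size j \<le> pop_size x"
proof -
  have "AE \<omega> in \<Omega>. pop_size j \<le> pop_size (X_proc \<xi> I j 1 \<omega>)"
    using AE_input_nonzero
  proof eventually_elim
    case (elim \<omega>)
    then show ?case
      using pop_size_X_1[OF elim, of j] unfolding X_proc_1 offspring_sum_def by (simp add: pop_size_sum)
  qed
  then have "AE x in law j 1. pop_size j \<le> pop_size x"
    unfolding measure_law by (subst AE_distr_iff[OF measurable_X_proc]) auto
  then show ?thesis using assms by (simp add: AE_measure_pmf_iff)
qed

lemma pop_size_le_of_law: "x \<in> set_pmf (law j n) \<Longrightarrow> pop_size j \<le> pop_size x"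
proof (induction n arbitrary: x)
  case 0
  then show ?case by (simp add: law_0)
next
  case (Suc n)
  then have "x \<in> set_pmf (bind_pmf (law j n) (\<lambda>a. law a 1))" by (simp only: law_Suc)
  then obtain y where y: "y \<in> set_pmf (law j n)" "x \<in> set_pmf (law y 1)" by auto
  show ?case
    using Suc.IH[OF y(1)] pop_size_le_of_law_1[OF y(2)] by simp
qed

section \<open>Transitions that keep the population size\<close>

lemma expectation_single:
  "measure_pmf.expectation (P k) (\<lambda>x. if pop_size x = 1 then monomial w x else 0) = (\<Sum>m\<in>UNIV. A $ k $ m * w m)"
proof -
  have "measure_pmf.expectation (P k) (\<lambda>x. if pop_size x = 1 then monomial w x else 0)
     = (\<Sum>x\<in>{axis 1 1, axis 2 1}. pmf (P k) x *\<^sub>R (if pop_size x = 1 then monomial w x else 0))"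
    by (rule integral_measure_pmf) (auto simp: pop_size_eq_1_iff split: if_splits)
  also have "\<dots> = (\<Sum>m\<in>UNIV. A $ k $ m * w m)"
    by (simp add: sum_2 axis_eq_axis monomial_axis single)
  finally show ?thesis .
qed

text \<open>Almost surely, the size is unchanged iff there is no immigrant and every particle has
  exactly one child, so the expectation factorizes over the particles. Within a level, the
  transition matrix is thus h0 times a symmetric power of \<open>A\<close>.\<close>

lemma level_expectation:
  "(\<Sum>x | pop_size x = pop_size j. pmf (law j 1) x * monomial w x) = h0 * (\<Prod>i\<in>UNIV. (\<Sum>m\<in>UNIV. A $ i $ m * w m) ^ (j $ i))"
proof -
  define g where "g = (\<lambda>x. if pop_size x = 1 then monomial w x else 0)"
  \<comment> \<open>One factor per input, equal to 0 as soon as that input enlarges the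
    population.\<close>
  define H where "H = (\<lambda>a \<omega>. case a of Inl c \<Rightarrow> indicator {0} (input a \<omega>) | Inr b \<Rightarrow> g (input a \<omega>))"
  define B :: "(nat + nat \<times> nat \<times> 2 \<times> nat) set" where "B = insert (Inl 1) (Inr ` founders j)"
  have B: "finite B" "B \<subseteq> inputs" by (auto simp: B_def)
  have Heq: "H = (\<lambda>a \<omega>. (case a of Inl c \<Rightarrow> indicator {0} | Inr b \<Rightarrow> g) (input a \<omega>))"
    by (auto simp: H_def fun_eq_iff split: sum.split)
  have ind: "indep_vars (\<lambda>_. borel) H B"
    unfolding Heq by (rule indep_vars_compose2[OF indep_vars_subset[OF indep_inputs B(2)]]) auto
  have gfin: "integrable (measure_pmf (P k)) g" for k
  proof (rule measure_pmf.integrable_const_bound[where B = "\<bar>w 1\<bar> + \<bar>w 2\<bar>"])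
    show "AE x in P k. norm (g x) \<le> \<bar>w 1\<bar> + \<bar>w 2\<bar>"
      by (auto simp: g_def pop_size_eq_1_iff monomial_axis)
  qed simp
  have int: "integrable \<Omega> (H a)" if "a \<in> B" for a
  proof (cases a)
    case (Inl c)
    then have c: "c = 1" using that by (auto simp: B_def)
    show ?thesis
      unfolding H_def Inl c sum.case
      by (rule integrable_const_bound[where B = 1])
        (auto intro!: measurable_fun_input split: split_indicator)
  next
    case (Inr b)
    then show ?thesis using gfin by (simp add: H_def integrable_input)
  qed
  have EI: "expectation (H (Inl 1)) = h0"
  proof -
    have "H (Inl 1) = indicator {\<omega>. I 1 \<omega> = 0}"
      by (auto simp: H_def input_def fun_eq_iff split: split_indicator)
    then have "expectation (H (Inl 1)) = prob ({\<omega>. I 1 \<omega> = 0} \<inter> space \<Omega>)" by simp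
    also have "{\<omega>. I 1 \<omega> = 0} \<inter> space \<Omega> = {\<omega> \<in> space \<Omega>. I 1 \<omega> = 0}" by auto
    finally show ?thesis by (simp add: h0)
  qed
  have "(\<Sum>x | pop_size x = pop_size j. pmf (law j 1) x * monomial w x)
      = measure_pmf.expectation (law j 1) (\<lambda>x. if pop_size x = pop_size j then monomial w x else 0)"
  proof -
    have "finite {x. pop_size x = pop_size j}"
      by (rule finite_subset[OF _ finite_pop_size_le[of "pop_size j"]]) auto
    then have "measure_pmf.expectation (law j 1) (\<lambda>x. if pop_size x = pop_size j then monomial w x else 0)
       = (\<Sum>x | pop_size x = pop_size j. pmf (law j 1) x *\<^sub>R (if pop_size x = pop_size j then monomial w x else 0))"
      by (intro integral_measure_pmf) (auto split: if_splits)
    then show ?thesis by simp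
  qed
  also have "\<dots> = expectation (\<lambda>\<omega>. if pop_size (X_proc \<xi> I j 1 \<omega>) = pop_size j then monomial w (X_proc \<xi> I j 1 \<omega>) else 0)"
    unfolding measure_law by (rule integral_distr[OF measurable_X_proc]) simp
  also have "\<dots> = expectation (\<lambda>\<omega>. \<Prod>a\<in>B. H a \<omega>)"
  proof (rule integral_cong_AE)
    show "(\<lambda>\<omega>. if pop_size (X_proc \<xi> I j 1 \<omega>) = pop_size j then monomial w (X_proc \<xi> I j 1 \<omega>) else 0) \<in> borel_measurable \<Omega>"
      by (rule measurable_compose[OF measurable_X_proc]) simp
    show "(\<lambda>\<omega>. \<Prod>a\<in>B. H a \<omega>) \<in> borel_measurable \<Omega>"
      by (intro borel_measurable_prod borel_measurable_integrable int)
    show "AE \<omega> in \<Omega>. (if pop_size (X_proc \<xi> I j 1 \<omega>) = pop_size j then monomial w (X_proc \<xi> I j 1 \<omega>) else 0) = (\<Prod>a\<in>B. H a \<omega>)"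
      using AE_input_nonzero
    proof eventually_elim
      case (elim \<omega>)
      let ?t = "\<Sum>b\<in>founders j. pop_size (input (Inr b) \<omega>)"
      have X: "X_proc \<xi> I j 1 \<omega> = I 1 \<omega> + (\<Sum>b\<in>founders j. input (Inr b) \<omega>)"
        unfolding X_proc_1 offspring_sum_def ..
      have tX: "pop_size (X_proc \<xi> I j 1 \<omega>) = pop_size (I 1 \<omega>) + ?t"
        unfolding X by (simp add: pop_size_sum)
      have prodB: "(\<Prod>a\<in>B. H a \<omega>) = indicator {0} (I 1 \<omega>) * (\<Prod>b\<in>founders j. g (input (Inr b) \<omega>))"
        unfolding B_def by (subst prod.insert) (auto simp: prod.reindex H_def input_def)
      show ?case
      proof (cases "I 1 \<omega> = 0 \<and> (\<forall>b\<in>founders j. pop_size (input (Inr b) \<omega>) = 1)")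
        case True
        then have "?t = pop_size j" by (simp add: card_founders)
        then have "pop_size (X_proc \<xi> I j 1 \<omega>) = pop_size j" using tX True by simp
        moreover have "monomial w (X_proc \<xi> I j 1 \<omega>) = (\<Prod>b\<in>founders j. g (input (Inr b) \<omega>))"
          using True unfolding X by (simp add: monomial_sum g_def)
        ultimately show ?thesis using True by (simp add: prodB)
      next
        case False
        have ge: "pop_size (input (Inr b) \<omega>) \<ge> 1" for b
          using elim by (simp add: Suc_le_eq del: split_paired_All)
        have "pop_size (X_proc \<xi> I j 1 \<omega>) \<noteq> pop_size j"
        proof
          assume "pop_size (X_proc \<xi> I j 1 \<omega>) = pop_size j"
          then have eq: "pop_size (I 1 \<omega>) = 0" "?t = (\<Sum>b\<in>founders j. 1)"
            using tX pop_size_X_1[OF elim, of j] by (auto simp: card_founders)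
          \<comment> \<open>Every particle has at least one child, so equality of the totals forces
            equality in each term.\<close>
          have "\<forall>b\<in>founders j. pop_size (input (Inr b) \<omega>) - 1 = 0"
          proof -
            have "(\<Sum>b\<in>founders j. pop_size (input (Inr b) \<omega>) - 1) = 0"
              using eq(2) ge by (subst sum_subtractf_nat) auto
            then show ?thesis by simp
          qed
          then have "pop_size (input (Inr b) \<omega>) = 1" if "b \<in> founders j" for b
            using ge[of b] that by (metis diff_is_0_eq le_antisym)
          then show False using False eq(1) by auto
        qed
        moreover have "(\<Prod>a\<in>B. H a \<omega>) = 0"
        proof (cases "I 1 \<omega> = 0")
          case True
          then obtain b where "b \<in> founders j" "pop_size (input (Inr b) \<omega>) \<noteq> 1" using False by auto
          then have "(\<Prod>b\<in>founders j. g (input (Inr b) \<omega>)) = 0"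
            by (intro prod_zero) (auto simp: g_def)
          then show ?thesis by (simp add: prodB)
        qed (simp add: prodB)
        ultimately show ?thesis by simp
      qed
    qed
  qed
  also have "\<dots> = (\<Prod>a\<in>B. expectation (H a))"
    by (rule indep_vars_lebesgue_integral[OF B(1) ind int])
  also have "\<dots> = h0 * (\<Prod>b\<in>founders j. expectation (H (Inr b)))"
    unfolding B_def by (subst prod.insert) (auto simp: prod.reindex EI[simplified])
  also have "(\<Prod>b\<in>founders j. expectation (H (Inr b))) = (\<Prod>b\<in>founders j. \<Sum>m\<in>UNIV. A $ particle_type b $ m * w m)"
  proof (rule prod.cong[OF refl])
    fix b
    have "expectation (H (Inr b)) = expectation (\<lambda>\<omega>. g (input (Inr b) \<omega>))" by (simp add: H_def)
    also have "\<dots> = measure_pmf.expectation (P (particle_type b)) g" by (rule expectation_input)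
    also have "\<dots> = (\<Sum>m\<in>UNIV. A $ particle_type b $ m * w m)"
      unfolding g_def by (rule expectation_single)
    finally show "expectation (H (Inr b)) = (\<Sum>m\<in>UNIV. A $ particle_type b $ m * w m)" .
  qed
  also have "\<dots> = (\<Prod>i\<in>UNIV. (\<Sum>m\<in>UNIV. A $ i $ m * w m) ^ (j $ i))"
    by (simp add: prod_founders particle_type_def)
  finally show ?thesis .
qed

text \<open>With w the indicator of type k, the monomial picks out e_k among the two states of size
  1.\<close>

lemma pmf_law_axis: "pmf (law (axis i 1) 1) (axis k 1) = h0 * A $ i $ k"
proof -
  have set: "{x. pop_size x = Suc 0} = {axis 1 (Suc 0), axis 2 (Suc 0)}"
    by (auto simp: pop_size_eq_1_iff)
  have "(\<Prod>l\<in>UNIV. (\<Sum>m\<in>UNIV. A $ l $ m * of_bool (m = k)) ^ ((axis i 1 :: nat ^ 2) $ l))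
      = monomial (\<lambda>l. A $ l $ k) (axis i 1)"
    by (simp add: monomial_def)
  then show ?thesis
    using level_expectation[of "axis i 1" "\<lambda>m. of_bool (m = k)"] exhaust_2[of k]
    by (auto simp: set axis_eq_axis monomial_axis)
qed


section \<open>Concentration of one step around its conditional mean\<close>

lemma integrable_offspring_powr:
  assumes "0 \<le> q" "q \<le> 2 * s"
  shows "integrable (measure_pmf (P k)) (\<lambda>x. real (pop_size x) powr q)"
  using measure_pmf.integrable_powr_le[of "P k" "\<lambda>x. real (pop_size x)" "2 * s" q] offspring_moment assms
  by simp

lemma integrable_offspring_component: "integrable (measure_pmf (P k)) (\<lambda>x. real (x $ m))"
proof (rule Bochner_Integration.integrable_bound)
  show "integrable (measure_pmf (P k)) (\<lambda>x. real (pop_size x) powr 1)"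
    by (rule integrable_offspring_powr) (use s_ge_1 in auto)
  show "AE x in measure_pmf (P k). norm (real (x $ m)) \<le> norm (real (pop_size x) powr 1)"
    by (simp add: component_le_pop_size)
qed simp

definition deviation :: "real ^ 2 \<Rightarrow> 2 \<Rightarrow> nat ^ 2 \<Rightarrow> real" where
  "deviation l i x = l \<bullet> real_vec x - (\<Sum>k\<in>UNIV. M $ i $ k * l $ k)"

lemma expectation_deviation: "measure_pmf.expectation (P i) (deviation l i) = 0"
  unfolding deviation_def inner_real_vec
  by (simp add: integrable_offspring_component mean mult.commute)

lemma integrable_deviation: "integrable (measure_pmf (P i)) (\<lambda>x. \<bar>deviation l i x\<bar> powr (2 * s))"
proof (rule Bochner_Integration.integrable_bound)
  \<comment> \<open>Almost surely |x| \<ge> 1, so the constant mean is absorbed into a multiple of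
    |x|.\<close>
  define L where "L = (\<Sum>k\<in>UNIV. \<bar>l $ k\<bar>) + \<bar>\<Sum>k\<in>UNIV. M $ i $ k * l $ k\<bar>"
  show "integrable (measure_pmf (P i)) (\<lambda>x. L powr (2 * s) * real (pop_size x) powr (2 * s))"
    using offspring_moment by simp
  have "norm (\<bar>deviation l i x\<bar> powr (2 * s)) \<le> norm (L powr (2 * s) * real (pop_size x) powr (2 * s))"
    if "x \<noteq> 0" for x
  proof -
    have 1: "real (pop_size x) \<ge> 1" using that by (simp add: Suc_le_eq flip: pop_size_pos_iff)
    have "\<bar>deviation l i x\<bar> \<le> \<bar>l \<bullet> real_vec x\<bar> + \<bar>\<Sum>k\<in>UNIV. M $ i $ k * l $ k\<bar>"
      unfolding deviation_def by (rule abs_triangle_ineq4)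
    also have "\<dots> \<le> (\<Sum>k\<in>UNIV. \<bar>l $ k\<bar>) * real (pop_size x) + \<bar>\<Sum>k\<in>UNIV. M $ i $ k * l $ k\<bar> * real (pop_size x)"
      by (intro add_mono abs_inner_real_vec_le) (use 1 in \<open>simp add: mult_le_cancel_left1\<close>)
    also have "\<dots> = L * real (pop_size x)" by (simp add: L_def distrib_right)
    finally have "\<bar>deviation l i x\<bar> powr (2 * s) \<le> (L * real (pop_size x)) powr (2 * s)"
      using s_ge_1 by (intro powr_mono2) auto
    then show ?thesis by (simp add: powr_mult)
  qed
  then show "AE x in measure_pmf (P i). norm (\<bar>deviation l i x\<bar> powr (2 * s))
      \<le> norm (L powr (2 * s) * real (pop_size x) powr (2 * s))"
    unfolding AE_measure_pmf_iff using nonzero_offspring by blast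
qed simp

text \<open>Markov's inequality with the moment of order 2s: the sum of |j| centred terms has moment
  O(|j|^s), and |j|^s / (\<delta> |j|)^(2s) = \<delta>^(-2s) |j|^(-s).\<close>

lemma offspring_deviation_bound:
  "\<exists>K\<ge>0. \<forall>j \<delta>. \<delta> > 0 \<longrightarrow> j \<noteq> 0 \<longrightarrow>
    prob {\<omega> \<in> space \<Omega>. \<bar>\<Sum>b\<in>founders j. deviation l (particle_type b) (input (Inr b) \<omega>)\<bar> > \<delta> * real (pop_size j)}
      \<le> K / \<delta> powr (2 * s) * real (pop_size j) powr (- s)"
proof -
  define \<beta> where "\<beta> = (\<Sum>i\<in>UNIV. measure_pmf.expectation (P i) (\<lambda>x. \<bar>deviation l i x\<bar> powr (2 * s)))"
  define Y :: "nat + nat \<times> nat \<times> 2 \<times> nat \<Rightarrow> 'w \<Rightarrow> real"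
    where "Y = (\<lambda>a \<omega>. deviation l (particle_type (projr a)) (input a \<omega>))"
  have \<beta>: "measure_pmf.expectation (P i) (\<lambda>x. \<bar>deviation l i x\<bar> powr (2 * s)) \<le> \<beta>" for i
    unfolding \<beta>_def by (rule member_le_sum) auto
  have \<beta>0: "\<beta> \<ge> 0" unfolding \<beta>_def by (intro sum_nonneg) simp
  have p: "2 * s \<ge> 2" using s_ge_1 by simp
  from moment_sum_indep[OF p \<beta>0]
  obtain K where K: "K \<ge> 0" and bound: "\<forall>B (Y :: nat + nat \<times> nat \<times> 2 \<times> nat \<Rightarrow> 'w \<Rightarrow> real). finite B \<longrightarrow>
      indep_vars (\<lambda>_. borel) Y B \<longrightarrow>
      (\<forall>x\<in>B. integrable \<Omega> (\<lambda>\<omega>. \<bar>Y x \<omega>\<bar> powr (2 * s))) \<longrightarrow>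
      (\<forall>x\<in>B. expectation (\<lambda>\<omega>. \<bar>Y x \<omega>\<bar> powr (2 * s)) \<le> \<beta>) \<longrightarrow>
      (\<forall>x\<in>B. expectation (Y x) = 0) \<longrightarrow>
      integrable \<Omega> (\<lambda>\<omega>. \<bar>\<Sum>x\<in>B. Y x \<omega>\<bar> powr (2 * s)) \<and>
      expectation (\<lambda>\<omega>. \<bar>\<Sum>x\<in>B. Y x \<omega>\<bar> powr (2 * s)) \<le> K * real (card B) powr (2 * s / 2)"
    by (elim exE conjE) (rule that)
  show ?thesis
  proof (intro exI[of _ K] conjI K allI impI)
    fix j :: "nat ^ 2" and \<delta> :: real assume \<delta>: "\<delta> > 0" and j: "j \<noteq> 0"
    let ?B = "Inr ` founders j :: (nat + nat \<times> nat \<times> 2 \<times> nat) set"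
    let ?S = "\<lambda>\<omega>. \<Sum>a\<in>?B. Y a \<omega>"
    define n where "n = real (pop_size j)"
    have n: "n > 0" using j by (simp add: n_def)
    have card: "card ?B = pop_size j"
      by (subst card_image) (auto simp: card_founders)
    have "integrable \<Omega> (\<lambda>\<omega>. \<bar>?S \<omega>\<bar> powr (2 * s)) \<and>
      expectation (\<lambda>\<omega>. \<bar>?S \<omega>\<bar> powr (2 * s)) \<le> K * real (card ?B) powr (2 * s / 2)"
    proof (intro bound[rule_format])
      show "finite ?B" by simp
      have "?B \<subseteq> inputs" by auto
      from indep_vars_subset[OF indep_inputs this] show "indep_vars (\<lambda>_. borel) Y ?B"
        unfolding Y_def by (rule indep_vars_compose2) auto
    next
      fix a assume "a \<in> ?B"
      then obtain b where a: "a = Inr b" by auto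
      show "integrable \<Omega> (\<lambda>\<omega>. \<bar>Y a \<omega>\<bar> powr (2 * s))"
        unfolding Y_def a sum.sel
        using integrable_input[of "\<lambda>x. \<bar>deviation l (particle_type b) x\<bar> powr (2 * s)" b] integrable_deviation by blast
      show "expectation (\<lambda>\<omega>. \<bar>Y a \<omega>\<bar> powr (2 * s)) \<le> \<beta>"
        unfolding Y_def a sum.sel
        using expectation_input[of "\<lambda>x. \<bar>deviation l (particle_type b) x\<bar> powr (2 * s)" b] \<beta> by simp
      show "expectation (Y a) = 0"
        unfolding Y_def a sum.sel
        using expectation_input[of "deviation l (particle_type b)" b] expectation_deviation by simp
    qed
    then have int: "integrable \<Omega> (\<lambda>\<omega>. \<bar>?S \<omega>\<bar> powr (2 * s))"
      and E: "expectation (\<lambda>\<omega>. \<bar>?S \<omega>\<bar> powr (2 * s)) \<le> K * n powr s"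
      by (simp_all add: card n_def)
    have "prob {\<omega> \<in> space \<Omega>. \<bar>?S \<omega>\<bar> > \<delta> * n} \<le> expectation (\<lambda>\<omega>. \<bar>?S \<omega>\<bar> powr (2 * s)) / (\<delta> * n) powr (2 * s)"
      by (rule prob_ge_le_moment[OF int]) (use \<delta> n s_ge_1 in auto)
    also have "\<dots> \<le> K * n powr s / (\<delta> * n) powr (2 * s)"
      by (rule divide_right_mono[OF E]) simp
    also have "\<dots> = K / \<delta> powr (2 * s) * (n powr s / n powr (2 * s))"
      by (simp add: powr_mult)
    also have "n powr s / n powr (2 * s) = n powr (- s)"
      by (simp flip: powr_diff)
    finally show "prob {\<omega> \<in> space \<Omega>. \<bar>\<Sum>b\<in>founders j. deviation l (particle_type b) (input (Inr b) \<omega>)\<bar> > \<delta> * real (pop_size j)}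
      \<le> K / \<delta> powr (2 * s) * real (pop_size j) powr (- s)"
      by (simp add: sum.reindex Y_def n_def)
  qed
qed

lemma inner_X_proc_1:
  "l \<bullet> real_vec (X_proc \<xi> I j 1 \<omega>) - l \<bullet> (real_vec j v* M)
    = l \<bullet> real_vec (I 1 \<omega>) + (\<Sum>b\<in>founders j. deviation l (particle_type b) (input (Inr b) \<omega>))"
proof -
  have "(\<Sum>b\<in>founders j. \<Sum>k\<in>UNIV. M $ particle_type b $ k * l $ k) = l \<bullet> (real_vec j v* M)"
    by (simp add: sum_founders particle_type_def inner_real_vec_mult)
  then show ?thesis
    unfolding X_proc_1 offspring_sum_def deviation_def
    by (simp add: real_vec_add real_vec_sum inner_add_right inner_sum_right sum_subtractf)
qed

text \<open>The deviation splits into offspring noise, which is large with probability O(|j|^(-s)),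
  and immigration, which is large with probability O(|j|^(-\<kappa>)); the slower of the two rates
  remains.\<close>

lemma concentration:
  assumes \<delta>: "\<delta> > 0"
  shows "\<exists>C\<ge>0. \<forall>j. j \<noteq> 0 \<longrightarrow>
    measure_pmf.prob (law j 1) {x. \<bar>l \<bullet> real_vec x - l \<bullet> (real_vec j v* M)\<bar> > \<delta> * real (pop_size j)}
      \<le> C * real (pop_size j) powr (- min s \<kappa>)"
proof -
  from offspring_deviation_bound[of l]
  obtain K where K: "K \<ge> 0" and dev: "\<forall>j \<delta>. \<delta> > 0 \<longrightarrow> j \<noteq> 0 \<longrightarrow>
    prob {\<omega> \<in> space \<Omega>. \<bar>\<Sum>b\<in>founders j. deviation l (particle_type b) (input (Inr b) \<omega>)\<bar> > \<delta> * real (pop_size j)}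
      \<le> K / \<delta> powr (2 * s) * real (pop_size j) powr (- s)"
    by (elim exE conjE) (rule that)
  define L where "L = (\<Sum>k\<in>UNIV. \<bar>l $ k\<bar>) + 1"
  have L: "L > 0" by (simp add: L_def add_nonneg_pos sum_nonneg)
  define E where "E = expectation (\<lambda>\<omega>. real (pop_size (I 1 \<omega>)) powr \<kappa>)"
  have E: "E \<ge> 0" by (simp add: E_def)
  \<comment> \<open>With this choice at most \<eta> |j| immigrants account for at most half of the
    allowed deviation \<delta> |j|. The 1 in L avoids division by 0 when l = 0.\<close>
  define \<eta> where "\<eta> = \<delta> / (2 * L)"
  have \<eta>: "\<eta> > 0" using \<delta> L by (simp add: \<eta>_def)
  define C where "C = K / (\<delta> / 2) powr (2 * s) + E / \<eta> powr \<kappa>"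
  show ?thesis
  proof (intro exI[of _ C] conjI allI impI)
    show "C \<ge> 0" using K E by (simp add: C_def)
    fix j :: "nat ^ 2" assume j: "j \<noteq> 0"
    define n where "n = real (pop_size j)"
    have n: "n \<ge> 1" using j by (simp add: n_def Suc_le_eq flip: pop_size_pos_iff)
    let ?D = "\<lambda>\<omega>. \<Sum>b\<in>founders j. deviation l (particle_type b) (input (Inr b) \<omega>)"
    let ?A = "{\<omega> \<in> space \<Omega>. \<bar>?D \<omega>\<bar> > \<delta> / 2 * n}"
    let ?B = "{\<omega> \<in> space \<Omega>. \<bar>real (pop_size (I 1 \<omega>))\<bar> > \<eta> * n}"
    have mI: "(\<lambda>\<omega>. real (pop_size (I 1 \<omega>))) \<in> borel_measurable \<Omega>"
      by (rule measurable_compose[OF measurable_immigration]) auto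
    have mD: "?D \<in> borel_measurable \<Omega>"
      by (intro borel_measurable_sum measurable_fun_input) simp
    have "measure_pmf.prob (law j 1) {x. \<bar>l \<bullet> real_vec x - l \<bullet> (real_vec j v* M)\<bar> > \<delta> * n}
       = prob {\<omega> \<in> space \<Omega>. \<bar>l \<bullet> real_vec (I 1 \<omega>) + ?D \<omega>\<bar> > \<delta> * n}"
      unfolding prob_law mem_Collect_eq inner_X_proc_1 ..
    also have "\<dots> \<le> prob (?A \<union> ?B)"
    proof (rule finite_measure_mono)
      show "{\<omega> \<in> space \<Omega>. \<bar>l \<bullet> real_vec (I 1 \<omega>) + ?D \<omega>\<bar> > \<delta> * n} \<subseteq> ?A \<union> ?B"
      proof
        fix \<omega> assume \<omega>: "\<omega> \<in> {\<omega> \<in> space \<Omega>. \<bar>l \<bullet> real_vec (I 1 \<omega>) + ?D \<omega>\<bar> > \<delta> * n}"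
        show "\<omega> \<in> ?A \<union> ?B"
        proof (rule ccontr)
          assume "\<omega> \<notin> ?A \<union> ?B"
          then have 1: "\<bar>?D \<omega>\<bar> \<le> \<delta> / 2 * n" and 2: "real (pop_size (I 1 \<omega>)) \<le> \<eta> * n"
            using \<omega> by auto
          have "\<bar>l \<bullet> real_vec (I 1 \<omega>)\<bar> \<le> L * real (pop_size (I 1 \<omega>))"
            using abs_inner_real_vec_le[of l "I 1 \<omega>"] by (simp add: L_def distrib_right)
          also have "\<dots> \<le> L * (\<eta> * n)" using 2 L by (intro mult_left_mono) auto
          also have "\<dots> = \<delta> / 2 * n" using L by (simp add: \<eta>_def)
          finally have "\<bar>l \<bullet> real_vec (I 1 \<omega>) + ?D \<omega>\<bar> \<le> \<delta> / 2 * n + \<delta> / 2 * n"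
            using 1 abs_triangle_ineq[of "l \<bullet> real_vec (I 1 \<omega>)" "?D \<omega>"] by linarith
          then show False using \<omega> by simp
        qed
      qed
      show "?A \<union> ?B \<in> events"
        using mI mD by measurable
    qed
    also have "\<dots> \<le> prob ?A + prob ?B"
      by (rule measure_Un_le) (use mI mD in measurable)
    also have "\<dots> \<le> K / (\<delta> / 2) powr (2 * s) * n powr (- s) + E / \<eta> powr \<kappa> * n powr (- \<kappa>)"
    proof (rule add_mono)
      show "prob ?A \<le> K / (\<delta> / 2) powr (2 * s) * n powr (- s)"
        using dev[rule_format, of "\<delta> / 2" j] \<delta> j by (simp add: n_def)
      have "prob ?B \<le> expectation (\<lambda>\<omega>. \<bar>real (pop_size (I 1 \<omega>))\<bar> powr \<kappa>) / (\<eta> * n) powr \<kappa>"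
        by (rule prob_ge_le_moment) (use immigration_moment \<eta> n kappa_ge_1 in auto)
      also have "\<dots> = E / \<eta> powr \<kappa> * n powr (- \<kappa>)"
        by (simp add: E_def powr_mult powr_minus_divide)
      finally show "prob ?B \<le> E / \<eta> powr \<kappa> * n powr (- \<kappa>)" .
    qed
    also have "\<dots> \<le> K / (\<delta> / 2) powr (2 * s) * n powr (- min s \<kappa>) + E / \<eta> powr \<kappa> * n powr (- min s \<kappa>)"
      using n K E by (intro add_mono mult_left_mono powr_mono) auto
    also have "\<dots> = C * n powr (- min s \<kappa>)" by (simp add: C_def distrib_right)
    finally show "measure_pmf.prob (law j 1) {x. \<bar>l \<bullet> real_vec x - l \<bullet> (real_vec j v* M)\<bar> > \<delta> * real (pop_size j)}
      \<le> C * real (pop_size j) powr (- min s \<kappa>)"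
      by (simp add: n_def)
  qed
qed

end

section \<open>Contractions and exchange of limit and sum\<close>

text \<open>b / (1 - q) is the fixed point of x \<mapsto> q x + b.\<close>

lemma geometric_recurrence_bounded:
  fixes a :: "nat \<Rightarrow> real"
  assumes q: "0 \<le> q" "q < 1" and a: "\<And>n. a (Suc n) \<le> q * a n + b"
  shows "a n \<le> max (a 0) (b / (1 - q))"
proof (induction n)
  case (Suc n)
  let ?K = "max (a 0) (b / (1 - q))"
  have "b \<le> (1 - q) * ?K"
    using q by (simp add: max_def field_simps)
  moreover have "q * a n \<le> q * ?K"
    using Suc q by (intro mult_left_mono) auto
  ultimately show ?case
    using a[of n] by (simp add: algebra_simps)
qed simp

text \<open>A linear recurrence with contracting matrix T and convergent input z. In the weighted
  l1-norm N, the difference of y at the times n + t and m + t obeys the same recurrence with the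
  small input z_(n+t) - z_(m+t); so y is Cauchy.\<close>

lemma contraction_convergent:
  fixes y z :: "nat \<Rightarrow> 'b \<Rightarrow> real" and T :: "'b \<Rightarrow> 'b \<Rightarrow> real"
  assumes L: "finite L" and W: "\<And>k. k \<in> L \<Longrightarrow> W k > 0" and T: "\<And>j k. T j k \<ge> 0"
    and q: "0 \<le> q" "q < 1" and contr: "\<And>j. j \<in> L \<Longrightarrow> (\<Sum>k\<in>L. T j k * W k) \<le> q * W j"
    and y: "\<And>n k. k \<in> L \<Longrightarrow> y (Suc n) k = (\<Sum>j\<in>L. y n j * T j k) + z n k"
    and z: "\<And>k. k \<in> L \<Longrightarrow> convergent (\<lambda>n. z n k)"
    and k: "k \<in> L"
  shows "convergent (\<lambda>n. y n k)"
proof -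
  define N where "N = (\<lambda>f :: 'b \<Rightarrow> real. \<Sum>k\<in>L. \<bar>f k\<bar> * W k)"
  have step: "N (\<lambda>k. (\<Sum>j\<in>L. f j * T j k) + g k) \<le> q * N f + N g" for f g
  proof -
    have "N (\<lambda>k. (\<Sum>j\<in>L. f j * T j k) + g k) \<le> (\<Sum>k\<in>L. ((\<Sum>j\<in>L. \<bar>f j\<bar> * T j k) + \<bar>g k\<bar>) * W k)"
      unfolding N_def
    proof (intro sum_mono mult_right_mono)
      fix k
      have "\<bar>\<Sum>j\<in>L. f j * T j k\<bar> \<le> (\<Sum>j\<in>L. \<bar>f j\<bar> * T j k)"
        by (rule order_trans[OF sum_abs]) (simp add: abs_mult T)
      then show "\<bar>(\<Sum>j\<in>L. f j * T j k) + g k\<bar> \<le> (\<Sum>j\<in>L. \<bar>f j\<bar> * T j k) + \<bar>g k\<bar>"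
        by linarith
    qed (simp add: W less_imp_le)
    \<comment> \<open>Exchanging the sums moves T from the row vector f to the weight W, where the
      contraction is assumed.\<close>
    also have "\<dots> = (\<Sum>j\<in>L. \<bar>f j\<bar> * (\<Sum>k\<in>L. T j k * W k)) + N g"
      unfolding N_def distrib_right sum.distrib sum_distrib_right sum_distrib_left
      by (subst sum.swap) (simp add: mult.assoc)
    also have "\<dots> \<le> (\<Sum>j\<in>L. \<bar>f j\<bar> * (q * W j)) + N g"
      by (intro add_mono sum_mono mult_left_mono contr order_refl) auto
    also have "\<dots> = q * N f + N g"
      by (simp add: N_def sum_distrib_left mult.left_commute)
    finally show ?thesis .
  qed
  have Ncong: "N f = N g" if "\<And>k. k \<in> L \<Longrightarrow> f k = g k" for f g
    unfolding N_def using that by (intro sum.cong) auto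
  have "\<exists>B. \<forall>n. N (z n) \<le> B"
  proof -
    have "\<exists>b. \<forall>n. \<bar>z n k\<bar> \<le> b" if "k \<in> L" for k
      using convergent_imp_Bseq[OF z[OF that]] by (auto simp: Bseq_def)
    then obtain b where b: "\<And>k n. k \<in> L \<Longrightarrow> \<bar>z n k\<bar> \<le> b k" by metis
    have "N (z n) \<le> (\<Sum>k\<in>L. b k * W k)" for n
      unfolding N_def using b W by (intro sum_mono mult_right_mono) (auto intro: less_imp_le)
    then show ?thesis by blast
  qed
  then obtain B where B: "\<And>n. N (z n) \<le> B" by blast
  define K where "K = max (N (y 0)) (B / (1 - q))"
  have K: "N (y n) \<le> K" for n
    unfolding K_def
  proof (rule geometric_recurrence_bounded[OF q])
    fix n
    have "N (y (Suc n)) = N (\<lambda>k. (\<Sum>j\<in>L. y n j * T j k) + z n k)"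
      by (rule Ncong) (rule y)
    then show "N (y (Suc n)) \<le> q * N (y n) + B" using step[of "y n" "z n"] B[of n] by linarith
  qed
  have D: "N (\<lambda>k. y n k - y m k) \<le> 2 * K" for n m
  proof -
    have "N (\<lambda>k. y n k - y m k) \<le> N (y n) + N (y m)"
      unfolding N_def sum.distrib[symmetric] distrib_right[symmetric]
      by (intro sum_mono mult_right_mono) (auto simp: W less_imp_le)
    then show ?thesis using K[of n] K[of m] by simp
  qed
  have cauchy: "\<exists>n0. \<forall>n\<ge>n0. \<forall>m\<ge>n0. N (\<lambda>k. y n k - y m k) < e" if e: "e > 0" for e
  proof -
    \<comment> \<open>This makes e / 2 the fixed point of x \<mapsto> q x + e', so the induction for
      \<open>rec\<close> reproduces its constant exactly.\<close>
    define e' where "e' = e / 2 * (1 - q)"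
    have e': "e' > 0" using e q by (simp add: e'_def)
    have "\<exists>n0. \<forall>n\<ge>n0. \<forall>m\<ge>n0. N (\<lambda>k. z n k - z m k) \<le> e'"
    proof -
      define \<eta> where "\<eta> = e' / (1 + (\<Sum>k\<in>L. W k))"
      have SW: "(\<Sum>k\<in>L. W k) \<ge> 0" by (intro sum_nonneg) (simp add: W less_imp_le)
      have \<eta>: "\<eta> > 0" using e' SW by (simp add: \<eta>_def)
      have "\<exists>n0. \<forall>n\<ge>n0. \<forall>m\<ge>n0. \<bar>z n k - z m k\<bar> < \<eta>" if "k \<in> L" for k
        using convergent_Cauchy[OF z[OF that]] \<eta> by (auto simp: Cauchy_iff)
      then obtain n0 where n0: "\<And>k n m. k \<in> L \<Longrightarrow> n \<ge> n0 k \<Longrightarrow> m \<ge> n0 k \<Longrightarrow> \<bar>z n k - z m k\<bar> < \<eta>"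
        by metis
      \<comment> \<open>The sum of the finitely many thresholds serves as a common one.\<close>
      have "N (\<lambda>k. z n k - z m k) \<le> e'" if "n \<ge> (\<Sum>k\<in>L. n0 k)" "m \<ge> (\<Sum>k\<in>L. n0 k)" for n m
      proof -
        have le: "n0 k \<le> (\<Sum>k\<in>L. n0 k)" if "k \<in> L" for k
          using that L by (intro member_le_sum) auto
        have "N (\<lambda>k. z n k - z m k) \<le> (\<Sum>k\<in>L. \<eta> * W k)"
          unfolding N_def
        proof (intro sum_mono mult_right_mono)
          fix k assume k: "k \<in> L"
          have "n0 k \<le> n" "n0 k \<le> m" using le[OF k] that by linarith+
          then show "\<bar>z n k - z m k\<bar> \<le> \<eta>" using n0[OF k] by (simp add: less_imp_le)
        qed (simp add: W less_imp_le)
        also have "\<dots> = \<eta> * (\<Sum>k\<in>L. W k)" by (simp add: sum_distrib_left)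
        also have "\<dots> \<le> \<eta> * (1 + (\<Sum>k\<in>L. W k))" using \<eta> by simp
        also have "\<dots> = e'" using SW by (simp add: \<eta>_def)
        finally show ?thesis .
      qed
      then show ?thesis by blast
    qed
    then obtain n0 where n0: "\<And>n m. n \<ge> n0 \<Longrightarrow> m \<ge> n0 \<Longrightarrow> N (\<lambda>k. z n k - z m k) \<le> e'" by blast
    have rec: "N (\<lambda>k. y (n + t) k - y (m + t) k) \<le> 2 * K * q ^ t + e / 2" if "n \<ge> n0" "m \<ge> n0" for n m t
    proof (induction t)
      case 0
      then show ?case using D[of n m] e by simp
    next
      case (Suc t)
      have "N (\<lambda>k. y (n + Suc t) k - y (m + Suc t) k)
         = N (\<lambda>k. (\<Sum>j\<in>L. (y (n + t) j - y (m + t) j) * T j k) + (z (n + t) k - z (m + t) k))"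
        by (rule Ncong) (simp add: y left_diff_distrib sum_subtractf)
      also have "\<dots> \<le> q * N (\<lambda>k. y (n + t) k - y (m + t) k) + N (\<lambda>k. z (n + t) k - z (m + t) k)"
        by (rule step)
      also have "\<dots> \<le> q * (2 * K * q ^ t + e / 2) + e'"
        using that q by (intro add_mono mult_left_mono Suc.IH n0) auto
      also have "\<dots> = 2 * K * q ^ Suc t + e / 2" by (simp add: e'_def field_simps)
      finally show ?case .
    qed
    have "(\<lambda>t. 2 * K * q ^ t) \<longlonglongrightarrow> 2 * K * 0"
      using q by (intro tendsto_mult tendsto_const LIMSEQ_power_zero) auto
    then have "\<forall>\<^sub>F t in sequentially. 2 * K * q ^ t < e / 2"
      using e by (intro order_tendstoD(2)[of _ "2 * K * 0"]) auto
    then obtain t where t: "2 * K * q ^ t < e / 2" by (auto simp: eventually_sequentially)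
    have "N (\<lambda>k. y n k - y m k) < e" if "n \<ge> n0 + t" "m \<ge> n0 + t" for n m
    proof -
      have nm: "n - t + t = n" "m - t + t = m" using that by auto
      have "N (\<lambda>k. y n k - y m k) \<le> 2 * K * q ^ t + e / 2"
        using rec[of "n - t" "m - t" t] that unfolding nm by simp
      then show ?thesis using t by simp
    qed
    then show ?thesis by blast
  qed
  have "Cauchy (\<lambda>n. y n k)"
    unfolding Cauchy_iff
  proof (intro allI impI)
    fix e :: real assume e: "e > 0"
    have "e * W k > 0" using e W[OF k] by simp
    from cauchy[OF this] obtain n0 where n0: "\<And>n m. n \<ge> n0 \<Longrightarrow> m \<ge> n0 \<Longrightarrow> N (\<lambda>k. y n k - y m k) < e * W k"
      by blast
    have "norm (y n k - y m k) < e" if "n \<ge> n0" "m \<ge> n0" for n m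
    proof -
      have "\<bar>y n k - y m k\<bar> * W k \<le> N (\<lambda>k. y n k - y m k)"
        unfolding N_def by (rule member_le_sum[OF k]) (auto simp: W L less_imp_le)
      also have "\<dots> < e * W k" by (rule n0[OF that])
      finally show ?thesis using W[OF k] by simp
    qed
    then show "\<exists>n0. \<forall>m\<ge>n0. \<forall>n\<ge>n0. norm (y m k - y n k) < e" by blast
  qed
  then show ?thesis by (rule Cauchy_convergent)
qed

section \<open>Exchange of limit and infinite sum\<close>

lemma expectation_bind_pmf_bounded:
  fixes f :: "'b \<Rightarrow> real"
  assumes f: "\<And>x. 0 \<le> f x" "\<And>x. f x \<le> B"
  shows "measure_pmf.expectation (bind_pmf p g) f = measure_pmf.expectation p (\<lambda>a. measure_pmf.expectation (g a) f)"
proof -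
  have int: "integrable (measure_pmf p') f" for p'
    by (rule measure_pmf.integrable_const_bound[where B = B]) (use f in auto)
  have E0: "0 \<le> measure_pmf.expectation p' f" for p' by (rule Bochner_Integration.integral_nonneg) (rule f)
  have EB: "measure_pmf.expectation p' f \<le> B" for p'
    by (rule measure_pmf.integral_le_const[OF int]) (use f in auto)
  have nn: "(\<integral>\<^sup>+x. ennreal (f x) \<partial>measure_pmf p') = ennreal (measure_pmf.expectation p' f)" for p'
    by (rule nn_integral_eq_integral[OF int]) (use f in auto)
  have int2: "integrable (measure_pmf p) (\<lambda>a. measure_pmf.expectation (g a) f)"
    by (rule measure_pmf.integrable_const_bound[where B = B]) (use E0 EB in auto)
  have "ennreal (measure_pmf.expectation (bind_pmf p g) f)
      = ennreal (measure_pmf.expectation p (\<lambda>a. measure_pmf.expectation (g a) f))"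
    unfolding nn[symmetric] nn_integral_bind_pmf
    unfolding nn by (rule nn_integral_eq_integral[OF int2]) (use E0 in auto)
  then show ?thesis
    using E0 by (simp add: Bochner_Integration.integral_nonneg)
qed

lemma prob_bind_pmf: "measure_pmf.prob (bind_pmf p f) E = measure_pmf.expectation p (\<lambda>x. measure_pmf.prob (f x) E)"
  using expectation_bind_pmf_bounded[of "indicator E" 1 p f] by simp

lemma expectation_split_finite:
  fixes \<psi> :: "'b \<Rightarrow> real"
  assumes F: "finite F" and int: "integrable (measure_pmf p) \<psi>"
  shows "measure_pmf.expectation p \<psi> = (\<Sum>j\<in>F. pmf p j * \<psi> j) + measure_pmf.expectation p (\<lambda>j. if j \<in> F then 0 else \<psi> j)"
proof -
  have i1: "integrable (measure_pmf p) (\<lambda>j. if j \<in> F then \<psi> j else 0)"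
    by (rule Bochner_Integration.integrable_bound[OF int]) auto
  have i2: "integrable (measure_pmf p) (\<lambda>j. if j \<in> F then 0 else \<psi> j)"
    by (rule Bochner_Integration.integrable_bound[OF int]) auto
  have "measure_pmf.expectation p (\<lambda>j. if j \<in> F then \<psi> j else 0) = (\<Sum>j\<in>F. pmf p j *\<^sub>R (if j \<in> F then \<psi> j else 0))"
    by (rule integral_measure_pmf[OF F]) (auto split: if_splits)
  also have "\<dots> = (\<Sum>j\<in>F. pmf p j * \<psi> j)" by (rule sum.cong) auto
  finally have "(\<Sum>j\<in>F. pmf p j * \<psi> j) = measure_pmf.expectation p (\<lambda>j. if j \<in> F then \<psi> j else 0)" by simp
  then have "(\<Sum>j\<in>F. pmf p j * \<psi> j) + measure_pmf.expectation p (\<lambda>j. if j \<in> F then 0 else \<psi> j)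
     = measure_pmf.expectation p (\<lambda>j. (if j \<in> F then \<psi> j else 0) + (if j \<in> F then 0 else \<psi> j))"
    using Bochner_Integration.integral_add[OF i1 i2] by simp
  also have "(\<lambda>j. (if j \<in> F then \<psi> j else 0) + (if j \<in> F then 0 else \<psi> j)) = \<psi>" by auto
  finally show ?thesis by simp
qed

text \<open>Outside a suitable finite F the function \<psi> is below e V, and the scaled mean of V
  is at most B, so the tail contributes at most e B uniformly in n. On F the limit is that of a
  finite sum.\<close>

lemma scaled_expectation_tendsto_infsum:
  fixes p :: "nat \<Rightarrow> 'b pmf" and \<psi> V r :: "'b \<Rightarrow> real"
  assumes c: "c > 0" and r: "\<And>j. j \<in> S \<Longrightarrow> (\<lambda>n. pmf (p n) j / c ^ n) \<longlonglongrightarrow> r j"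
    and supp: "\<And>n. set_pmf (p n) \<subseteq> S"
    and \<psi>: "\<And>j. 0 \<le> \<psi> j" "\<And>j. \<psi> j \<le> K" and V: "\<And>j. 0 \<le> V j" "\<And>j. V j \<le> K'"
    and B: "\<And>n. measure_pmf.expectation (p n) V \<le> B * c ^ n"
    and tail: "\<And>e. e > 0 \<Longrightarrow> \<exists>F. finite F \<and> F \<subseteq> S \<and> (\<forall>j\<in>S - F. \<psi> j \<le> e * V j)"
  shows "(\<lambda>j. \<psi> j * r j) summable_on S"
    and "(\<lambda>n. measure_pmf.expectation (p n) \<psi> / c ^ n) \<longlonglongrightarrow> (\<Sum>\<^sub>\<infinity>j\<in>S. \<psi> j * r j)"
proof -
  let ?y = "\<lambda>n j. pmf (p n) j / c ^ n"
  have int\<psi>: "integrable (measure_pmf (p n)) \<psi>" for n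
    by (rule measure_pmf.integrable_const_bound[where B = K]) (use \<psi> in auto)
  have intV: "integrable (measure_pmf (p n)) V" for n
    by (rule measure_pmf.integrable_const_bound[where B = K']) (use V in auto)
  have B0: "B \<ge> 0"
    using order_trans[OF Bochner_Integration.integral_nonneg B[of 0]] V by simp
  have r0: "r j \<ge> 0" if "j \<in> S" for j
    using r[OF that] by (rule LIMSEQ_le_const) (use c in auto)
  have near: "0 \<le> measure_pmf.expectation (p n) \<psi> / c ^ n - (\<Sum>j\<in>F. \<psi> j * ?y n j)"
      "measure_pmf.expectation (p n) \<psi> / c ^ n - (\<Sum>j\<in>F. \<psi> j * ?y n j) \<le> e * B"
    if F: "finite F" "\<forall>j\<in>S - F. \<psi> j \<le> e * V j" and e: "e > 0" for F e n
  proof -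
    let ?R = "measure_pmf.expectation (p n) (\<lambda>j. if j \<in> F then 0 else \<psi> j)"
    have eq: "measure_pmf.expectation (p n) \<psi> / c ^ n - (\<Sum>j\<in>F. \<psi> j * ?y n j) = ?R / c ^ n"
      by (subst expectation_split_finite[OF F(1) int\<psi>])
         (simp add: add_divide_distrib sum_divide_distrib mult.commute)
    have "?R \<ge> 0" by (rule Bochner_Integration.integral_nonneg) (simp add: \<psi>)
    then show "0 \<le> measure_pmf.expectation (p n) \<psi> / c ^ n - (\<Sum>j\<in>F. \<psi> j * ?y n j)"
      unfolding eq using c by simp
    have "?R \<le> measure_pmf.expectation (p n) (\<lambda>j. e * V j)"
    proof (rule integral_mono_AE)
      show "integrable (measure_pmf (p n)) (\<lambda>j. if j \<in> F then 0 else \<psi> j)"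
        by (rule Bochner_Integration.integrable_bound[OF int\<psi>]) auto
      show "AE j in measure_pmf (p n). (if j \<in> F then 0 else \<psi> j) \<le> e * V j"
        using F(2) supp[of n] e V by (auto simp: AE_measure_pmf_iff)
    qed (simp add: intV)
    also have "\<dots> \<le> e * (B * c ^ n)" using B[of n] e by simp
    finally have "?R / c ^ n \<le> e * (B * c ^ n) / c ^ n" using c by (intro divide_right_mono) auto
    then show "measure_pmf.expectation (p n) \<psi> / c ^ n - (\<Sum>j\<in>F. \<psi> j * ?y n j) \<le> e * B"
      unfolding eq using c by simp
  qed
  have lim: "(\<lambda>n. \<Sum>j\<in>F. \<psi> j * ?y n j) \<longlonglongrightarrow> (\<Sum>j\<in>F. \<psi> j * r j)" if "F \<subseteq> S" for F
    using that by (intro tendsto_sum tendsto_mult tendsto_const r) auto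
  \<comment> \<open>The tail condition with e = 1 bounds all finite partial sums at once; as the
    terms are nonnegative, this gives summability.\<close>
  obtain F1 where F1: "finite F1" "F1 \<subseteq> S" "\<forall>j\<in>S - F1. \<psi> j \<le> 1 * V j"
    using tail[of 1] by auto
  have bound: "(\<Sum>j\<in>F. \<psi> j * r j) \<le> (\<Sum>j\<in>F1. \<psi> j * r j) + B" if F: "finite F" "F \<subseteq> S" for F
  proof -
    have "(\<Sum>j\<in>F. \<psi> j * r j) \<le> (\<Sum>j\<in>F \<union> F1. \<psi> j * r j)"
      using F F1 r0 \<psi> by (intro sum_mono2) auto
    also have "\<dots> \<le> (\<Sum>j\<in>F1. \<psi> j * r j) + B"
    proof (rule LIMSEQ_le)
      show "(\<lambda>n. \<Sum>j\<in>F \<union> F1. \<psi> j * ?y n j) \<longlonglongrightarrow> (\<Sum>j\<in>F \<union> F1. \<psi> j * r j)"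
        using F F1 by (intro lim) auto
      show "(\<lambda>n. (\<Sum>j\<in>F1. \<psi> j * ?y n j) + B) \<longlonglongrightarrow> (\<Sum>j\<in>F1. \<psi> j * r j) + B"
        using F1 by (intro tendsto_add lim tendsto_const)
      have "(\<Sum>j\<in>F \<union> F1. \<psi> j * ?y n j) \<le> (\<Sum>j\<in>F1. \<psi> j * ?y n j) + B" for n
        using near(1)[of "F \<union> F1" 1 n] near(2)[of F1 1 n] F F1 by auto
      then show "\<exists>N. \<forall>n\<ge>N. (\<Sum>j\<in>F \<union> F1. \<psi> j * ?y n j) \<le> (\<Sum>j\<in>F1. \<psi> j * ?y n j) + B" by blast
    qed
    finally show ?thesis .
  qed
  show summable: "(\<lambda>j. \<psi> j * r j) summable_on S"
  proof (rule nonneg_bdd_above_summable_on)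
    show "bdd_above (sum (\<lambda>j. \<psi> j * r j) ` {F. F \<subseteq> S \<and> finite F})"
      using bound by (auto intro!: bdd_aboveI2)
  qed (use r0 \<psi> in auto)
  define L where "L = (\<Sum>\<^sub>\<infinity>j\<in>S. \<psi> j * r j)"
  have "(\<lambda>n. measure_pmf.expectation (p n) \<psi> / c ^ n) \<longlonglongrightarrow> L"
  proof (rule LIMSEQ_I)
    fix e :: real assume e: "e > 0"
    \<comment> \<open>The 1 in the denominator covers B = 0.\<close>
    define e1 where "e1 = e / (3 * (B + 1))"
    have e1: "e1 > 0" using e B0 by (simp add: e1_def)
    have e1B: "e1 * B \<le> e / 3" using e B0 by (simp add: e1_def field_simps)
    have "((\<lambda>j. \<psi> j * r j) has_sum L) S"
      unfolding L_def using summable by (rule has_sum_infsum)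
    then have "\<forall>\<^sub>F F in finite_subsets_at_top S. dist (\<Sum>j\<in>F. \<psi> j * r j) L < e / 3"
      unfolding has_sum_def using e by (intro tendstoD) auto
    then obtain F2 where F2: "finite F2" "F2 \<subseteq> S"
      "\<And>F. finite F \<Longrightarrow> F2 \<subseteq> F \<Longrightarrow> F \<subseteq> S \<Longrightarrow> dist (\<Sum>j\<in>F. \<psi> j * r j) L < e / 3"
      unfolding eventually_finite_subsets_at_top by metis
    obtain F3 where F3: "finite F3" "F3 \<subseteq> S" "\<forall>j\<in>S - F3. \<psi> j \<le> e1 * V j"
      using tail[OF e1] by auto
    define F where "F = F2 \<union> F3"
    have F: "finite F" "F \<subseteq> S" "\<forall>j\<in>S - F. \<psi> j \<le> e1 * V j"
      using F2 F3 by (auto simp: F_def)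
    have 1: "\<bar>(\<Sum>j\<in>F. \<psi> j * r j) - L\<bar> < e / 3"
      using F2(3)[of F] F by (simp add: F_def dist_real_def)
    obtain n0 where n0: "\<And>n. n \<ge> n0 \<Longrightarrow> \<bar>(\<Sum>j\<in>F. \<psi> j * ?y n j) - (\<Sum>j\<in>F. \<psi> j * r j)\<bar> < e / 3"
      using LIMSEQ_D[OF lim[OF F(2)], of "e / 3"] e by auto
    have "norm (measure_pmf.expectation (p n) \<psi> / c ^ n - L) < e" if "n \<ge> n0" for n
      using near[OF F(1,3) e1, of n] e1B 1 n0[OF that] unfolding real_norm_def by linarith
    then show "\<exists>n0. \<forall>n\<ge>n0. norm (measure_pmf.expectation (p n) \<psi> / c ^ n - L) < e" by blast
  qed
  then show "(\<lambda>n. measure_pmf.expectation (p n) \<psi> / c ^ n) \<longlonglongrightarrow> (\<Sum>\<^sub>\<infinity>j\<in>S. \<psi> j * r j)"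
    by (simp add: L_def)
qed

section \<open>Matrix powers and a subinvariant weight\<close>

lemma mat_power_Suc_right: "mat_power A (Suc n) = mat_power A n ** A"
  by (induction n) (simp_all add: matrix_mul_assoc)

lemma mat_power_component: "mat_power A (Suc n) $ i $ k = (\<Sum>l\<in>UNIV. mat_power A n $ i $ l * A $ l $ k)"
  unfolding mat_power_Suc_right by (simp add: matrix_matrix_mult_def)

lemma mat_power_component': "mat_power A (Suc n) $ i $ k = (\<Sum>l\<in>UNIV. A $ i $ l * mat_power A n $ l $ k)"
  by (simp add: matrix_matrix_mult_def)

lemma mat_power_nonneg:
  assumes "\<And>i k. A $ i $ k \<ge> 0"
  shows "mat_power A n $ i $ k \<ge> 0"
proof (induction n arbitrary: i k)
  case 0
  then show ?case by (simp add: mat_def)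
next
  case (Suc n)
  then show ?case
    unfolding mat_power_component by (intro sum_nonneg mult_nonneg_nonneg assms)
qed

text \<open>The weight is the truncated resolvent \<open>\<Sum>n<N. A^n 1 / g^n\<close>.\<close>

lemma subinvariant_weight:
  fixes A :: "real ^ 2 ^ 2"
  assumes A0: "\<And>i k. A $ i $ k \<ge> 0" and \<gamma>: "0 < \<gamma>" "\<gamma> < g"
    and lim: "(\<lambda>n. mat_power A n /\<^sub>R \<gamma> ^ n) \<longlonglongrightarrow> P0"
  shows "\<exists>w. \<forall>i. 0 < w i \<and> (\<Sum>m\<in>UNIV. A $ i $ m * w m) \<le> g * w i"
proof -
  define R where "R = (\<lambda>n i. (\<Sum>m\<in>UNIV. mat_power A n $ i $ m) / g ^ n)"
  have g: "g > 0" using \<gamma> by simp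
  have R0: "R n i \<ge> 0" for n i
    unfolding R_def using g by (intro divide_nonneg_nonneg sum_nonneg mat_power_nonneg A0) auto
  have R1: "R 0 i = 1" for i
    using exhaust_2[of i] by (auto simp: R_def mat_def sum_2)
  have "(\<lambda>n. R n i) \<longlonglongrightarrow> 0" for i
  proof -
    have "(\<lambda>n. (\<Sum>m\<in>UNIV. (mat_power A n /\<^sub>R \<gamma> ^ n) $ i $ m) * (\<gamma> / g) ^ n) \<longlonglongrightarrow> (\<Sum>m\<in>UNIV. P0 $ i $ m) * 0"
      using \<gamma> by (intro tendsto_mult tendsto_sum tendsto_vec_nth lim LIMSEQ_power_zero) auto
    moreover have "(\<Sum>m\<in>UNIV. (mat_power A n /\<^sub>R \<gamma> ^ n) $ i $ m) * (\<gamma> / g) ^ n = R n i" for n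
      using \<gamma> by (simp add: R_def sum_2 field_simps power_divide)
    ultimately show ?thesis by simp
  qed
  then have "\<forall>\<^sub>F n in sequentially. \<forall>i\<in>UNIV. R n i < 1"
    by (intro eventually_ball_finite ballI order_tendstoD(2)[of _ 0]) auto
  then obtain N where N: "\<And>n i. n \<ge> N \<Longrightarrow> R n i < 1"
    by (auto simp: eventually_sequentially)
  define w where "w = (\<lambda>i. \<Sum>n<Suc N. R n i)"
  have "0 < w i \<and> (\<Sum>m\<in>UNIV. A $ i $ m * w m) \<le> g * w i" for i
  proof
    have "w i = R 0 i + (\<Sum>n<N. R (Suc n) i)"
      unfolding w_def by (subst sum.lessThan_Suc_shift) simp
    also have "\<dots> \<ge> 1 + 0" unfolding R1 by (intro add_mono order_refl sum_nonneg R0)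
    finally show "0 < w i" by simp
    have AR: "(\<Sum>m\<in>UNIV. A $ i $ m * R n m) = g * R (Suc n) i" for n
    proof -
      have "(\<Sum>m\<in>UNIV. A $ i $ m * R n m) = (\<Sum>m\<in>UNIV. \<Sum>k\<in>UNIV. A $ i $ m * mat_power A n $ m $ k) / g ^ n"
        by (simp add: R_def sum_divide_distrib sum_distrib_left)
      also have "(\<Sum>m\<in>UNIV. \<Sum>k\<in>UNIV. A $ i $ m * mat_power A n $ m $ k) = (\<Sum>k\<in>UNIV. mat_power A (Suc n) $ i $ k)"
        unfolding mat_power_component' by (rule sum.swap)
      finally show ?thesis using g by (simp add: R_def)
    qed
    have "(\<Sum>m\<in>UNIV. A $ i $ m * w m) = (\<Sum>n<Suc N. \<Sum>m\<in>UNIV. A $ i $ m * R n m)"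
      unfolding w_def sum_distrib_left by (rule sum.swap)
    also have "\<dots> = g * (\<Sum>n<Suc N. R (Suc n) i)" by (simp only: AR sum_distrib_left)
    also have "(\<Sum>n<Suc N. R (Suc n) i) = w i + R (Suc N) i - R 0 i"
      unfolding w_def using sum.lessThan_Suc_shift[of "\<lambda>n. R n i" "Suc N"] by simp
    \<comment> \<open>The sum telescopes, and N is so large that the new last term is below 1 =
      \<open>R 0 i\<close>; the boundary terms together are negative.\<close>
    also have "g * (w i + R (Suc N) i - R 0 i) \<le> g * w i"
      using N[of "Suc N" i] g by (intro mult_left_mono) (simp_all add: R1)
    finally show "(\<Sum>m\<in>UNIV. A $ i $ m * w m) \<le> g * w i" .
  qed
  then show ?thesis by blast
qed

section \<open>Convergence of the scaled laws\<close>

locale supercritical_branching = growing_branching \<Omega> P \<xi> I M A s \<kappa> h0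
  for \<Omega> :: "'w measure"
  and P :: "2 \<Rightarrow> (nat ^ 2) pmf"
  and \<xi> :: "nat \<Rightarrow> nat \<Rightarrow> 2 \<Rightarrow> nat \<Rightarrow> 'w \<Rightarrow> nat ^ 2"
  and I :: "nat \<Rightarrow> 'w \<Rightarrow> nat ^ 2"
  and M A :: "real ^ 2 ^ 2" and s \<kappa> h0 :: real +
  fixes \<gamma> \<rho> :: real and P0 :: "real ^ 2 ^ 2" and u v :: "real ^ 2"
  assumes h0_pos: "h0 > 0"
    and gamma: "0 < \<gamma>" "\<gamma> < 1"
    and A_limit: "(\<lambda>n. mat_power A n /\<^sub>R \<gamma> ^ n) \<longlonglongrightarrow> P0"
    and rho: "\<rho> > 1"
    and right_ev: "M *v u = \<rho> *s u" and u_pos: "u $ k > 0"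
    and left_ev: "v v* M = \<rho> *s v" and v_pos: "v $ k > 0"
    and regular: "positively_regular M"
    and critical: "h0 * \<gamma> * \<rho> powr (min s \<kappa>) > 1"
begin

definition scaled :: "2 \<Rightarrow> nat \<Rightarrow> nat ^ 2 \<Rightarrow> real" where
  "scaled i n j = pmf (law (axis i 1) n) j / (h0 * \<gamma>) ^ n"

lemma decay_pos: "h0 * \<gamma> > 0"
  using h0_pos gamma by simp

lemma A_nonneg: "A $ i $ k \<ge> 0"
  by (simp add: single)

lemma finite_pop_size_eq: "finite {x. pop_size x = m}"
  by (rule finite_subset[OF _ finite_pop_size_le[of m]]) auto

lemma law_axis_nonzero: "x \<in> set_pmf (law (axis i 1) n) \<Longrightarrow> x \<noteq> 0"
  using pop_size_le_of_law[of x "axis i 1" n] by auto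

lemma scaled_0: "scaled i n 0 = 0"
  using law_axis_nonzero[of 0 i n] by (auto simp: scaled_def set_pmf_iff)

text \<open>Only states of at most the same size can be predecessors, so the recursion involves a
  finite sum.\<close>

lemma scaled_Suc:
  "scaled i (Suc n) k = (\<Sum>j | pop_size j \<le> pop_size k. scaled i n j * (pmf (law j 1) k / (h0 * \<gamma>)))"
proof -
  have "pmf (law (axis i 1) (Suc n)) k = measure_pmf.expectation (law (axis i 1) n) (\<lambda>j. pmf (law j 1) k)"
    unfolding law_Suc[of _ n] by (rule pmf_bind)
  also have "\<dots> = (\<Sum>j | pop_size j \<le> pop_size k. pmf (law (axis i 1) n) j *\<^sub>R pmf (law j 1) k)"
  proof (rule integral_measure_pmf[OF finite_pop_size_le])
    fix j assume "pmf (law j 1) k \<noteq> 0"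
    then show "j \<in> {j. pop_size j \<le> pop_size k}"
      using pop_size_le_of_law_1[of k j] by (simp add: set_pmf_iff)
  qed
  finally show ?thesis
    by (simp add: scaled_def sum_divide_distrib mult.commute)
qed

text \<open>The only predecessors of e_k with positive probability are the e_l. A step among them
  has probability h0 A_lk, and h0 cancels against the scaling.\<close>

lemma scaled_axis: "scaled i n (axis k 1) = (mat_power A n /\<^sub>R \<gamma> ^ n) $ i $ k"
proof (induction n arbitrary: k)
  case 0
  then show ?case
    by (auto simp: scaled_def law_0 mat_def axis_eq_axis indicator_def)
next
  case (Suc n)
  have set: "{j. pop_size j \<le> pop_size (axis k 1 :: nat ^ 2)} = insert 0 ((\<lambda>l. axis l 1) ` UNIV)"
    by (auto simp: le_Suc_eq pop_size_eq_1_iff UNIV_2)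
  have inj: "inj (\<lambda>l. axis l 1 :: nat ^ 2)"
    by (auto simp: inj_on_def axis_eq_axis)
  have "scaled i (Suc n) (axis k 1) = (\<Sum>l\<in>UNIV. scaled i n (axis l 1) * (pmf (law (axis l 1) 1) (axis k 1) / (h0 * \<gamma>)))"
    unfolding scaled_Suc set
    by (subst sum.insert) (auto simp: scaled_0 sum.reindex[OF inj] simp del: One_nat_def dest!: arg_cong[where f = pop_size])
  also have "\<dots> = (\<Sum>l\<in>UNIV. (mat_power A n /\<^sub>R \<gamma> ^ n) $ i $ l * (A $ l $ k / \<gamma>))"
    unfolding Suc pmf_law_axis using h0_pos by simp
  also have "\<dots> = (mat_power A (Suc n) /\<^sub>R \<gamma> ^ Suc n) $ i $ k"
    using gamma by (simp add: mat_power_component sum_distrib_left divide_simps mult_ac del: mat_power.simps)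
  finally show ?case .
qed

lemma convergent_scaled: "convergent (\<lambda>n. scaled i n j)"
proof (induction "pop_size j" arbitrary: j rule: less_induct)
  case less
  consider "j = 0" | "pop_size j = 1" | "pop_size j \<ge> 2"
    using pop_size_eq_0_iff[of j] by linarith
  then show ?case
  proof cases
    case 1
    then show ?thesis by (simp add: scaled_0 convergent_const)
  next
    case 2
    then obtain k where k: "j = axis k 1" by (auto simp: pop_size_eq_1_iff)
    show ?thesis
      unfolding k scaled_axis convergent_def
      using tendsto_vec_nth[OF tendsto_vec_nth[OF A_limit]] by blast
  next
    case 3
    define m where "m = pop_size j"
    define L where "L = {x. pop_size x = m}"
    define T where "T = (\<lambda>x k. pmf (law x 1) k / (h0 * \<gamma>))"
    \<comment> \<open>What matters is \<gamma> < g and g^2 < \<gamma>: the first makes a weight for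
      \<open>A\<close> available, the second gives g^m / \<gamma> < 1 for all m \<ge> 2.\<close>
    define g where "g = \<gamma> powr (3 / 4)"
    have g: "0 < g" "\<gamma> < g" "g < 1" "g\<^sup>2 < \<gamma>"
    proof -
      show "0 < g" using gamma by (simp add: g_def)
      show "\<gamma> < g" using gamma powr_less_mono'[of \<gamma> "3/4" 1] by (simp add: g_def)
      show "g < 1" using gamma powr_less_mono'[of \<gamma> 0 "3/4"] by (simp add: g_def)
      have "g\<^sup>2 = \<gamma> powr (3 / 2)" using gamma by (simp add: g_def powr_powr flip: powr_numeral)
      also have "\<dots> < \<gamma> powr 1" using gamma by (intro powr_less_mono') auto
      finally show "g\<^sup>2 < \<gamma>" using gamma by simp
    qed
    from subinvariant_weight[OF A_nonneg gamma(1) g(2) A_limit]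
    obtain w where w: "\<And>i. 0 < w i" "\<And>i. (\<Sum>m\<in>UNIV. A $ i $ m * w m) \<le> g * w i" by metis
    have W: "monomial w x > 0" for x
      unfolding monomial_def using w by (intro prod_pos) simp
    show ?thesis
    proof (rule contraction_convergent[where y = "scaled i" and k = j])
      show "finite L" unfolding L_def by (rule finite_pop_size_eq)
      show "monomial w k > 0" for k by (rule W)
      show "T x k \<ge> 0" for x k using decay_pos by (simp add: T_def)
      show "0 \<le> g\<^sup>2 / \<gamma>" "g\<^sup>2 / \<gamma> < 1" using g gamma by auto
      show "j \<in> L" by (simp add: L_def m_def)
    next
      fix x assume "x \<in> L"
      then have x: "pop_size x = m" by (simp add: L_def)
      have "(\<Sum>k\<in>L. T x k * monomial w k) = (\<Sum>k | pop_size k = pop_size x. pmf (law x 1) k * monomial w k) / (h0 * \<gamma>)"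
        by (simp add: L_def x T_def sum_divide_distrib)
      also have "\<dots> = (\<Prod>i\<in>UNIV. (\<Sum>m\<in>UNIV. A $ i $ m * w m) ^ (x $ i)) / \<gamma>"
        unfolding level_expectation using h0_pos by simp
      also have "\<dots> \<le> (\<Prod>i\<in>UNIV. (g * w i) ^ (x $ i)) / \<gamma>"
        using gamma by (intro divide_right_mono prod_mono conjI power_mono zero_le_power sum_nonneg w(2)
            mult_nonneg_nonneg A_nonneg less_imp_le[OF w(1)]) simp
      also have "(\<Prod>i\<in>UNIV. (g * w i) ^ (x $ i)) = g ^ m * monomial w x"
        by (simp add: power_mult_distrib prod.distrib monomial_def x[symmetric] pop_size_def power_sum)
      also have "g ^ m * monomial w x / \<gamma> \<le> g\<^sup>2 * monomial w x / \<gamma>"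
        using g gamma W[of x] 3
        by (intro divide_right_mono mult_right_mono power_decreasing) (auto simp: m_def)
      finally show "(\<Sum>k\<in>L. T x k * monomial w k) \<le> g\<^sup>2 / \<gamma> * monomial w x" by simp
    next
      fix n k assume "k \<in> L"
      then have k: "pop_size k = m" by (simp add: L_def)
      \<comment> \<open>Predecessors of the same size form the contracting matrix, the smaller ones
        the input that converges by induction.\<close>
      have "{x. pop_size x \<le> pop_size k} = L \<union> {x. pop_size x < m}" "L \<inter> {x. pop_size x < m} = {}"
        by (auto simp: k L_def)
      moreover have "finite L" "finite {x. pop_size x < m}"
        unfolding L_def
        by (auto intro: finite_pop_size_eq finite_subset[OF _ finite_pop_size_le[of m]])
      ultimately show "scaled i (Suc n) k = (\<Sum>x\<in>L. scaled i n x * T x k) + (\<Sum>x | pop_size x < m. scaled i n x * T x k)"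
        unfolding scaled_Suc T_def by (simp add: sum.union_disjoint)
    next
      fix k
      show "convergent (\<lambda>n. \<Sum>x | pop_size x < m. scaled i n x * T x k)"
        by (intro convergent_sum convergent_mult less convergent_const) (auto simp: m_def)
    qed
  qed
qed

lemma scaled_tendsto: "(\<lambda>n. scaled i n j) \<longlonglongrightarrow> lim (\<lambda>n. scaled i n j)"
  using convergent_scaled by (simp add: convergent_LIMSEQ_iff)

section \<open>Lyapunov function and harmonic moments\<close>

definition u_min :: real where "u_min = min (u $ 1) (u $ 2)"

definition u_max :: real where "u_max = max (u $ 1) (u $ 2)"

lemma u_min_pos: "u_min > 0" and u_max_pos: "u_max > 0"
  using u_pos by (auto simp: u_min_def u_max_def less_max_iff_disj)

lemma inner_u_ge: "u_min * real (pop_size x) \<le> u \<bullet> real_vec x"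
proof -
  have "u_min \<le> u $ k" for k using exhaust_2[of k] by (auto simp: u_min_def)
  then show ?thesis
    unfolding inner_real_vec pop_size_def of_nat_sum sum_distrib_left by (intro sum_mono mult_right_mono) auto
qed

lemma inner_u_le: "u \<bullet> real_vec x \<le> u_max * real (pop_size x)"
proof -
  have "u $ k \<le> u_max" for k using exhaust_2[of k] by (auto simp: u_max_def)
  then show ?thesis
    unfolding inner_real_vec pop_size_def of_nat_sum sum_distrib_left by (intro sum_mono mult_right_mono) auto
qed

lemma inner_u_pos: "x \<noteq> 0 \<Longrightarrow> u \<bullet> real_vec x > 0"
  using inner_u_ge[of x] mult_pos_pos[OF u_min_pos, of "real (pop_size x)"] by simp

lemma inner_u_mult: "u \<bullet> (real_vec j v* M) = \<rho> * (u \<bullet> real_vec j)"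
proof -
  have "u \<bullet> (real_vec j v* M) = (M *v u) \<bullet> real_vec j"
    by (metis dot_lmul_matrix inner_commute)
  then show ?thesis by (simp add: right_ev scalar_mult_eq_scaleR)
qed

text \<open>At x = 0 the value is \<open>0 powr (- e) = 0\<close>, so the bounds below hold without
  excluding this state.\<close>

definition lyapunov :: "real \<Rightarrow> nat ^ 2 \<Rightarrow> real" where
  "lyapunov e x = (u \<bullet> real_vec x) powr (- e)"

lemma lyapunov_nonneg: "lyapunov e x \<ge> 0"
  by (simp add: lyapunov_def)

lemma lyapunov_le: "e > 0 \<Longrightarrow> lyapunov e x \<le> (u_min * real (pop_size x)) powr (- e)"
proof (cases "x = 0")
  case False
  assume "e > 0"
  then show ?thesis
    unfolding lyapunov_def using u_min_pos False inner_u_ge[of x]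
    by (intro powr_mono2') auto
qed (simp add: lyapunov_def)

lemma lyapunov_ge: "e > 0 \<Longrightarrow> (u_max * real (pop_size x)) powr (- e) \<le> lyapunov e x"
proof (cases "x = 0")
  case False
  assume "e > 0"
  then show ?thesis
    unfolding lyapunov_def using inner_u_pos[OF False] inner_u_le[of x]
    by (intro powr_mono2') auto
qed (simp add: lyapunov_def)

lemma lyapunov_bounded: "e > 0 \<Longrightarrow> lyapunov e x \<le> u_min powr (- e)"
proof (cases "x = 0")
  case False
  assume e: "e > 0"
  have "real (pop_size x) \<ge> 1" using False by (simp add: Suc_le_eq flip: pop_size_pos_iff)
  then have "u_min * 1 \<le> u_min * real (pop_size x)" using u_min_pos by (intro mult_left_mono) auto
  then have "(u_min * real (pop_size x)) powr (- e) \<le> u_min powr (- e)"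
    using e u_min_pos by (intro powr_mono2') auto
  then show ?thesis using lyapunov_le[OF e, of x] by linarith
qed (simp add: lyapunov_def)

lemma integrable_lyapunov: "e > 0 \<Longrightarrow> integrable (measure_pmf p) (lyapunov e)"
  using lyapunov_nonneg lyapunov_bounded
  by (intro measure_pmf.integrable_const_bound[where B = "u_min powr (- e)"]) auto

text \<open>Outside a rare event u . x grows at least by a factor \<tau> < \<rho>, which multiplies
  the function by at most \<tau>^(-e). On the rare event the size still does not drop, so the new
  value is at most R times the old one, and R times the probability is small for large
  populations.\<close>

lemma lyapunov_drift:
  assumes e: "e > 0" and crit: "h0 * \<gamma> * \<rho> powr e > 1"
  shows "\<exists>q m. 0 \<le> q \<and> q < h0 * \<gamma> \<and>
    (\<forall>j. pop_size j > m \<longrightarrow> measure_pmf.expectation (law j 1) (lyapunov e) \<le> q * lyapunov e j)"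
proof -
  define c where "c = h0 * \<gamma>"
  have c: "c > 0" using decay_pos by (simp add: c_def)
  \<comment> \<open>The hypothesis amounts to c^(-1/e) < \<rho>; a \<tau> strictly between them
    satisfies \<tau>^(-e) < c.\<close>
  define \<tau> where "\<tau> = (c powr (- 1 / e) + \<rho>) / 2"
  have "c powr (- 1 / e) < \<rho>"
  proof -
    have "1 / c < \<rho> powr e" using crit c by (simp add: c_def field_simps)
    then have "(1 / c) powr (1 / e) < (\<rho> powr e) powr (1 / e)"
      using c e by (intro powr_less_mono2) auto
    also have "\<dots> = \<rho>" using e rho by (simp add: powr_powr)
    also have "(1 / c) powr (1 / e) = c powr (- 1 / e)"
      using c by (simp add: powr_divide powr_minus_divide)
    finally show ?thesis .
  qed
  then have \<tau>: "c powr (- 1 / e) < \<tau>" "\<tau> < \<rho>" "\<tau> > 0"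
    using powr_gt_zero[of c "- 1 / e"] c rho by (auto simp: \<tau>_def intro: add_nonneg_pos)
  define q1 where "q1 = \<tau> powr (- e)"
  have q1: "q1 < c"
  proof -
    have "q1 < (c powr (- 1 / e)) powr (- e)"
      unfolding q1_def using \<tau> e c by (intro powr_less_mono2_neg) auto
    also have "\<dots> = c" using e c by (simp add: powr_powr)
    finally show ?thesis .
  qed
  have q10: "q1 \<ge> 0" by (simp add: q1_def)
  \<comment> \<open>Keeps the permitted error \<delta> |j| below (\<rho> - \<tau>) (u . j).\<close>
  define \<delta> where "\<delta> = (\<rho> - \<tau>) * u_min / 2"
  have \<delta>: "\<delta> > 0" using \<tau> u_min_pos by (simp add: \<delta>_def)
  from concentration[OF \<delta>, of u]
  obtain C where C: "C \<ge> 0" and conc: "\<And>j. j \<noteq> 0 \<Longrightarrow>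
    measure_pmf.prob (law j 1) {x. \<bar>u \<bullet> real_vec x - u \<bullet> (real_vec j v* M)\<bar> > \<delta> * real (pop_size j)}
      \<le> C * real (pop_size j) powr (- min s \<kappa>)" by blast
  \<comment> \<open>The cost of passing from u . x to |x| and back, raised to the power e.\<close>
  define R where "R = (u_max / u_min) powr e"
  have "((\<lambda>n. R * C * real n powr (- min s \<kappa>)) \<longlongrightarrow> R * C * 0) sequentially"
    using s_ge_1 kappa_ge_1
    by (intro tendsto_mult tendsto_const tendsto_neg_powr filterlim_real_sequentially) auto
  then have "\<forall>\<^sub>F n in sequentially. R * C * real n powr (- min s \<kappa>) < (c - q1) / 2"
    using q1 by (intro order_tendstoD(2)[of _ "R * C * 0"]) auto
  then obtain m where m: "\<And>n. n \<ge> m \<Longrightarrow> R * C * real n powr (- min s \<kappa>) < (c - q1) / 2"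
    by (auto simp: eventually_sequentially)
  \<comment> \<open>Midway between q1 and c, which leaves (c - q1) / 2 for the rare event.\<close>
  define q where "q = (q1 + c) / 2"
  have "measure_pmf.expectation (law j 1) (lyapunov e) \<le> q * lyapunov e j" if j: "pop_size j > m" for j
  proof -
    have j0: "j \<noteq> 0" using j by auto
    define n where "n = real (pop_size j)"
    have n: "n > 0" using j0 by (simp add: n_def)
    define E where "E = {x. \<bar>u \<bullet> real_vec x - u \<bullet> (real_vec j v* M)\<bar> > \<delta> * n}"
    have bound: "lyapunov e x \<le> (q1 + R * indicator E x) * lyapunov e j" if "x \<in> set_pmf (law j 1)" for x
    proof (cases "x \<in> E")
      case True
      have sz: "n \<le> real (pop_size x)" using pop_size_le_of_law_1[OF that] by (simp add: n_def)
      then have "u_min * n \<le> u_min * real (pop_size x)"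
        using u_min_pos by (intro mult_left_mono) auto
      then have "(u_min * real (pop_size x)) powr (- e) \<le> (u_min * n) powr (- e)"
        using e u_min_pos n by (intro powr_mono2') auto
      then have "lyapunov e x \<le> (u_min * n) powr (- e)"
        using lyapunov_le[OF e, of x] by linarith
      also have "\<dots> = R * (u_max * n) powr (- e)"
        using u_min_pos u_max_pos n by (simp add: R_def powr_mult powr_divide powr_minus_divide)
      also have "\<dots> \<le> R * lyapunov e j"
        using lyapunov_ge[OF e, of j] by (intro mult_left_mono) (auto simp: n_def R_def)
      also have "\<dots> \<le> (q1 + R * indicator E x) * lyapunov e j"
        using True q10 lyapunov_nonneg[of e j] by (simp add: distrib_right)
      finally show ?thesis .
    next
      case False
      have "\<rho> * (u \<bullet> real_vec j) - u \<bullet> real_vec x \<le> \<delta> * n"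
        using False by (auto simp: E_def inner_u_mult)
      also have "\<delta> * n \<le> (\<rho> - \<tau>) * (u \<bullet> real_vec j)"
      proof -
        have "\<delta> * n = (\<rho> - \<tau>) / 2 * (u_min * n)" by (simp add: \<delta>_def)
        also have "\<dots> \<le> (\<rho> - \<tau>) * (u \<bullet> real_vec j)"
          using \<tau> inner_u_ge[of j] inner_u_pos[OF j0] u_min_pos n by (intro mult_mono) (auto simp: n_def)
        finally show ?thesis .
      qed
      finally have "\<tau> * (u \<bullet> real_vec j) \<le> u \<bullet> real_vec x" by (simp add: algebra_simps)
      then have "lyapunov e x \<le> (\<tau> * (u \<bullet> real_vec j)) powr (- e)"
        unfolding lyapunov_def using \<tau> inner_u_pos[OF j0] e by (intro powr_mono2') auto
      also have "\<dots> = q1 * lyapunov e j" by (simp add: powr_mult q1_def lyapunov_def)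
      finally show ?thesis using False by simp
    qed
    have "measure_pmf.expectation (law j 1) (lyapunov e)
       \<le> measure_pmf.expectation (law j 1) (\<lambda>x. (q1 + R * indicator E x) * lyapunov e j)"
    proof (rule integral_mono_AE[OF integrable_lyapunov[OF e]])
      have "integrable (measure_pmf (law j 1)) (indicator E :: _ \<Rightarrow> real)"
        by (rule measure_pmf.integrable_const_bound[where B = 1]) auto
      then show "integrable (measure_pmf (law j 1)) (\<lambda>x. (q1 + R * indicator E x) * lyapunov e j)"
        by (intro integrable_mult_left Bochner_Integration.integrable_add integrable_mult_right) simp_all
    qed (use bound in \<open>auto simp: AE_measure_pmf_iff\<close>)
    also have "\<dots> = (q1 + R * measure_pmf.prob (law j 1) E) * lyapunov e j"
      by (simp add: measure_pmf.emeasure_eq_measure)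
    also have "\<dots> \<le> q * lyapunov e j"
    proof (intro mult_right_mono lyapunov_nonneg)
      have "R * measure_pmf.prob (law j 1) E \<le> R * (C * n powr (- min s \<kappa>))"
        using conc[OF j0] by (intro mult_left_mono) (auto simp: E_def n_def R_def)
      also have "\<dots> \<le> (c - q1) / 2" using m[of "pop_size j"] j by (simp add: n_def mult.assoc)
      finally show "q1 + R * measure_pmf.prob (law j 1) E \<le> q" by (simp add: q_def field_simps)
    qed
    finally show ?thesis .
  qed
  moreover have "0 \<le> q" "q < c"
    using q1 q10 c by (auto simp: q_def)
  ultimately show ?thesis unfolding c_def by blast
qed

text \<open>The drift may fail only on a finite set of states, whose total probability is O(c^n) by
  the convergence of the scaled laws. So the mean satisfies a recurrence with factor q < c and input
  O(c^n), and is bounded after division by c^n.\<close>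

lemma lyapunov_moment_bound:
  assumes e: "e > 0" and crit: "h0 * \<gamma> * \<rho> powr e > 1"
  shows "\<exists>B. \<forall>n. measure_pmf.expectation (law (axis i 1) n) (lyapunov e) \<le> B * (h0 * \<gamma>) ^ n"
proof -
  define c where "c = h0 * \<gamma>"
  have c: "c > 0" using decay_pos by (simp add: c_def)
  define U where "U = u_min powr (- e)"
  have U: "U \<ge> 0" "\<And>x. lyapunov e x \<le> U" using lyapunov_bounded[OF e] by (auto simp: U_def)
  from lyapunov_drift[OF assms] obtain q m where q: "0 \<le> q" "q < c"
    and drift: "\<And>j. pop_size j > m \<Longrightarrow> measure_pmf.expectation (law j 1) (lyapunov e) \<le> q * lyapunov e j"
    unfolding c_def by blast
  let ?F = "{j. pop_size j \<le> m}"
  let ?E = "\<lambda>n. measure_pmf.expectation (law (axis i 1) n) (lyapunov e)"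
  have "convergent (\<lambda>n. \<Sum>j\<in>?F. scaled i n j)"
    by (intro convergent_sum convergent_scaled)
  then obtain b where b: "\<And>n. \<bar>\<Sum>j\<in>?F. scaled i n j\<bar> \<le> b"
    using convergent_imp_Bseq[of "\<lambda>n. \<Sum>j\<in>?F. scaled i n j"] by (auto simp: Bseq_def)
  have step: "?E (Suc n) \<le> q * ?E n + U * (b * c ^ n)" for n
  proof -
    have le: "measure_pmf.expectation (law j 1) (lyapunov e) \<le> q * lyapunov e j + U * indicator ?F j" for j
    proof (cases "j \<in> ?F")
      case True
      have "measure_pmf.expectation (law j 1) (lyapunov e) \<le> U"
        by (rule measure_pmf.integral_le_const[OF integrable_lyapunov[OF e]]) (use U in auto)
      moreover have "0 \<le> q * lyapunov e j" by (intro mult_nonneg_nonneg q lyapunov_nonneg)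
      ultimately show ?thesis using True by simp
    next
      case False
      then show ?thesis using drift[of j] by simp
    qed
    have EU: "0 \<le> measure_pmf.expectation (law j 1) (lyapunov e)" "measure_pmf.expectation (law j 1) (lyapunov e) \<le> U" for j
      by (auto intro!: Bochner_Integration.integral_nonneg lyapunov_nonneg
          measure_pmf.integral_le_const[OF integrable_lyapunov[OF e]] U)
    have "?E (Suc n) = measure_pmf.expectation (law (axis i 1) n) (\<lambda>j. measure_pmf.expectation (law j 1) (lyapunov e))"
      unfolding law_Suc[of _ n] by (rule expectation_bind_pmf_bounded) (rule lyapunov_nonneg, rule U(2))
    also have "\<dots> \<le> measure_pmf.expectation (law (axis i 1) n) (\<lambda>j. q * lyapunov e j + U * indicator ?F j)"
    proof (rule integral_mono)
      show "integrable (measure_pmf (law (axis i 1) n)) (\<lambda>j. measure_pmf.expectation (law j 1) (lyapunov e))"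
        by (rule measure_pmf.integrable_const_bound[where B = U]) (use EU in auto)
      show "integrable (measure_pmf (law (axis i 1) n)) (\<lambda>j. q * lyapunov e j + U * indicator ?F j)"
        by (intro Bochner_Integration.integrable_add integrable_mult_right integrable_lyapunov e
            measure_pmf.integrable_const_bound[where B = 1]) auto
    qed (rule le)
    also have "\<dots> = q * ?E n + U * measure_pmf.prob (law (axis i 1) n) ?F"
    proof -
      have "integrable (measure_pmf (law (axis i 1) n)) (\<lambda>j. q * lyapunov e j)"
        by (intro integrable_mult_right integrable_lyapunov e)
      moreover have "integrable (measure_pmf (law (axis i 1) n)) (\<lambda>j. U * indicator ?F j)"
        by (intro integrable_mult_right measure_pmf.integrable_const_bound[where B = 1]) auto
      ultimately show ?thesis by simp
    qed
    also have "measure_pmf.prob (law (axis i 1) n) ?F = (\<Sum>j\<in>?F. pmf (law (axis i 1) n) j)"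
      by (rule measure_measure_pmf_finite[OF finite_pop_size_le])
    also have "\<dots> = (\<Sum>j\<in>?F. scaled i n j) * c ^ n"
      unfolding sum_distrib_right scaled_def c_def using decay_pos by (intro sum.cong) auto
    also have "\<dots> \<le> b * c ^ n"
      using b[of n] c by (intro mult_right_mono) auto
    finally show ?thesis using U by (simp add: mult_left_mono)
  qed
  define a where "a = (\<lambda>n. ?E n / c ^ n)"
  have "a n \<le> max (a 0) (U * b / c / (1 - q / c))" for n
  proof (rule geometric_recurrence_bounded)
    show "0 \<le> q / c" "q / c < 1" using q c by auto
    fix n
    have "a (Suc n) \<le> (q * ?E n + U * (b * c ^ n)) / c ^ Suc n"
      unfolding a_def using step[of n] c by (intro divide_right_mono) auto
    also have "\<dots> = q / c * a n + U * b / c"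
      unfolding a_def using c by (simp add: field_simps)
    finally show "a (Suc n) \<le> q / c * a n + U * b / c" .
  qed
  then have "?E n \<le> max (a 0) (U * b / c / (1 - q / c)) * c ^ n" for n
    unfolding a_def using c by (simp add: pos_divide_le_eq)
  then show ?thesis unfolding c_def by blast
qed

lemma scaled_expectation_limit:
  assumes \<psi>: "\<And>j. 0 \<le> \<psi> j" "\<And>j. \<psi> j \<le> 1" and C: "\<And>j. j \<noteq> 0 \<Longrightarrow> \<psi> j \<le> C * real (pop_size j) powr (- min s \<kappa>)"
  shows "(\<lambda>j. \<psi> j * lim (\<lambda>n. scaled i n j)) summable_on (UNIV - {0})"
    and "(\<lambda>n. measure_pmf.expectation (law (axis i 1) n) \<psi> / (h0 * \<gamma>) ^ n)
      \<longlonglongrightarrow> (\<Sum>\<^sub>\<infinity>j\<in>UNIV - {0}. \<psi> j * lim (\<lambda>n. scaled i n j))"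
proof -
  define d where "d = min s \<kappa>"
  have d: "d \<ge> 1" using s_ge_1 kappa_ge_1 by (simp add: d_def)
  \<comment> \<open>By continuity the strict inequality at d persists for some e < d.\<close>
  have "((\<lambda>x. h0 * \<gamma> * \<rho> powr x) \<longlongrightarrow> h0 * \<gamma> * \<rho> powr d) (at_left d)"
    using rho by (intro tendsto_intros) auto
  then have "\<forall>\<^sub>F x in at_left d. h0 * \<gamma> * \<rho> powr x > 1"
    using critical by (intro order_tendstoD) (auto simp: d_def)
  moreover have "\<forall>\<^sub>F x in at_left d. x \<in> {0<..<d}"
    by (rule eventually_at_leftI[of 0]) (use d in auto)
  ultimately have "\<exists>x. h0 * \<gamma> * \<rho> powr x > 1 \<and> x \<in> {0<..<d}"
    using eventually_conj eventually_happens by (metis (mono_tags, lifting) trivial_limit_at_left_real)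
  then obtain e where e: "h0 * \<gamma> * \<rho> powr e > 1" "0 < e" "e < d" by auto
  from lyapunov_moment_bound[OF e(2,1)] obtain B where
    B: "\<And>n. measure_pmf.expectation (law (axis i 1) n) (lyapunov e) \<le> B * (h0 * \<gamma>) ^ n" by blast
  have tail: "\<exists>F. finite F \<and> F \<subseteq> UNIV - {0} \<and> (\<forall>j\<in>UNIV - {0} - F. \<psi> j \<le> \<eta> * lyapunov e j)" if \<eta>: "\<eta> > 0" for \<eta>
  proof -
    \<comment> \<open>\<psi> divided by the Lyapunov function is O(|x|^(-(d - e))), hence below any
      \<eta> outside a finite set.\<close>
    have "((\<lambda>n. \<bar>C\<bar> * u_max powr e * real n powr (- (d - e))) \<longlongrightarrow> \<bar>C\<bar> * u_max powr e * 0) sequentially"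
      using e by (intro tendsto_mult tendsto_const tendsto_neg_powr filterlim_real_sequentially) auto
    then have "\<forall>\<^sub>F n in sequentially. \<bar>C\<bar> * u_max powr e * real n powr (- (d - e)) < \<eta>"
      using \<eta> by (intro order_tendstoD(2)[of _ "\<bar>C\<bar> * u_max powr e * 0"]) auto
    then obtain m where m: "\<And>n. n \<ge> m \<Longrightarrow> \<bar>C\<bar> * u_max powr e * real n powr (- (d - e)) < \<eta>"
      by (auto simp: eventually_sequentially)
    have le: "\<psi> j \<le> \<eta> * lyapunov e j" if j: "j \<noteq> 0" "pop_size j > m" for j
    proof -
      define n where "n = real (pop_size j)"
      have n: "n > 0" using j by (simp add: n_def)
      have "\<psi> j \<le> C * n powr (- d)" using C[OF j(1)] by (simp add: n_def d_def)
      also have "\<dots> \<le> \<bar>C\<bar> * n powr (- d)" by (intro mult_right_mono) auto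
      also have "n powr (- d) = n powr (- (d - e)) * n powr (- e)" by (simp flip: powr_add)
      also have "n powr (- e) = u_max powr e * (u_max * n) powr (- e)"
        using u_max_pos by (simp add: powr_mult powr_minus_divide)
      finally have "\<psi> j \<le> (\<bar>C\<bar> * u_max powr e * n powr (- (d - e))) * (u_max * n) powr (- e)"
        by (simp add: mult_ac)
      also have "\<dots> \<le> \<eta> * lyapunov e j"
        using m[of "pop_size j"] j \<eta> lyapunov_ge[OF e(2), of j]
        by (intro mult_mono) (auto simp: n_def)
      finally show ?thesis .
    qed
    have "\<forall>j\<in>UNIV - {0} - ({j. pop_size j \<le> m} - {0}). \<psi> j \<le> \<eta> * lyapunov e j"
    proof
      fix j assume "j \<in> UNIV - {0} - ({j. pop_size j \<le> m} - {0})"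
      then have "j \<noteq> 0" "pop_size j > m" by (auto simp: not_le)
      then show "\<psi> j \<le> \<eta> * lyapunov e j" by (rule le)
    qed
    moreover have "finite ({j. pop_size j \<le> m} - {0})" by (simp add: finite_pop_size_le)
    moreover have "{j. pop_size j \<le> m} - {0} \<subseteq> UNIV - {0}" by blast
    ultimately show ?thesis by blast
  qed
  have r: "(\<lambda>n. pmf (law (axis i 1) n) j / (h0 * \<gamma>) ^ n) \<longlonglongrightarrow> lim (\<lambda>n. scaled i n j)" for j
    using scaled_tendsto[of i j] by (simp only: scaled_def)
  have supp: "set_pmf (law (axis i 1) n) \<subseteq> UNIV - {0}" for n
    using law_axis_nonzero[of _ i n] by blast
  note lim = scaled_expectation_tendsto_infsum[where S = "UNIV - {0}" and r = "\<lambda>j. lim (\<lambda>n. scaled i n j)",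
      OF decay_pos r supp \<psi> lyapunov_nonneg lyapunov_bounded[OF e(2)] B tail]
  show "(\<lambda>j. \<psi> j * lim (\<lambda>n. scaled i n j)) summable_on (UNIV - {0})"
    by (rule lim(1))
  show "(\<lambda>n. measure_pmf.expectation (law (axis i 1) n) \<psi> / (h0 * \<gamma>) ^ n)
      \<longlonglongrightarrow> (\<Sum>\<^sub>\<infinity>j\<in>UNIV - {0}. \<psi> j * lim (\<lambda>n. scaled i n j))"
    by (rule lim(2))
qed

end

section \<open>Convergence of the type ratio\<close>

text \<open>Terms of opposite sign cancel partly, so the triangle inequality is strict. It will be
  applied to the rows of a strictly positive matrix.\<close>

lemma abs_add_mult_less:
  fixes a b x y :: real
  assumes "a > 0" "b > 0" "x * y < 0"
  shows "\<bar>a * x + b * y\<bar> < a * \<bar>x\<bar> + b * \<bar>y\<bar>"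
proof (cases "x > 0")
  case True
  then have "y < 0" using assms(3) by (simp add: mult_less_0_iff)
  then show ?thesis
    using True mult_pos_pos[OF assms(1) True] mult_pos_neg[OF assms(2), of y] by (simp add: abs_if)
next
  case False
  then have "x < 0" "y > 0" using assms(3) by (auto simp: mult_less_0_iff)
  then show ?thesis
    using mult_pos_pos[OF assms(2), of y] mult_pos_neg[OF assms(1), of x] by (simp add: abs_if)
qed

context branching_with_immigration
begin

lemma law_add: "law j (n + k) = bind_pmf (law j n) (\<lambda>a. law a k)"
proof (induction k)
  case 0
  then show ?case by (simp add: law_0 bind_return_pmf')
next
  case (Suc k)
  have "law j (n + Suc k) = bind_pmf (bind_pmf (law j n) (\<lambda>a. law a k)) (\<lambda>a. law a 1)"
    using law_Suc[of j "n + k"] Suc by simp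
  also have "\<dots> = bind_pmf (law j n) (\<lambda>a. law a (Suc k))"
    unfolding bind_assoc_pmf law_Suc[of _ k] ..
  finally show ?case .
qed

lemma prob_joint:
  "prob {\<omega> \<in> space \<Omega>. X_proc \<xi> I j (Suc n) \<omega> \<in> E (X_proc \<xi> I j n \<omega>)}
    = measure_pmf.expectation (law j n) (\<lambda>a. measure_pmf.prob (law a 1) (E a))"
proof -
  have int: "integrable (measure_pmf (law j n)) (\<lambda>a. measure_pmf.prob (law a 1) (E a))"
    by (rule measure_pmf.integrable_const_bound[where B = 1]) auto
  have "ennreal (prob {\<omega> \<in> space \<Omega>. X_proc \<xi> I j (Suc n) \<omega> \<in> E (X_proc \<xi> I j n \<omega>)})
     = (\<integral>\<^sup>+a. ennreal (measure_pmf.prob (law a 1) (E a)) \<partial>law j n)"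
    using emeasure_joint[of j n E] by (simp add: emeasure_eq_measure measure_pmf.emeasure_eq_measure)
  also have "\<dots> = ennreal (measure_pmf.expectation (law j n) (\<lambda>a. measure_pmf.prob (law a 1) (E a)))"
    by (rule nn_integral_eq_integral[OF int]) simp
  finally show ?thesis
    by (simp add: Bochner_Integration.integral_nonneg)
qed

text \<open>The first generation from e_k is a single offspring vector, so moment conditions on Z_1
  are conditions on \<open>P k\<close>.\<close>

lemma Z_proc_axis_1: "Z_proc \<xi> (axis k 1) 1 \<omega> = \<xi> 0 0 k 0 \<omega>"
proof -
  have "(\<Sum>m<(axis k 1 :: nat ^ 2) $ i. \<xi> 0 0 i m \<omega>) = (if i = k then \<xi> 0 0 k 0 \<omega> else 0)" for i
    by (simp add: axis_def)
  then show ?thesis by (simp add: Z_proc_def)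
qed

end

section \<open>Second eigenvalue and skewness of the type composition\<close>

context supercritical_branching
begin

lemma left_mat_power: "v v* mat_power M n = \<rho> ^ n *s v"
proof (induction n)
  case (Suc n)
  have "v v* mat_power M (Suc n) = (v v* mat_power M n) v* M"
    unfolding mat_power_Suc_right by (simp add: vector_matrix_mul_assoc)
  also have "\<dots> = \<rho> ^ n *s (v v* M)"
    unfolding Suc by (simp add: vec_eq_iff vector_matrix_mult_def sum_2 algebra_simps)
  also have "\<dots> = \<rho> ^ Suc n *s v" by (simp add: left_ev vec_eq_iff)
  finally show ?case .
qed simp

text \<open>In dimension two the orthogonal complement of \<open>v\<close> is a line, hence an eigenspace of \<open>M\<close>.\<close>

lemma second_eigenvalue:
  assumes orth: "v \<bullet> y = 0"
  shows "\<exists>\<mu>. \<bar>\<mu>\<bar> < \<rho> \<and> M *v y = \<mu> *s y"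
proof (cases "y = 0")
  case True
  then show ?thesis using rho by (intro exI[of _ 0]) simp
next
  case False
  have v: "v $ 1 > 0" "v $ 2 > 0" using v_pos by auto
  have o: "v $ 1 * y $ 1 + v $ 2 * y $ 2 = 0"
    using orth by (simp add: inner_vec_def sum_2)
  have y2: "y $ 2 = - (v $ 1 * y $ 1) / v $ 2" using o v by (simp add: field_simps)
  have y1: "y $ 1 \<noteq> 0"
  proof
    assume "y $ 1 = 0"
    then have "y = 0" using y2 by (simp add: vec_eq_iff forall_2)
    then show False using False by simp
  qed
  \<comment> \<open>As v is positive, a nonzero vector orthogonal to it has coordinates of opposite
    sign.\<close>
  have neg: "y $ 1 * y $ 2 < 0"
  proof -
    have "y $ 1 * y $ 2 = - (v $ 1 * (y $ 1)\<^sup>2 / v $ 2)" by (simp add: y2 power2_eq_square)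
    also have "\<dots> < 0" using v y1 by simp
    finally show ?thesis .
  qed
  define z where "z = M *v y"
  have "v \<bullet> z = (v v* M) \<bullet> y" unfolding z_def by (simp add: dot_lmul_matrix)
  also have "\<dots> = 0" using orth by (simp add: left_ev scalar_mult_eq_scaleR)
  finally have "v $ 1 * z $ 1 + v $ 2 * z $ 2 = 0" by (simp add: inner_vec_def sum_2)
  then have z2: "z $ 2 = - (v $ 1 * z $ 1) / v $ 2" using v by (simp add: field_simps)
  define \<mu> where "\<mu> = z $ 1 / y $ 1"
  have My: "M *v y = \<mu> *s y"
    unfolding z_def[symmetric] using y1 v by (simp add: vec_eq_iff forall_2 y2 z2 \<mu>_def)
  have pw: "mat_power M n *v y = \<mu> ^ n *s y" for n
  proof (induction n)
    case (Suc n)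
    have "mat_power M (Suc n) *v y = mat_power M n *v (M *v y)"
      unfolding mat_power_Suc_right by (simp add: matrix_vector_mul_assoc)
    also have "\<dots> = \<mu> *s (mat_power M n *v y)"
      unfolding My by (simp add: vec_eq_iff matrix_vector_mult_def sum_2 algebra_simps)
    finally show ?case unfolding Suc by (simp add: vec_eq_iff)
  qed simp
  obtain n where n: "\<And>i j. mat_power M n $ i $ j > 0"
    using regular unfolding positively_regular_def by blast
  define N where "N = mat_power M n"
  have lt: "\<bar>\<mu>\<bar> ^ n * \<bar>y $ i\<bar> < N $ i $ 1 * \<bar>y $ 1\<bar> + N $ i $ 2 * \<bar>y $ 2\<bar>" for i
  proof -
    have "\<mu> ^ n * y $ i = N $ i $ 1 * y $ 1 + N $ i $ 2 * y $ 2"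
      using arg_cong[OF pw[of n], of "\<lambda>x. x $ i"] by (simp add: N_def matrix_vector_mult_def sum_2)
    then have "\<bar>\<mu>\<bar> ^ n * \<bar>y $ i\<bar> = \<bar>N $ i $ 1 * y $ 1 + N $ i $ 2 * y $ 2\<bar>"
      by (metis abs_mult power_abs)
    also have "\<dots> < N $ i $ 1 * \<bar>y $ 1\<bar> + N $ i $ 2 * \<bar>y $ 2\<bar>"
      unfolding N_def by (rule abs_add_mult_less[OF n n neg])
    finally show ?thesis .
  qed
  have vN: "v $ 1 * N $ 1 $ k + v $ 2 * N $ 2 $ k = \<rho> ^ n * v $ k" for k
    using arg_cong[OF left_mat_power[of n], of "\<lambda>x. x $ k"]
    by (simp add: N_def vector_matrix_mult_def sum_2 mult.commute)
  \<comment> \<open>Pairing the strict inequalities with the left eigenvector, for which v N =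
    \<rho>^n v, turns them into |\<mu>|^n S < \<rho>^n S.\<close>
  define S where "S = v $ 1 * \<bar>y $ 1\<bar> + v $ 2 * \<bar>y $ 2\<bar>"
  have S: "S > 0" using v y1 by (simp add: S_def add_pos_nonneg)
  have "\<bar>\<mu>\<bar> ^ n * S = v $ 1 * (\<bar>\<mu>\<bar> ^ n * \<bar>y $ 1\<bar>) + v $ 2 * (\<bar>\<mu>\<bar> ^ n * \<bar>y $ 2\<bar>)"
    by (simp add: S_def algebra_simps)
  also have "\<dots> < v $ 1 * (N $ 1 $ 1 * \<bar>y $ 1\<bar> + N $ 1 $ 2 * \<bar>y $ 2\<bar>) + v $ 2 * (N $ 2 $ 1 * \<bar>y $ 1\<bar> + N $ 2 $ 2 * \<bar>y $ 2\<bar>)"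
    by (intro add_strict_mono mult_strict_left_mono lt v)
  also have "\<dots> = (v $ 1 * N $ 1 $ 1 + v $ 2 * N $ 2 $ 1) * \<bar>y $ 1\<bar> + (v $ 1 * N $ 1 $ 2 + v $ 2 * N $ 2 $ 2) * \<bar>y $ 2\<bar>"
    by (simp add: algebra_simps)
  also have "\<dots> = \<rho> ^ n * S" unfolding vN by (simp add: S_def algebra_simps)
  finally have "\<bar>\<mu>\<bar> ^ n < \<rho> ^ n" using S by simp
  then have "\<bar>\<mu>\<bar> < \<rho>" by (rule power_less_imp_less_base) (use rho in simp)
  then show ?thesis using My by blast
qed

lemma inner_orthogonal_mult:
  assumes "M *v y = \<mu> *s y"
  shows "y \<bullet> (real_vec j v* M) = \<mu> * (y \<bullet> real_vec j)"
proof -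
  have "y \<bullet> (real_vec j v* M) = (M *v y) \<bullet> real_vec j"
    by (metis dot_lmul_matrix inner_commute)
  then show ?thesis by (simp add: assms scalar_mult_eq_scaleR)
qed

text \<open>The states whose relative skewness |y . x| / (u . x) exceeds b, written without
  division. For y orthogonal to v this measures how far the composition is from that of v.\<close>

definition skewed :: "real ^ 2 \<Rightarrow> real \<Rightarrow> (nat ^ 2) set" where
  "skewed y b = {x. \<bar>y \<bullet> real_vec x\<bar> > b * (u \<bullet> real_vec x)}"

text \<open>Up to errors \<delta>' (u . x), one step multiplies y . x by \<mu> and u . x by \<rho>,
  so the ratio b becomes at most (|\<mu>| b + \<delta>') / (\<rho> - \<delta>'). The lower bound b
  \<ge> \<eta> lets the additive error count as a multiple of b.\<close>

lemma skewed_contraction: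
  assumes My: "M *v y = \<mu> *s y" and \<mu>: "\<bar>\<mu>\<bar> < \<rho>" and \<eta>: "\<eta> > 0"
  shows "\<exists>q C. 0 < q \<and> q < 1 \<and> (\<forall>x b. x \<noteq> 0 \<longrightarrow> b \<ge> \<eta> \<longrightarrow> x \<notin> skewed y b \<longrightarrow>
    measure_pmf.prob (law x 1) (skewed y (q * b)) \<le> C * real (pop_size x) powr (- min s \<kappa>)) \<and> C \<ge> 0"
proof -
  define z where "z = \<bar>\<mu>\<bar> / \<rho>"
  \<comment> \<open>Strictly between |\<mu>| / \<rho> and 1, and positive even if \<mu> = 0.\<close>
  define q where "q = (z + 1) / 2"
  have "z < 1" "0 \<le> z" using \<mu> rho by (simp_all add: z_def)
  then have q: "0 < q" "q < 1" "z < q" by (simp_all add: q_def)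
  then have q\<rho>: "\<bar>\<mu>\<bar> < q * \<rho>" using rho by (simp add: z_def pos_divide_less_eq)
  \<comment> \<open>The solution of |\<mu>| + \<delta>' / \<eta> = q (\<rho> - \<delta>').\<close>
  define \<delta>' where "\<delta>' = (q * \<rho> - \<bar>\<mu>\<bar>) / (1 / \<eta> + q)"
  have \<delta>': "\<delta>' > 0" using q\<rho> q \<eta> by (simp add: \<delta>'_def add_pos_pos)
  have eq: "\<delta>' / \<eta> + q * \<delta>' = q * \<rho> - \<bar>\<mu>\<bar>"
  proof -
    have "\<delta>' * (1 / \<eta> + q) = q * \<rho> - \<bar>\<mu>\<bar>"
      using q \<eta> add_pos_pos[of "1 / \<eta>" q] by (simp add: \<delta>'_def)
    then show ?thesis by (simp add: algebra_simps)
  qed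
  have \<delta>\<rho>: "\<delta>' < \<rho>"
  proof -
    have "q * \<delta>' < q * \<rho>" using eq divide_pos_pos[OF \<delta>' \<eta>] by linarith
    then show ?thesis using q by simp
  qed
  define \<delta> where "\<delta> = \<delta>' * u_min"
  have \<delta>: "\<delta> > 0" using \<delta>' u_min_pos by (simp add: \<delta>_def)
  from concentration[OF \<delta>, of y] obtain C1 where C1: "C1 \<ge> 0" and c1: "\<And>j. j \<noteq> 0 \<Longrightarrow>
    measure_pmf.prob (law j 1) {x. \<bar>y \<bullet> real_vec x - y \<bullet> (real_vec j v* M)\<bar> > \<delta> * real (pop_size j)}
      \<le> C1 * real (pop_size j) powr (- min s \<kappa>)" by blast
  from concentration[OF \<delta>, of u] obtain C2 where C2: "C2 \<ge> 0" and c2: "\<And>j. j \<noteq> 0 \<Longrightarrow>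
    measure_pmf.prob (law j 1) {x. \<bar>u \<bullet> real_vec x - u \<bullet> (real_vec j v* M)\<bar> > \<delta> * real (pop_size j)}
      \<le> C2 * real (pop_size j) powr (- min s \<kappa>)" by blast
  have "measure_pmf.prob (law x 1) (skewed y (q * b)) \<le> (C1 + C2) * real (pop_size x) powr (- min s \<kappa>)"
    if x: "x \<noteq> 0" and b: "b \<ge> \<eta>" and nx: "x \<notin> skewed y b" for x b
  proof -
    let ?A = "{z. \<bar>y \<bullet> real_vec z - y \<bullet> (real_vec x v* M)\<bar> > \<delta> * real (pop_size x)}"
    let ?B = "{z. \<bar>u \<bullet> real_vec z - u \<bullet> (real_vec x v* M)\<bar> > \<delta> * real (pop_size x)}"
    define U where "U = u \<bullet> real_vec x"
    have U: "U > 0" unfolding U_def by (rule inner_u_pos[OF x])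
    have \<delta>U: "\<delta> * real (pop_size x) \<le> \<delta>' * U"
    proof -
      have "\<delta>' * (u_min * real (pop_size x)) \<le> \<delta>' * U"
        unfolding U_def using \<delta>' inner_u_ge[of x] by (intro mult_left_mono) auto
      then show ?thesis by (simp add: \<delta>_def mult.assoc)
    qed
    have b0: "b > 0" using b \<eta> by simp
    have "skewed y (q * b) \<subseteq> ?A \<union> ?B"
    proof
      fix z assume z: "z \<in> skewed y (q * b)"
      show "z \<in> ?A \<union> ?B"
      proof (rule ccontr)
        assume "z \<notin> ?A \<union> ?B"
        then have a1: "\<bar>y \<bullet> real_vec z - \<mu> * (y \<bullet> real_vec x)\<bar> \<le> \<delta>' * U"
          and a2: "\<bar>u \<bullet> real_vec z - \<rho> * U\<bar> \<le> \<delta>' * U"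
          using \<delta>U by (auto simp: inner_orthogonal_mult[OF My] inner_u_mult U_def)
        have "\<bar>\<mu> * (y \<bullet> real_vec x)\<bar> \<le> \<bar>\<mu>\<bar> * (b * U)"
          unfolding abs_mult using nx by (intro mult_left_mono) (auto simp: skewed_def U_def)
        then have "\<bar>y \<bullet> real_vec z\<bar> \<le> \<bar>\<mu>\<bar> * (b * U) + \<delta>' * U"
          using a1 by linarith
        also have "\<dots> \<le> \<bar>\<mu>\<bar> * (b * U) + (\<delta>' / \<eta>) * (b * U)"
        proof -
          have "\<delta>' * U * \<eta> \<le> \<delta>' * U * b" using \<delta>' U b by (intro mult_left_mono) auto
          then show ?thesis using \<eta> by (simp add: field_simps)
        qed
        also have "\<dots> = (\<bar>\<mu>\<bar> + \<delta>' / \<eta>) * (b * U)" by (simp add: distrib_right)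
        also have "\<bar>\<mu>\<bar> + \<delta>' / \<eta> = q * (\<rho> - \<delta>')" using eq by (simp add: algebra_simps)
        also have "q * (\<rho> - \<delta>') * (b * U) = q * b * ((\<rho> - \<delta>') * U)" by simp
        also have "\<dots> \<le> q * b * (u \<bullet> real_vec z)"
          using a2 q b0 by (intro mult_left_mono) (auto simp: left_diff_distrib)
        finally show False using z by (simp add: skewed_def)
      qed
    qed
    then have "measure_pmf.prob (law x 1) (skewed y (q * b)) \<le> measure_pmf.prob (law x 1) (?A \<union> ?B)"
      by (intro measure_pmf.finite_measure_mono) auto
    also have "\<dots> \<le> measure_pmf.prob (law x 1) ?A + measure_pmf.prob (law x 1) ?B"
      by (rule measure_Un_le) auto
    also have "\<dots> \<le> (C1 + C2) * real (pop_size x) powr (- min s \<kappa>)"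
      using c1[OF x] c2[OF x] by (simp add: distrib_right)
    finally show ?thesis .
  qed
  then show ?thesis using q C1 C2 by (intro exI[of _ q] exI[of _ "C1 + C2"]) auto
qed

text \<open>The threshold shrinks by the factor q in each step until it reaches \<eta>. The failure
  probabilities add up, and each is O(|j|^(-d)) because the size never falls below |j|.\<close>

lemma skewed_iterate:
  assumes q: "0 < q" "q < 1" and C: "C \<ge> 0" and \<eta>: "\<eta> > 0"
    and step: "\<And>x b. x \<noteq> 0 \<Longrightarrow> b \<ge> \<eta> \<Longrightarrow> x \<notin> skewed y b \<Longrightarrow>
      measure_pmf.prob (law x 1) (skewed y (q * b)) \<le> C * real (pop_size x) powr (- min s \<kappa>)"
    and b0: "\<And>x. x \<notin> skewed y b0" and j: "j \<noteq> 0"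
  shows "measure_pmf.prob (law j t) (skewed y (max (q ^ t * b0) \<eta>)) \<le> real t * C * real (pop_size j) powr (- min s \<kappa>)"
proof (induction t)
  case 0
  have "j \<notin> skewed y (max b0 \<eta>)"
  proof
    assume "j \<in> skewed y (max b0 \<eta>)"
    moreover have "b0 * (u \<bullet> real_vec j) \<le> max b0 \<eta> * (u \<bullet> real_vec j)"
      using inner_u_pos[OF j] by (intro mult_right_mono) auto
    ultimately have "j \<in> skewed y b0" by (simp add: skewed_def)
    then show False using b0 by blast
  qed
  then show ?case by (simp add: law_0)
next
  case (Suc t)
  let ?b = "max (q ^ t * b0) \<eta>" and ?b' = "max (q ^ Suc t * b0) \<eta>"
  let ?c = "C * real (pop_size j) powr (- min s \<kappa>)"
  have c0: "?c \<ge> 0" using C by simp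
  have bb: "q * ?b \<le> ?b'"
  proof -
    have "q * \<eta> \<le> 1 * \<eta>" using q \<eta> by (intro mult_right_mono) auto
    then have "q * \<eta> \<le> ?b'" by simp
    moreover have "q * (q ^ t * b0) \<le> ?b'" by simp
    moreover have "?b = q ^ t * b0 \<or> ?b = \<eta>" by (simp add: max_def)
    ultimately show ?thesis by (elim disjE) (simp_all only:)
  qed
  have sub: "measure_pmf.prob (law x 1) (skewed y ?b') \<le> measure_pmf.prob (law x 1) (skewed y (q * ?b))" for x
  proof (rule measure_pmf.finite_measure_mono_AE)
    have "z \<in> skewed y (q * ?b)" if "z \<in> skewed y ?b'" for z
    proof -
      have "0 \<le> u \<bullet> real_vec z" using inner_u_pos[of z] by (cases "z = 0") auto
      then have "q * ?b * (u \<bullet> real_vec z) \<le> ?b' * (u \<bullet> real_vec z)"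
        by (intro mult_right_mono bb)
      then show ?thesis using that unfolding skewed_def by simp
    qed
    then show "AE z in law x 1. z \<in> skewed y ?b' \<longrightarrow> z \<in> skewed y (q * ?b)" by simp
  qed simp
  have "measure_pmf.prob (law j (Suc t)) (skewed y ?b')
      = measure_pmf.expectation (law j t) (\<lambda>x. measure_pmf.prob (law x 1) (skewed y ?b'))"
    unfolding law_Suc[of j t] by (rule prob_bind_pmf)
  also have "\<dots> \<le> measure_pmf.expectation (law j t) (\<lambda>x. indicator (skewed y ?b) x + ?c)"
  proof (rule integral_mono_AE)
    show "integrable (measure_pmf (law j t)) (\<lambda>x. measure_pmf.prob (law x 1) (skewed y ?b'))"
      by (rule measure_pmf.integrable_const_bound[where B = 1]) auto
    have "integrable (measure_pmf (law j t)) (indicator (skewed y ?b) :: _ \<Rightarrow> real)"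
      by (rule measure_pmf.integrable_const_bound[where B = 1]) auto
    then show "integrable (measure_pmf (law j t)) (\<lambda>x. indicator (skewed y ?b) x + ?c)" by simp
    have "measure_pmf.prob (law x 1) (skewed y ?b') \<le> indicator (skewed y ?b) x + ?c" if x: "x \<in> set_pmf (law j t)" for x
    proof (cases "x \<in> skewed y ?b")
      case True
      then show ?thesis using c0 measure_pmf.prob_le_1[of "law x 1" "skewed y ?b'"] by (simp add: add_increasing2)
    next
      case False
      have sz: "pop_size j \<le> pop_size x" by (rule pop_size_le_of_law[OF x])
      then have x0: "x \<noteq> 0" using j by (auto simp flip: pop_size_pos_iff)
      have "measure_pmf.prob (law x 1) (skewed y (q * ?b)) \<le> C * real (pop_size x) powr (- min s \<kappa>)"
        by (rule step[OF x0 _ False]) simp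
      also have "\<dots> \<le> ?c"
        using C sz j s_ge_1 kappa_ge_1 by (intro mult_left_mono powr_mono2') auto
      finally show ?thesis using sub[of x] False by simp
    qed
    then show "AE x in law j t. measure_pmf.prob (law x 1) (skewed y ?b') \<le> indicator (skewed y ?b) x + ?c"
      by (simp add: AE_measure_pmf_iff)
  qed
  also have "\<dots> = measure_pmf.prob (law j t) (skewed y ?b) + ?c"
  proof -
    have "integrable (measure_pmf (law j t)) (indicator (skewed y ?b) :: _ \<Rightarrow> real)"
      by (rule measure_pmf.integrable_const_bound[where B = 1]) auto
    then show ?thesis by simp
  qed
  also have "\<dots> \<le> real t * C * real (pop_size j) powr (- min s \<kappa>) + ?c" using Suc by simp
  also have "\<dots> = real (Suc t) * C * real (pop_size j) powr (- min s \<kappa>)" by (simp add: algebra_simps)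
  finally show ?case .
qed

lemma type_ratio_deviation:
  assumes \<epsilon>: "\<epsilon> > 0"
  shows "\<exists>k0>0. \<exists>C. \<forall>j. j \<noteq> 0 \<longrightarrow>
    measure_pmf.prob (law j k0) {x. \<bar>l \<bullet> real_vec x / (1 \<bullet> real_vec x) - l \<bullet> v / (1 \<bullet> v)\<bar> > \<epsilon>}
      \<le> C * real (pop_size j) powr (- min s \<kappa>)"
proof -
  define \<theta> where "\<theta> = l \<bullet> v / (1 \<bullet> v)"
  \<comment> \<open>Subtracting \<theta> times the all-ones vector makes y orthogonal to v, and y .
    x / |x| is exactly the deviation to be estimated.\<close>
  define y where "y = l - \<theta> *\<^sub>R 1"
  have v1: "1 \<bullet> v > 0" using v_pos[of 1] v_pos[of 2] by (simp add: inner_vec_def sum_2)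
  have "v \<bullet> y = 0"
    using v1 by (simp add: y_def \<theta>_def inner_diff_right inner_commute)
  from second_eigenvalue[OF this] obtain \<mu> where \<mu>: "\<bar>\<mu>\<bar> < \<rho>" "M *v y = \<mu> *s y" by blast
  \<comment> \<open>Since u . x \<le> u_max |x|, a deviation above \<epsilon> forces a skewness
    above \<eta>.\<close>
  define \<eta> where "\<eta> = \<epsilon> / u_max"
  have \<eta>: "\<eta> > 0" using \<epsilon> u_max_pos by (simp add: \<eta>_def)
  from skewed_contraction[OF \<mu>(2,1) \<eta>] obtain q C where q: "0 < q" "q < 1" and C: "C \<ge> 0"
    and step: "\<And>x b. x \<noteq> 0 \<Longrightarrow> b \<ge> \<eta> \<Longrightarrow> x \<notin> skewed y b \<Longrightarrow>
      measure_pmf.prob (law x 1) (skewed y (q * b)) \<le> C * real (pop_size x) powr (- min s \<kappa>)" by blast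
  \<comment> \<open>A skewness that no state exceeds, so the iteration may start from any j.\<close>
  define b0 where "b0 = (\<Sum>k\<in>UNIV. \<bar>y $ k\<bar>) / u_min"
  have b0: "x \<notin> skewed y b0" for x
  proof -
    have "\<bar>y \<bullet> real_vec x\<bar> \<le> b0 * (u_min * real (pop_size x))"
      using abs_inner_real_vec_le[of y x] u_min_pos by (simp add: b0_def)
    also have "\<dots> \<le> b0 * (u \<bullet> real_vec x)"
      using u_min_pos by (intro mult_left_mono inner_u_ge) (simp add: b0_def sum_nonneg)
    finally show ?thesis by (simp add: skewed_def)
  qed
  have "(\<lambda>t. q ^ t * b0) \<longlonglongrightarrow> 0 * b0"
    using q by (intro tendsto_mult tendsto_const LIMSEQ_power_zero) auto
  then have "\<forall>\<^sub>F t in sequentially. q ^ t * b0 < \<eta>"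
    using \<eta> by (intro order_tendstoD(2)[of _ "0 * b0"]) auto
  then obtain t where t: "\<And>n. n \<ge> t \<Longrightarrow> q ^ n * b0 < \<eta>" by (auto simp: eventually_sequentially)
  \<comment> \<open>The same for all j, as b0 bounds the initial skewness of every state. The
    successor ensures k0 > 0.\<close>
  define k0 where "k0 = Suc t"
  have max: "max (q ^ k0 * b0) \<eta> = \<eta>" using t[of k0] by (simp add: k0_def)
  have "measure_pmf.prob (law j k0) {x. \<bar>l \<bullet> real_vec x / (1 \<bullet> real_vec x) - l \<bullet> v / (1 \<bullet> v)\<bar> > \<epsilon>}
      \<le> real k0 * C * real (pop_size j) powr (- min s \<kappa>)" if j: "j \<noteq> 0" for j
  proof -
    have "x \<in> skewed y \<eta>" if x: "x \<in> set_pmf (law j k0)"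
      and dev: "\<bar>l \<bullet> real_vec x / (1 \<bullet> real_vec x) - \<theta>\<bar> > \<epsilon>" for x
    proof -
      have "pop_size j \<le> pop_size x" by (rule pop_size_le_of_law[OF x])
      then have n: "real (pop_size x) > 0" using j by (auto simp flip: pop_size_pos_iff)
      have "\<eta> * (u \<bullet> real_vec x) \<le> \<eta> * (u_max * real (pop_size x))"
        using \<eta> by (intro mult_left_mono inner_u_le) auto
      also have "\<dots> = \<epsilon> * real (pop_size x)" using u_max_pos by (simp add: \<eta>_def)
      also have "\<dots> < \<bar>l \<bullet> real_vec x / (1 \<bullet> real_vec x) - \<theta>\<bar> * real (pop_size x)"
        using n dev by (intro mult_strict_right_mono)
      also have "\<dots> = \<bar>(l \<bullet> real_vec x / real (pop_size x) - \<theta>) * real (pop_size x)\<bar>"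
        by (simp add: abs_mult inner_one_real_vec)
      also have "(l \<bullet> real_vec x / real (pop_size x) - \<theta>) * real (pop_size x) = y \<bullet> real_vec x"
        using n by (simp add: y_def inner_diff_left inner_one_real_vec left_diff_distrib)
      finally show ?thesis by (simp add: skewed_def)
    qed
    then have "measure_pmf.prob (law j k0) {x. \<bar>l \<bullet> real_vec x / (1 \<bullet> real_vec x) - \<theta>\<bar> > \<epsilon>}
        \<le> measure_pmf.prob (law j k0) (skewed y \<eta>)"
      by (intro measure_pmf.finite_measure_mono_AE) (auto simp: AE_measure_pmf_iff)
    also have "\<dots> \<le> real k0 * C * real (pop_size j) powr (- min s \<kappa>)"
      using skewed_iterate[OF q C \<eta> step b0 j, of k0] unfolding max by simp
    finally show ?thesis by (simp add: \<theta>_def)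
  qed
  then show ?thesis by (intro exI[of _ k0] conjI exI[of _ "real k0 * C"]) (auto simp: k0_def)
qed

section \<open>The two limits as scaled expectations\<close>

lemma one_step_limit:
  fixes l :: "real ^ 2"
  assumes \<epsilon>: "\<epsilon> > 0"
  defines "\<phi> \<equiv> \<lambda>j. measure_pmf.prob (law j 1) {x. \<bar>l \<bullet> real_vec x - l \<bullet> (real_vec j v* M)\<bar> > \<epsilon> * (1 \<bullet> real_vec j)}"
  shows "(\<lambda>j. \<phi> j * lim (\<lambda>n. scaled i n j)) summable_on (UNIV - {0})"
    and "(\<lambda>n. prob {\<omega> \<in> space \<Omega>.
        \<bar>l \<bullet> real_vec (X_proc \<xi> I (axis i 1) (Suc n) \<omega>) / (1 \<bullet> real_vec (X_proc \<xi> I (axis i 1) n \<omega>))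
          - l \<bullet> (real_vec (X_proc \<xi> I (axis i 1) n \<omega>) v* M) / (1 \<bullet> real_vec (X_proc \<xi> I (axis i 1) n \<omega>))\<bar> > \<epsilon>}
        / (h0 * \<gamma>) ^ n)
      \<longlonglongrightarrow> (\<Sum>\<^sub>\<infinity>j\<in>UNIV - {0}. \<phi> j * lim (\<lambda>n. scaled i n j))"
proof -
  from concentration[OF \<epsilon>, of l] obtain C where C: "\<And>j. j \<noteq> 0 \<Longrightarrow> \<phi> j \<le> C * real (pop_size j) powr (- min s \<kappa>)"
    unfolding \<phi>_def inner_one_real_vec by blast
  note lim = scaled_expectation_limit[of \<phi> C i, OF _ _ C]
  have \<phi>01: "0 \<le> \<phi> j" "\<phi> j \<le> 1" for j by (auto simp: \<phi>_def)
  show "(\<lambda>j. \<phi> j * lim (\<lambda>n. scaled i n j)) summable_on (UNIV - {0})"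
    by (rule lim(1)[OF \<phi>01])
  \<comment> \<open>The event depends on the present state. As X_n is almost surely nonzero, its
    denominators can be cleared, which turns the conditional probability into \<phi>.\<close>
  define E where "E = (\<lambda>a. {x. \<bar>l \<bullet> real_vec x / (1 \<bullet> real_vec a) - l \<bullet> (real_vec a v* M) / (1 \<bullet> real_vec a)\<bar> > \<epsilon>})"
  have "prob {\<omega> \<in> space \<Omega>. X_proc \<xi> I (axis i 1) (Suc n) \<omega> \<in> E (X_proc \<xi> I (axis i 1) n \<omega>)}
      = measure_pmf.expectation (law (axis i 1) n) \<phi>" for n
    unfolding prob_joint
  proof (rule integral_cong_AE)
    have "measure_pmf.prob (law a 1) (E a) = \<phi> a" if "a \<in> set_pmf (law (axis i 1) n)" for a
    proof -
      have a: "real (pop_size a) > 0" using law_axis_nonzero[OF that] by simp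
      have "\<bar>l \<bullet> real_vec x / real (pop_size a) - l \<bullet> (real_vec a v* M) / real (pop_size a)\<bar> > \<epsilon>
         \<longleftrightarrow> \<bar>l \<bullet> real_vec x - l \<bullet> (real_vec a v* M)\<bar> > \<epsilon> * real (pop_size a)" for x
        using a by (simp add: diff_divide_distrib[symmetric] pos_less_divide_eq)
      then show ?thesis by (simp add: E_def \<phi>_def inner_one_real_vec)
    qed
    then show "AE a in law (axis i 1) n. measure_pmf.prob (law a 1) (E a) = \<phi> a"
      by (simp add: AE_measure_pmf_iff)
  qed simp_all
  then show "(\<lambda>n. prob {\<omega> \<in> space \<Omega>.
        \<bar>l \<bullet> real_vec (X_proc \<xi> I (axis i 1) (Suc n) \<omega>) / (1 \<bullet> real_vec (X_proc \<xi> I (axis i 1) n \<omega>))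
          - l \<bullet> (real_vec (X_proc \<xi> I (axis i 1) n \<omega>) v* M) / (1 \<bullet> real_vec (X_proc \<xi> I (axis i 1) n \<omega>))\<bar> > \<epsilon>}
        / (h0 * \<gamma>) ^ n)
      \<longlonglongrightarrow> (\<Sum>\<^sub>\<infinity>j\<in>UNIV - {0}. \<phi> j * lim (\<lambda>n. scaled i n j))"
    using lim(2)[OF \<phi>01] unfolding E_def mem_Collect_eq by simp
qed

text \<open>By the Markov property the last k0 of n + k0 steps are integrated out, which leaves an
  expectation at time n. Scaling at time n + k0 instead of n produces the factor (h0
  \<gamma>)^(-k0).\<close>

lemma type_ratio_limit:
  fixes l :: "real ^ 2"
  assumes \<epsilon>: "\<epsilon> > 0"
  defines "E \<equiv> {x. \<bar>l \<bullet> real_vec x / (1 \<bullet> real_vec x) - l \<bullet> v / (1 \<bullet> v)\<bar> > \<epsilon>}"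
  shows "\<exists>k0>0. (\<lambda>j. measure_pmf.prob (law j k0) E * lim (\<lambda>n. scaled i n j)) summable_on (UNIV - {0}) \<and>
    (\<lambda>n. measure_pmf.prob (law (axis i 1) n) E / (h0 * \<gamma>) ^ n)
      \<longlonglongrightarrow> (\<Sum>\<^sub>\<infinity>j\<in>UNIV - {0}. measure_pmf.prob (law j k0) E * lim (\<lambda>n. scaled i n j)) / (h0 * \<gamma>) ^ k0"
proof -
  from type_ratio_deviation[OF \<epsilon>, of l] obtain k0 C where k0: "k0 > 0"
    and C: "\<And>j. j \<noteq> 0 \<Longrightarrow> measure_pmf.prob (law j k0) E \<le> C * real (pop_size j) powr (- min s \<kappa>)"
    unfolding E_def by blast
  note lim = scaled_expectation_limit[where \<psi> = "\<lambda>j. measure_pmf.prob (law j k0) E" and C = C and i = i, OF _ _ C]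
  have "(\<lambda>n. measure_pmf.expectation (law (axis i 1) n) (\<lambda>j. measure_pmf.prob (law j k0) E) / (h0 * \<gamma>) ^ n / (h0 * \<gamma>) ^ k0)
    \<longlonglongrightarrow> (\<Sum>\<^sub>\<infinity>j\<in>UNIV - {0}. measure_pmf.prob (law j k0) E * lim (\<lambda>n. scaled i n j)) / (h0 * \<gamma>) ^ k0"
    by (intro tendsto_divide lim(2) tendsto_const) (use decay_pos in auto)
  moreover have "measure_pmf.expectation (law (axis i 1) n) (\<lambda>j. measure_pmf.prob (law j k0) E) / (h0 * \<gamma>) ^ n / (h0 * \<gamma>) ^ k0
      = measure_pmf.prob (law (axis i 1) (n + k0)) E / (h0 * \<gamma>) ^ (n + k0)" for n
    unfolding law_add prob_bind_pmf by (simp add: power_add)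
  ultimately have "(\<lambda>n. measure_pmf.prob (law (axis i 1) (n + k0)) E / (h0 * \<gamma>) ^ (n + k0))
    \<longlonglongrightarrow> (\<Sum>\<^sub>\<infinity>j\<in>UNIV - {0}. measure_pmf.prob (law j k0) E * lim (\<lambda>n. scaled i n j)) / (h0 * \<gamma>) ^ k0"
    by (simp only:)
  then have "(\<lambda>n. measure_pmf.prob (law (axis i 1) n) E / (h0 * \<gamma>) ^ n)
      \<longlonglongrightarrow> (\<Sum>\<^sub>\<infinity>j\<in>UNIV - {0}. measure_pmf.prob (law j k0) E * lim (\<lambda>n. scaled i n j)) / (h0 * \<gamma>) ^ k0"
    by (rule LIMSEQ_offset)
  moreover have "(\<lambda>j. measure_pmf.prob (law j k0) E * lim (\<lambda>n. scaled i n j)) summable_on (UNIV - {0})"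
    by (rule lim(1)) auto
  ultimately show ?thesis using k0 by blast
qed

end


theorem theorem1p2:
  fixes \<Omega> :: "'w measure"
    and P :: "2 \<Rightarrow> (nat ^ 2) pmf"
    and \<xi> :: "nat \<Rightarrow> nat \<Rightarrow> 2 \<Rightarrow> nat \<Rightarrow> 'w \<Rightarrow> nat ^ 2"
    and I :: "nat \<Rightarrow> 'w \<Rightarrow> nat ^ 2"
    and M A P0 :: "real ^ 2 ^ 2"
    and \<rho> h0 \<gamma> s \<kappa> d \<epsilon> :: real
    and u v l :: "real ^ 2"
    and i :: 2
    and X Z :: "nat ^ 2 \<Rightarrow> nat \<Rightarrow> 'w \<Rightarrow> nat ^ 2"
    and \<phi> :: "nat ^ 2 \<Rightarrow> real \<Rightarrow> real"
    and \<phi>h :: "nat ^ 2 \<Rightarrow> nat \<Rightarrow> real \<Rightarrow> real"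
    and r :: "2 \<Rightarrow> nat ^ 2 \<Rightarrow> real"
  assumes process: "branching_with_immigration \<Omega> P \<xi> I"
    and Z_def: "Z = Z_proc \<xi>"
    and X_def: "X = X_proc \<xi> I"
    and f0: "\<And>k. offspring_gf P k 0 = 0"
    and M: "is_mean_matrix P M" "positively_regular M"
    and rho: "maximal_eigenvalue M \<rho>" "\<rho> > 1"
    and left_ev: "v v* M = \<rho> *s v" "\<And>k. v $ k > 0"
    and right_ev: "M *v u = \<rho> *s u" "\<And>k. u $ k > 0"
    and normalization: "v \<bullet> u = 1" "u \<bullet> 1 = 1"
    and h0: "h0 = \<P>(\<omega> in \<Omega>. I 1 \<omega> = 0)" "h0 > 0"
    and A_def: "A = derivative_matrix P 0"
    and gamma: "0 < \<gamma>" "\<gamma> < 1"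
    and A_limit: "(\<lambda>n. mat_power A n /\<^sub>R \<gamma> ^ n) \<longlonglongrightarrow> P0" "P0 \<noteq> 0"
    and s: "s \<ge> 1"
    and kappa: "\<kappa> \<ge> 1"
    and offspring_moment:
      "\<And>k. integrable \<Omega> (\<lambda>\<omega>. (1 \<bullet> real_vec (Z (axis k 1) 1 \<omega>)) powr (2 * s))"
    and immigration_moment: "integrable \<Omega> (\<lambda>\<omega>. (1 \<bullet> real_vec (I 1 \<omega>)) powr \<kappa>)"
    and d: "d = min s \<kappa>" "h0 * \<gamma> * \<rho> powr d > 1"
    and l: "l \<noteq> 0" "l $ 1 \<noteq> l $ 2"
    and eps: "\<epsilon> > 0"
    and \<phi>_def: "\<And>j e. \<phi> j e =
      \<P>(\<omega> in \<Omega>. \<bar>l \<bullet> real_vec (X j 1 \<omega>) - l \<bullet> (real_vec j v* M)\<bar> > e * (1 \<bullet> real_vec j))"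
    and \<phi>h_def: "\<And>j k e. \<phi>h j k e =
      \<P>(\<omega> in \<Omega>. \<bar>l \<bullet> real_vec (X j k \<omega>) / (1 \<bullet> real_vec (X j k \<omega>)) - l \<bullet> v / (1 \<bullet> v)\<bar> > e)"
    and r_def: "\<And>k j. r k j = lim (\<lambda>n. \<P>(\<omega> in \<Omega>. X (axis k 1) n \<omega> = j) / (h0 * \<gamma>) ^ n)"
  shows "(\<forall>j. convergent (\<lambda>n. \<P>(\<omega> in \<Omega>. X (axis i 1) n \<omega> = j) / (h0 * \<gamma>) ^ n)) \<and>
    (\<lambda>j. \<phi> j \<epsilon> * r i j) summable_on (UNIV - {0}) \<and>
    (\<lambda>n. \<P>(\<omega> in \<Omega>.
        \<bar>l \<bullet> real_vec (X (axis i 1) (Suc n) \<omega>) / (1 \<bullet> real_vec (X (axis i 1) n \<omega>))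
          - l \<bullet> (real_vec (X (axis i 1) n \<omega>) v* M) / (1 \<bullet> real_vec (X (axis i 1) n \<omega>))\<bar> > \<epsilon>)
        / (h0 * \<gamma>) ^ n)
      \<longlonglongrightarrow> (\<Sum>\<^sub>\<infinity>j\<in>UNIV - {0}. \<phi> j \<epsilon> * r i j) \<and>
    (\<exists>k0 > 0.
      (\<lambda>j. \<phi>h j k0 \<epsilon> * r i j) summable_on (UNIV - {0}) \<and>
      (\<lambda>n. \<P>(\<omega> in \<Omega>.
          \<bar>l \<bullet> real_vec (X (axis i 1) n \<omega>) / (1 \<bullet> real_vec (X (axis i 1) n \<omega>))
            - l \<bullet> v / (1 \<bullet> v)\<bar> > \<epsilon>)
          / (h0 * \<gamma>) ^ n)
        \<longlonglongrightarrow> (\<Sum>\<^sub>\<infinity>j\<in>UNIV - {0}. \<phi>h j k0 \<epsilon> * r i j) / (h0 * \<gamma>) ^ k0)"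
proof -
  interpret branching_with_immigration \<Omega> P \<xi> I by (rule process)
  have off: "integrable (measure_pmf (P k)) (\<lambda>x. real (pop_size x) powr (2 * s))" for k
  proof -
    have "integrable \<Omega> (\<lambda>\<omega>. real (pop_size (\<xi> 0 0 k 0 \<omega>)) powr (2 * s))"
      using offspring_moment[of k] unfolding Z_def Z_proc_axis_1 inner_one_real_vec .
    then have "integrable (distr \<Omega> (count_space UNIV) (\<xi> 0 0 k 0)) (\<lambda>x. real (pop_size x) powr (2 * s))"
      by (subst integrable_distr_eq[OF measurable_offspring]) simp_all
    then show ?thesis unfolding offspring_law .
  qed
  \<comment> \<open>Second moments exist since 2s \<ge> 2; they justify differentiating the
    generating functions under the expectation.\<close>
  have sq: "integrable (measure_pmf (P k)) (\<lambda>x. (real (x $ m))\<^sup>2)" for k m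
  proof (rule Bochner_Integration.integrable_bound)
    show "integrable (measure_pmf (P k)) (\<lambda>x. real (pop_size x) powr 2)"
      using measure_pmf.integrable_powr_le[of "P k" "\<lambda>x. real (pop_size x)" "2 * s" 2] off[of k] s by simp
    have "norm ((real (x $ m))\<^sup>2) \<le> norm (real (pop_size x) powr 2)" for x
      using component_le_pop_size[of x m] by simp
    then show "AE x in measure_pmf (P k). norm ((real (x $ m))\<^sup>2) \<le> norm (real (pop_size x) powr 2)"
      by simp
  qed simp
  interpret supercritical_branching \<Omega> P \<xi> I M A s \<kappa> h0 \<gamma> \<rho> P0 u v
  proof
    show "pmf (P k) 0 = 0" for k
      using f0[of k] by (simp add: offspring_gf_0)
    show "M $ k $ m = measure_pmf.expectation (P k) (\<lambda>x. real (x $ m))" for k m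
      by (rule mean_matrix_eq[OF M(1) sq])
    show "A $ k $ m = pmf (P k) (axis m 1)" for k m
      unfolding A_def by (rule derivative_matrix_0[OF sq])
    show "integrable (measure_pmf (P k)) (\<lambda>x. real (pop_size x) powr (2 * s))" for k
      by (rule off)
    show "integrable \<Omega> (\<lambda>\<omega>. real (pop_size (I 1 \<omega>)) powr \<kappa>)"
      using immigration_moment unfolding inner_one_real_vec .
    show "h0 * \<gamma> * \<rho> powr min s \<kappa> > 1"
      using d(2) unfolding d(1) .
  qed (use s kappa h0 gamma A_limit(1) rho(2) left_ev right_ev M(2) in auto)
  have scaled: "\<P>(\<omega> in \<Omega>. X (axis k 1) n \<omega> = j) / (h0 * \<gamma>) ^ n = scaled k n j" for k n j
    by (simp add: scaled_def pmf_law X_def)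
  \<comment> \<open>Each \<open>lim\<close> is a genuine limit, by
    \<open>convergent_scaled\<close>.\<close>
  have r: "r i = (\<lambda>j. lim (\<lambda>n. scaled i n j))"
    by (rule ext) (simp only: r_def scaled)
  have \<phi>: "\<phi> j \<epsilon> = measure_pmf.prob (law j 1) {x. \<bar>l \<bullet> real_vec x - l \<bullet> (real_vec j v* M)\<bar> > \<epsilon> * (1 \<bullet> real_vec j)}" for j
    unfolding \<phi>_def X_def prob_law mem_Collect_eq ..
  have \<phi>h: "\<phi>h j k \<epsilon> = measure_pmf.prob (law j k) {x. \<bar>l \<bullet> real_vec x / (1 \<bullet> real_vec x) - l \<bullet> v / (1 \<bullet> v)\<bar> > \<epsilon>}" for j k
    unfolding \<phi>h_def X_def prob_law mem_Collect_eq ..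
  have ratio: "\<P>(\<omega> in \<Omega>. \<bar>l \<bullet> real_vec (X (axis i 1) n \<omega>) / (1 \<bullet> real_vec (X (axis i 1) n \<omega>)) - l \<bullet> v / (1 \<bullet> v)\<bar> > \<epsilon>)
     = measure_pmf.prob (law (axis i 1) n) {x. \<bar>l \<bullet> real_vec x / (1 \<bullet> real_vec x) - l \<bullet> v / (1 \<bullet> v)\<bar> > \<epsilon>}" for n
    unfolding X_def prob_law mem_Collect_eq ..
  show ?thesis
    unfolding scaled \<phi> \<phi>h ratio r
    unfolding X_def
    by (intro conjI allI convergent_scaled one_step_limit type_ratio_limit eps)
qed

end
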